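(* Let $R$ be a reduced root system in $\mathbb{R}^m$ with positive subsystem $R_+$, associated finite reflection group $W$ and positive Weyl chamber $C$, and let $k:R\to\mathbb{R}$ be a $W$-invariant function with $k(\alpha)>0$ for all $\alpha\in R_+$. Define $$\Phi(x) = -\sum_{\alpha\in R_+}k(\alpha)\ln(\langle\alpha,x\rangle),\qquad x\in C.$$ Then the stochastic differential equation $$dX_t = dB_t-\nabla\Phi(X_t)\,dt,\qquad X_0\in C,\quad t\ge 0,$$ where $X$ is an adapted continuous process valued in $\overline{C}$ and $B$ is a Brownian motion in $\mathbb{R}^m$, has a unique strong solution (defined for all $t\ge 0$).
   Context: A reduced root system $R$ in a Euclidean space $V$ of dimension $m$ (identified with $\mathbb{R}^m$) is a finite set of nonzero vectors spanning $V$ such that $R\cap\mathbb{R}\alpha=\{\alpha,-\alpha\}$ and $\sigma_\alpha(R)=R$ for all $\alpha\in R$, where $\sigma_\alpha(x)=x-2\frac{\langle\alpha,x\rangle}{\langle\alpha,\alpha\rangle}\alpha$. The group $W$ is generated by the reflections $\sigma_\alpha$, $\alpha\in R$. A simple system $\Delta\subset R$ is a basis of $V$ such that each root is a linear combination of elements of $\Delta$ with coefficients all of the same sign; $R_+$ is the set of roots that are nonnegative combinations of $\Delta$. The positive Weyl chamber is $C=\{x\in V:\langle\alpha,x\rangle>0\ \forall\alpha\in R_+\}$ and $\overline{C}$ is its closure. The equation is understood in integral form: $X_t=X_0+B_t-\int_0^t\nabla\Phi(X_s)\,ds$, where the drift is integrated over times $s$ at which $X_s\in C$ (where $\nabla\Phi$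 is defined) and the integral is required to converge absolutely. *)

theory Defs
  imports "HOL-Probability.Probability"
begin

definition reflection :: "'a::euclidean_space \<Rightarrow> 'a \<Rightarrow> 'a" where
  "reflection \<alpha> x = x - (2 * (\<alpha> \<bullet> x) / (\<alpha> \<bullet> \<alpha>)) *\<^sub>R \<alpha>"

definition reduced_root_system :: "'a::euclidean_space set \<Rightarrow> bool" where
  "reduced_root_system R \<longleftrightarrow>
     finite R \<and> 0 \<notin> R \<and> span R = UNIV \<and>
     (\<forall>\<alpha>\<in>R. R \<inter> range (\<lambda>c. c *\<^sub>R \<alpha>) = {\<alpha>, - \<alpha>}) \<and>
     (\<forall>\<alpha>\<in>R. reflection \<alpha> ` R = R)"

inductive_set reflection_group :: "'a::euclidean_space set \<Rightarrow> ('a \<Rightarrow> 'a) set"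
  for R where
  id: "id \<in> reflection_group R"
| gen: "\<alpha> \<in> R \<Longrightarrow> reflection \<alpha> \<in> reflection_group R"
| comp: "v \<in> reflection_group R \<Longrightarrow> w \<in> reflection_group R \<Longrightarrow> v \<circ> w \<in> reflection_group R"
| inv: "w \<in> reflection_group R \<Longrightarrow> inv w \<in> reflection_group R"

definition simple_system :: "'a::euclidean_space set \<Rightarrow> 'a set \<Rightarrow> bool" where
  "simple_system R \<Delta> \<longleftrightarrow>
     \<Delta> \<subseteq> R \<and> independent \<Delta> \<and> span \<Delta> = UNIV \<and>
     (\<forall>\<beta>\<in>R. \<exists>c. \<beta> = (\<Sum>\<delta>\<in>\<Delta>. c \<delta> *\<^sub>R \<delta>) \<and>
        ((\<forall>\<delta>\<in>\<Delta>. 0 \<le> c \<delta>) \<or> (\<forall>\<delta>\<in>\<Delta>. c \<delta> \<le> 0)))"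

definition positive_roots :: "'a::euclidean_space set \<Rightarrow> 'a set \<Rightarrow> 'a set" where
  "positive_roots R \<Delta> =
     {\<beta>\<in>R. \<exists>c. \<beta> = (\<Sum>\<delta>\<in>\<Delta>. c \<delta> *\<^sub>R \<delta>) \<and> (\<forall>\<delta>\<in>\<Delta>. 0 \<le> c \<delta>)}"

definition weyl_chamber :: "'a::euclidean_space set \<Rightarrow> 'a set" where
  "weyl_chamber Rp = {x. \<forall>\<alpha>\<in>Rp. 0 < \<alpha> \<bullet> x}"

definition Phi :: "('a::euclidean_space \<Rightarrow> real) \<Rightarrow> 'a set \<Rightarrow> 'a \<Rightarrow> real" where
  "Phi k Rp x = - (\<Sum>\<alpha>\<in>Rp. k \<alpha> * ln (\<alpha> \<bullet> x))"

definition grad :: "('a::euclidean_space \<Rightarrow> real) \<Rightarrow> 'a \<Rightarrow> 'a" where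
  "grad f x = (THE D. GDERIV f x :> D)"

text \<open>Filtrations are indexed by \<^typ>\<open>real\<close>, but only times \<open>t \<ge> 0\<close> matter.\<close>

definition filtration_on :: "'w measure \<Rightarrow> (real \<Rightarrow> 'w measure) \<Rightarrow> bool" where
  "filtration_on M F \<longleftrightarrow>
     (\<forall>t\<ge>0. subalgebra M (F t)) \<and>
     (\<forall>s t. 0 \<le> s \<longrightarrow> s \<le> t \<longrightarrow> sets (F s) \<subseteq> sets (F t))"

definition augmented :: "'w measure \<Rightarrow> (real \<Rightarrow> 'w measure) \<Rightarrow> real \<Rightarrow> 'w measure" where
  "augmented M F t = sigma (space M) (sets (F t) \<union> null_sets M)"

text \<open>The filtration generated by an initial value and a driving process.\<close>

definition generated_filtration ::
  "'w measure \<Rightarrow> ('w \<Rightarrow> 'a::euclidean_space) \<Rightarrow> (real \<Rightarrow> 'w \<Rightarrow> 'a) \<Rightarrow> real \<Rightarrow> 'w measure" where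
  "generated_filtration M X0 B t = sigma (space M)
     ({X0 -` A \<inter> space M | A. A \<in> sets borel} \<union>
      {B s -` A \<inter> space M | s A. 0 \<le> s \<and> s \<le> t \<and> A \<in> sets borel})"

text \<open>Brownian motion relative to \<open>F\<close>, started at the origin: the increments over \<open>[s, t]\<close> are
  independent of \<open>F s\<close> and have the centred Gaussian law with covariance \<open>(t - s)\<close> times the
  identity, given here by its density.\<close>

definition brownian_motion ::
  "'w measure \<Rightarrow> (real \<Rightarrow> 'w measure) \<Rightarrow> (real \<Rightarrow> 'w \<Rightarrow> 'a::euclidean_space) \<Rightarrow> bool" where
  "brownian_motion M F B \<longleftrightarrow>
     (\<forall>t\<ge>0. B t \<in> borel_measurable (F t)) \<and>
     (AE \<omega> in M. B 0 \<omega> = 0) \<and>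
     (AE \<omega> in M. continuous_on {0..} (\<lambda>t. B t \<omega>)) \<and>
     (\<forall>s t. 0 \<le> s \<longrightarrow> s < t \<longrightarrow>
        distributed M lborel (\<lambda>\<omega>. B t \<omega> - B s \<omega>)
          (\<lambda>x. ennreal (\<Prod>b\<in>Basis. normal_density 0 (sqrt (t - s)) (x \<bullet> b))) \<and>
        prob_space.indep_set M (sets (F s))
          {(\<lambda>\<omega>. B t \<omega> - B s \<omega>) -` A \<inter> space M | A. A \<in> sets borel})"

text \<open>\<open>X\<close> is a continuous \<open>F\<close>-adapted process with values in the closure of \<open>C\<close> solving
  \<open>dX = dB - b(X) dt\<close>, \<open>X\<^sub>0 = X0\<close>, in integral form; \<open>b\<close> is only evaluated at times at which
  \<open>X\<close> is in \<open>C\<close>, and its integral over them is an absolutely convergent Lebesgue integral.\<close>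

definition sde_solution ::
  "'w measure \<Rightarrow> (real \<Rightarrow> 'w measure) \<Rightarrow> 'a::euclidean_space set \<Rightarrow> ('a \<Rightarrow> 'a) \<Rightarrow>
   ('w \<Rightarrow> 'a) \<Rightarrow> (real \<Rightarrow> 'w \<Rightarrow> 'a) \<Rightarrow> (real \<Rightarrow> 'w \<Rightarrow> 'a) \<Rightarrow> bool" where
  "sde_solution M F C b X0 B X \<longleftrightarrow>
     (\<forall>t\<ge>0. X t \<in> borel_measurable (F t)) \<and>
     (\<forall>\<omega>\<in>space M. continuous_on {0..} (\<lambda>t. X t \<omega>)) \<and>
     (\<forall>\<omega>\<in>space M. \<forall>t\<ge>0. X t \<omega> \<in> closure C) \<and>
     (AE \<omega> in M. \<forall>t\<ge>0.
        set_integrable lborel {s\<in>{0..t}. X s \<omega> \<in> C} (\<lambda>s. b (X s \<omega>)) \<and>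
        X t \<omega> = X0 \<omega> + B t \<omega> - (LINT s:{s\<in>{0..t}. X s \<omega> \<in> C}|lborel. b (X s \<omega>)))"

text \<open>A strong solution is adapted to the null-set augmentation of the filtration generated by
  the initial value and the Brownian motion.\<close>

definition strong_solution ::
  "'w measure \<Rightarrow> 'a::euclidean_space set \<Rightarrow> ('a \<Rightarrow> 'a) \<Rightarrow>
   ('w \<Rightarrow> 'a) \<Rightarrow> (real \<Rightarrow> 'w \<Rightarrow> 'a) \<Rightarrow> (real \<Rightarrow> 'w \<Rightarrow> 'a) \<Rightarrow> bool" where
  "strong_solution M C b X0 B X \<longleftrightarrow>
     sde_solution M (augmented M (generated_filtration M X0 B)) C b X0 B X"

end

theory Submission
  imports Defs
begin

text \<open>
  The noise is additive, so solutions are studied path by path through \<open>v = X - X\<^sub>0 - B\<close>, and the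
  only property of the roots that matters is that \<open>C\<close> is a nonempty intersection of open half-spaces.
  The drift \<open>b = -\<nabla>\<Phi>\<close> is monotone, \<open>b x \<bullet> x\<close> is the constant \<open>\<Sum>\<alpha>. k \<alpha>\<close>, and \<open>\<bar>b x\<bar>\<close> is controlled by
  \<open>b x \<bullet> a\<close> for any \<open>a\<close> in \<open>C\<close>. These three facts make the implicit Euler scheme converge
  uniformly on compact time intervals along every continuous path.

  In the limit the integrated drift could lose mass on the walls (a reflection term). This is
  excluded almost surely: for a set \<open>I\<close> of roots choose \<open>p\<close> in the open cone spanned by \<open>I\<close> with
  \<open>p \<bullet> \<beta> > 0\<close> on \<open>I\<close> and test the scheme with a concave function of \<open>p \<bullet> x\<close> that is constant
  away from the face where \<open>I\<close> vanishes. This bounds the drift from \<open>I\<close> near that face by the drift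
  of the other roots there, which is concentrated on smaller faces; induction on faces concludes.

  For uniqueness, a solution spends no time on the walls, since on the zero set of \<open>\<alpha> \<bullet> X\<close> the
  increments of \<open>\<alpha> \<bullet> B\<close> over time \<open>u\<close> would be \<open>O(u)\<close>, which is incompatible with their size \<open>\<surd>u\<close>.
  Then monotonicity of \<open>b\<close> gives \<open>\<bar>X - Y\<bar> = 0\<close>.
\<close>

section \<open>The logarithmic potential of a chamber\<close>

text \<open>Gaussian noise enters existence only through the loss of mass. There the scheme is
  studied in expectation: its increments are independent of the past, so test functions obey a
  discrete Ito inequality. The obstacle is the curvature of a test function at scale d, which costs
  the expected time with \<open>p \<bullet> x \<le> 2 * d\<close> divided by d. The a priori bound
  on 1 / (p \<bullet> x) keeps this bounded but not small. However, 1 / (p \<bullet> x) dominates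
  the sum of these costs over all dyadic scales, so among N scales one has cost O(1/N). That scale
  varies with the mesh, hence estimates are made uniform over a fixed finite range of scales.
  Smallness in expectation yields, by Fatou, smallness along infinitely many meshes for almost every
  path; this suffices because uniform convergence along all meshes is already known. Moments require
  a bounded initial value, so \<open>X0\<close> is truncated and recovered path by path. In the
  uniqueness part, wall times have to be removed first because the integrated drift counts as zero
  there, and monotonicity says nothing about such times.\<close>

lemma continuous_on_Ici:
  fixes f :: "real \<Rightarrow> 'b::metric_space"
  assumes "\<And>T. 0 \<le> T \<Longrightarrow> continuous_on {0..T} f"
  shows "continuous_on {0..} f"
  unfolding continuous_on_def
proof
  fix x :: real assume x: "x \<in> {0..}"
  have "(f \<longlongrightarrow> f x) (at x within {0..x + 1})"
    using assms[of "x + 1"] x unfolding continuous_on_def by auto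
  moreover have "at x within {0..x + 1} = at x within {0..}"
    by (rule at_within_nhd[of _ "{..<x + 1}"]) (use x in auto)
  ultimately show "(f \<longlongrightarrow> f x) (at x within {0..})" by simp
qed

lemma compact_sublevel:
  fixes f :: "real \<Rightarrow> real"
  assumes "continuous_on {a..b} f"
  shows "compact {s\<in>{a..b}. f s \<le> c}"
proof -
  have "closed ({a..b} \<inter> f -` {..c})" by (rule continuous_closed_preimage[OF assms]) auto
  then have "compact ({a..b} \<inter> ({a..b} \<inter> f -` {..c}))" by (intro compact_Int_closed) auto
  moreover have "{a..b} \<inter> ({a..b} \<inter> f -` {..c}) = {s\<in>{a..b}. f s \<le> c}" by auto
  ultimately show ?thesis by simp
qed

lemma finite_pos_lower_bound:
  fixes f :: "'b \<Rightarrow> real"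
  assumes "finite A" "\<And>x. x \<in> A \<Longrightarrow> 0 < f x"
  obtains e where "0 < e" "\<And>x. x \<in> A \<Longrightarrow> e \<le> f x"
proof
  show "0 < Min (insert 1 (f ` A))" using assms by (subst Min_gr_iff) auto
  show "Min (insert 1 (f ` A)) \<le> f x" if "x \<in> A" for x using assms that by (intro Min_le) auto
qed

lemma finite_upper_bound:
  fixes f :: "'b \<Rightarrow> real"
  assumes "finite A"
  obtains M where "0 < M" "\<And>x. x \<in> A \<Longrightarrow> f x \<le> M"
proof
  show "0 < Max (insert 1 (f ` A))" using assms by (subst Max_gr_iff) auto
  show "f x \<le> Max (insert 1 (f ` A))" if "x \<in> A" for x using assms that by (intro Max_ge) auto
qed

text \<open>To be instantiated with \<open>S\<close> the positive roots. Nonemptiness of the chamber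
  supplies the interior point \<open>a\<close> against which the drift is measured in the a priori
  bounds.\<close>

locale wall_repulsion =
  fixes S :: "'a::euclidean_space set" and k :: "'a \<Rightarrow> real"
  assumes fin: "finite S" and nonzero: "0 \<notin> S" and k_pos: "\<And>\<alpha>. \<alpha> \<in> S \<Longrightarrow> 0 < k \<alpha>"
    and chamber_nonempty: "weyl_chamber S \<noteq> {}"
begin

abbreviation "C \<equiv> weyl_chamber S"

text \<open>The negative gradient of \<open>Phi\<close> on the chamber, so with it the equation
  reads dX = dB + \<open>drift\<close> X dt.\<close>

definition drift :: "'a \<Rightarrow> 'a" where
  "drift x = (\<Sum>\<alpha>\<in>S. (k \<alpha> / (\<alpha> \<bullet> x)) *\<^sub>R \<alpha>)"

definition total :: real where "total = (\<Sum>\<alpha>\<in>S. k \<alpha>)"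

text \<open>A scalar substitute for the norm of \<open>drift\<close>: on the chamber the two are
  comparable up to constants, and \<open>weight\<close> splits into the contributions of single
  walls.\<close>

definition weight :: "'a \<Rightarrow> real" where "weight x = (\<Sum>\<alpha>\<in>S. 1 / (\<alpha> \<bullet> x))"

lemma C_D: "x \<in> C \<Longrightarrow> \<alpha> \<in> S \<Longrightarrow> 0 < \<alpha> \<bullet> x"
  by (simp add: weyl_chamber_def)

lemma total_nonneg: "0 \<le> total"
  unfolding total_def using k_pos by (intro sum_nonneg) (simp add: less_imp_le)

lemma weight_nonneg: "x \<in> C \<Longrightarrow> 0 \<le> weight x"
  unfolding weight_def using C_D by (intro sum_nonneg) (simp add: less_imp_le)

lemma inverse_le_weight: "x \<in> C \<Longrightarrow> \<alpha> \<in> S \<Longrightarrow> 1 / (\<alpha> \<bullet> x) \<le> weight x"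
  unfolding weight_def using C_D fin by (intro member_le_sum) (auto simp: less_imp_le)

lemma drift_inner: "drift x \<bullet> y = (\<Sum>\<alpha>\<in>S. k \<alpha> * (\<alpha> \<bullet> y) / (\<alpha> \<bullet> x))"
  unfolding drift_def inner_sum_left by (intro sum.cong) auto

lemma drift_inner_self: "x \<in> C \<Longrightarrow> drift x \<bullet> x = total"
  unfolding drift_inner total_def by (intro sum.cong refl) (simp add: C_D[THEN less_imp_neq, THEN not_sym])

lemma drift_inner_nonneg:
  assumes "x \<in> C" "\<And>\<alpha>. \<alpha> \<in> S \<Longrightarrow> 0 \<le> \<alpha> \<bullet> y"
  shows "0 \<le> drift x \<bullet> y"
  unfolding drift_inner using assms C_D[OF assms(1)] k_pos
  by (intro sum_nonneg divide_nonneg_pos mult_nonneg_nonneg) (auto simp: less_imp_le)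

lemma drift_inner_diff_le:
  assumes "x \<in> C" "\<And>\<alpha>. \<alpha> \<in> S \<Longrightarrow> 0 \<le> \<alpha> \<bullet> y"
  shows "drift x \<bullet> (x - y) \<le> total"
  using drift_inner_nonneg[OF assms] drift_inner_self[OF assms(1)] by (simp add: inner_diff_right)

text \<open>Root by root, because the reciprocal is decreasing on the positive half-line. This is
  convexity of \<open>Phi\<close>.\<close>

lemma drift_mono:
  assumes "x \<in> C" "y \<in> C"
  shows "(x - y) \<bullet> (drift x - drift y) \<le> 0"
proof -
  have "(x - y) \<bullet> (drift x - drift y) = (\<Sum>\<alpha>\<in>S. k \<alpha> * (\<alpha> \<bullet> (x - y)) / (\<alpha> \<bullet> x) - k \<alpha> * (\<alpha> \<bullet> (x - y)) / (\<alpha> \<bullet> y))"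
    by (simp only: inner_commute[of "x - y"] inner_diff_left[of "drift x" "drift y"] drift_inner sum_subtractf)
  also have "\<dots> \<le> 0"
  proof (rule sum_nonpos)
    fix \<alpha> assume a: "\<alpha> \<in> S"
    define u v where "u = \<alpha> \<bullet> x" and "v = \<alpha> \<bullet> y"
    have uv: "u > 0" "v > 0" using assms a C_D by (auto simp: u_def v_def)
    have "k \<alpha> * (u - v) / u - k \<alpha> * (u - v) / v = - (k \<alpha> * (u - v)\<^sup>2 / (u * v))"
      using uv by (simp add: field_simps power2_eq_square)
    also have "\<dots> \<le> 0" using uv k_pos[OF a] by simp
    finally show "k \<alpha> * (\<alpha> \<bullet> (x - y)) / (\<alpha> \<bullet> x) - k \<alpha> * (\<alpha> \<bullet> (x - y)) / (\<alpha> \<bullet> y) \<le> 0"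
      by (simp add: u_def v_def inner_diff_right)
  qed
  finally show ?thesis .
qed

lemma norm_drift_le_weight:
  obtains M where "0 < M" "\<And>x. x \<in> C \<Longrightarrow> norm (drift x) \<le> M * weight x"
proof -
  obtain M where M: "0 < M" "\<And>\<alpha>. \<alpha> \<in> S \<Longrightarrow> k \<alpha> * norm \<alpha> \<le> M"
    using finite_upper_bound[OF fin, of "\<lambda>\<alpha>. k \<alpha> * norm \<alpha>"] by blast
  have "norm (drift x) \<le> M * weight x" if x: "x \<in> C" for x
  proof -
    have "norm (drift x) \<le> (\<Sum>\<alpha>\<in>S. norm ((k \<alpha> / (\<alpha> \<bullet> x)) *\<^sub>R \<alpha>))"
      unfolding drift_def by (rule norm_sum)
    also have "\<dots> \<le> (\<Sum>\<alpha>\<in>S. M * (1 / (\<alpha> \<bullet> x)))"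
    proof (rule sum_mono)
      fix \<alpha> assume a: "\<alpha> \<in> S"
      have "norm ((k \<alpha> / (\<alpha> \<bullet> x)) *\<^sub>R \<alpha>) = (k \<alpha> * norm \<alpha>) / (\<alpha> \<bullet> x)"
        using C_D[OF x a] k_pos[OF a] by simp
      also have "\<dots> \<le> M / (\<alpha> \<bullet> x)" using C_D[OF x a] M(2)[OF a] by (intro divide_right_mono) auto
      finally show "norm ((k \<alpha> / (\<alpha> \<bullet> x)) *\<^sub>R \<alpha>) \<le> M * (1 / (\<alpha> \<bullet> x))" by simp
    qed
    finally show ?thesis by (simp add: weight_def sum_distrib_left)
  qed
  with M(1) that show ?thesis by blast
qed

text \<open>Against an interior direction \<open>a\<close> every root contributes with positive
  sign, so the repulsions of different walls cannot cancel in
  \<open>drift x \<bullet> a\<close>.\<close>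

lemma weight_le_drift_inner:
  assumes a: "a \<in> C"
  obtains c where "0 < c" "\<And>x. x \<in> C \<Longrightarrow> weight x \<le> c * (drift x \<bullet> a)"
proof -
  obtain e where e: "0 < e" "\<And>\<alpha>. \<alpha> \<in> S \<Longrightarrow> e \<le> k \<alpha> * (\<alpha> \<bullet> a)"
    using finite_pos_lower_bound[OF fin, of "\<lambda>\<alpha>. k \<alpha> * (\<alpha> \<bullet> a)"] k_pos C_D[OF a] by (metis mult_pos_pos)
  have "weight x \<le> (1 / e) * (drift x \<bullet> a)" if x: "x \<in> C" for x
  proof -
    have "e * weight x \<le> drift x \<bullet> a"
      unfolding weight_def drift_inner sum_distrib_left
    proof (rule sum_mono)
      fix \<alpha> assume "\<alpha> \<in> S"
      with e(2) C_D[OF x] show "e * (1 / (\<alpha> \<bullet> x)) \<le> k \<alpha> * (\<alpha> \<bullet> a) / (\<alpha> \<bullet> x)"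
        by (auto intro!: divide_right_mono simp: less_imp_le)
    qed
    with e(1) show ?thesis by (simp add: field_simps)
  qed
  with e(1) that[of "1 / e"] show ?thesis by simp
qed

lemma drift_coercive:
  assumes a: "a \<in> C"
  shows "\<exists>c>0. \<forall>x\<in>C. weight x \<le> c * (drift x \<bullet> a) \<and> norm (drift x) \<le> c * (drift x \<bullet> a)"
proof -
  obtain c where c: "0 < c" "\<And>x. x \<in> C \<Longrightarrow> weight x \<le> c * (drift x \<bullet> a)"
    using weight_le_drift_inner[OF a] by blast
  obtain M where M: "0 < M" "\<And>x. x \<in> C \<Longrightarrow> norm (drift x) \<le> M * weight x"
    using norm_drift_le_weight by blast
  have pos: "0 \<le> drift x \<bullet> a" if "x \<in> C" for x
    using drift_inner_nonneg[OF that] C_D[OF a] by (auto simp: less_imp_le)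
  show ?thesis
  proof (intro exI conjI ballI)
    show "0 < c + M * c" using c M by (simp add: add_pos_pos)
    fix x assume x: "x \<in> C"
    show "weight x \<le> (c + M * c) * (drift x \<bullet> a)"
      using c(2)[OF x] pos[OF x] mult_nonneg_nonneg[OF mult_nonneg_nonneg[of M c], of "drift x \<bullet> a"] c(1) M(1)
      unfolding distrib_right by linarith
    show "norm (drift x) \<le> (c + M * c) * (drift x \<bullet> a)"
      using M(2)[OF x] mult_left_mono[OF c(2)[OF x], of M] M(1) pos[OF x] c(1)
        mult_nonneg_nonneg[of c "drift x \<bullet> a"]
      unfolding distrib_right mult.assoc by linarith
  qed
qed

lemma open_C: "open C"
proof -
  have "C = (\<Inter>\<alpha>\<in>S. {x. 0 < \<alpha> \<bullet> x})" by (auto simp: weyl_chamber_def)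
  then show ?thesis using fin by (auto intro!: open_Collect_less continuous_intros)
qed

lemma closure_C_D: "x \<in> closure C \<Longrightarrow> \<alpha> \<in> S \<Longrightarrow> 0 \<le> \<alpha> \<bullet> x"
proof -
  assume a: "\<alpha> \<in> S" and x: "x \<in> closure C"
  have "closure C \<subseteq> {x. 0 \<le> \<alpha> \<bullet> x}"
    using C_D a by (intro closure_minimal closed_Collect_le continuous_intros) (auto simp: less_imp_le)
  with x show ?thesis by auto
qed

section \<open>Gradient of the potential and resolvent of the drift\<close>

lemma GDERIV_Phi:
  assumes x: "x \<in> C"
  shows "GDERIV (Phi k S) x :> - drift x"
proof -
  have "((\<lambda>x. Phi k S x) has_derivative (\<lambda>h. - (\<Sum>\<alpha>\<in>S. k \<alpha> * ((\<alpha> \<bullet> h) / (\<alpha> \<bullet> x))))) (at x)"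
    unfolding Phi_def
    by (auto intro!: derivative_eq_intros C_D[OF x] simp: field_simps)
  moreover have "(\<lambda>h. - (\<Sum>\<alpha>\<in>S. k \<alpha> * ((\<alpha> \<bullet> h) / (\<alpha> \<bullet> x)))) = (\<lambda>h. h \<bullet> - drift x)"
    by (auto simp: inner_commute[of _ "drift x"] drift_inner)
  ultimately show ?thesis unfolding gderiv_def by simp
qed

lemma grad_Phi:
  assumes x: "x \<in> C"
  shows "grad (Phi k S) x = - drift x"
  unfolding grad_def
proof (rule the_equality)
  show "GDERIV (Phi k S) x :> - drift x" by (rule GDERIV_Phi[OF x])
  fix D assume D: "GDERIV (Phi k S) x :> D"
  have "(\<lambda>h. h \<bullet> D) = (\<lambda>h. h \<bullet> - drift x)"
    using D GDERIV_Phi[OF x] unfolding gderiv_def by (rule has_derivative_unique)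
  then have "h \<bullet> D = h \<bullet> - drift x" for h by meson
  then show "D = - drift x" by (metis vector_eq_ldot)
qed

text \<open>The equation is the stationarity condition of \<open>f\<close>, half the squared
  distance to \<open>z\<close> plus \<open>h\<close> times the potential. The logarithms blow up at
  the walls, so the minimum of \<open>f\<close> is attained inside the open chamber.\<close>

lemma resolvent_exists:
  assumes h: "0 < h"
  shows "\<exists>x\<in>C. x - h *\<^sub>R drift x = z"
proof -
  obtain a where a: "a \<in> C" using chamber_nonempty by blast
  define f where "f = (\<lambda>x. (1 / 2) * ((x - z) \<bullet> (x - z)) + h * Phi k S x)"
  obtain A where A: "0 < A" "\<And>\<alpha>. \<alpha> \<in> S \<Longrightarrow> norm \<alpha> \<le> A"
    using finite_upper_bound[OF fin, of norm] by blast
  have ln_le: "ln (\<alpha> \<bullet> x) \<le> A * norm x" if "x \<in> C" "\<alpha> \<in> S" for x \<alpha>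
  proof -
    have "ln (\<alpha> \<bullet> x) \<le> \<alpha> \<bullet> x" using C_D[OF that] ln_less_self less_imp_le by blast
    also have "\<dots> \<le> norm \<alpha> * norm x" by (rule norm_cauchy_schwarz)
    also have "\<dots> \<le> A * norm x" using A(2)[OF that(2)] by (intro mult_right_mono) auto
    finally show ?thesis .
  qed
  have Phi_ge: "Phi k S x \<ge> - total * A * norm x" if x: "x \<in> C" for x
  proof -
    have "(\<Sum>\<alpha>\<in>S. k \<alpha> * ln (\<alpha> \<bullet> x)) \<le> (\<Sum>\<alpha>\<in>S. k \<alpha> * (A * norm x))"
      using ln_le[OF x] k_pos by (intro sum_mono mult_left_mono) (auto simp: less_imp_le)
    then show ?thesis by (simp add: Phi_def total_def sum_distrib_right mult.assoc)
  qed
  define c where "c = norm z + h * total * A"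
  define \<rho> where "\<rho> = 2 * c + 2 * \<bar>f a\<bar> + 1"
  have c0: "0 \<le> c" unfolding c_def using total_nonneg h A by simp
  \<comment> \<open>The potential decreases at most linearly in \<open>norm x\<close>, so the
    quadratic term bounds the sublevel set.\<close>
  have bounded: "norm x \<le> \<rho>" if x: "x \<in> C" and le: "f x \<le> f a" for x
  proof (rule ccontr)
    assume "\<not> norm x \<le> \<rho>"
    then have n: "norm x > 2 * c + 2 * \<bar>f a\<bar> + 1" by (simp add: \<rho>_def)
    have "(x - z) \<bullet> (x - z) \<ge> (norm x)\<^sup>2 - 2 * norm z * norm x"
    proof -
      have "2 * norm z * norm x = 2 * (norm x * norm z)" by simp
      with norm_cauchy_schwarz[of x z] inner_ge_zero[of z] show ?thesis
        unfolding power2_norm_eq_inner inner_diff_left inner_diff_right inner_commute[of z x] by linarith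
    qed
    then have "f x \<ge> (norm x)\<^sup>2 / 2 - norm z * norm x + h * (- total * A * norm x)"
      using mult_left_mono[OF Phi_ge[OF x], of h] h by (simp add: f_def)
    also have "(norm x)\<^sup>2 / 2 - norm z * norm x + h * (- total * A * norm x) = norm x * (norm x / 2 - c)"
      by (simp add: c_def power2_eq_square algebra_simps)
    finally have 1: "f x \<ge> norm x * (norm x / 2 - c)" .
    have 2: "norm x / 2 - c \<ge> \<bar>f a\<bar> + 1/2" using n by simp
    have 3: "norm x \<ge> 1" using n c0 by simp
    have "norm x * (norm x / 2 - c) \<ge> 1 * (\<bar>f a\<bar> + 1/2)"
      using 2 3 by (intro mult_mono) auto
    with 1 le show False by simp
  qed
  have rho: "\<rho> \<ge> 1" using c0 by (simp add: \<rho>_def)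
  \<comment> \<open>Within radius \<open>\<rho>\<close> the other logarithms are bounded above, so a
    bound on \<open>f\<close> bounds \<open>ln (\<alpha> \<bullet> x)\<close> from below.\<close>
  have lb: "\<exists>e>0. \<forall>x\<in>C. f x \<le> f a \<longrightarrow> e \<le> \<alpha> \<bullet> x" if al: "\<alpha> \<in> S" for \<alpha>
  proof -
    define D where "D = (f a + h * total * (A * \<rho>)) / (h * k \<alpha>)"
    have "exp (- D) \<le> \<alpha> \<bullet> x" if x: "x \<in> C" and le: "f x \<le> f a" for x
    proof -
      have nx: "norm x \<le> \<rho>" using bounded[OF x le] .
      have "(\<Sum>\<beta>\<in>S. k \<beta> * ln (\<beta> \<bullet> x)) = k \<alpha> * ln (\<alpha> \<bullet> x) + (\<Sum>\<beta>\<in>S - {\<alpha>}. k \<beta> * ln (\<beta> \<bullet> x))"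
        using fin al by (simp add: sum.remove)
      also have "(\<Sum>\<beta>\<in>S - {\<alpha>}. k \<beta> * ln (\<beta> \<bullet> x)) \<le> (\<Sum>\<beta>\<in>S - {\<alpha>}. k \<beta> * (A * \<rho>))"
      proof (intro sum_mono mult_left_mono)
        fix \<beta> assume b: "\<beta> \<in> S - {\<alpha>}"
        from b have "\<beta> \<in> S" by simp
        from ln_le[OF x this] mult_left_mono[OF nx less_imp_le[OF A(1)]]
        show "ln (\<beta> \<bullet> x) \<le> A * \<rho>" by (rule order_trans)
        show "0 \<le> k \<beta>" using k_pos[of \<beta>] b by simp
      qed
      also have "\<dots> \<le> (\<Sum>\<beta>\<in>S. k \<beta> * (A * \<rho>))"
        using fin k_pos A(1) rho by (intro sum_mono2) (auto intro!: mult_nonneg_nonneg simp: less_imp_le)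
      also have "\<dots> = total * (A * \<rho>)" by (simp add: total_def sum_distrib_right)
      finally have "- (k \<alpha> * ln (\<alpha> \<bullet> x)) \<le> Phi k S x + total * (A * \<rho>)" by (simp add: Phi_def)
      from mult_left_mono[OF this, of h] h
      have "- (h * k \<alpha> * ln (\<alpha> \<bullet> x)) \<le> h * Phi k S x + h * total * (A * \<rho>)" by (simp add: algebra_simps)
      also have "h * Phi k S x \<le> f x" by (simp add: f_def)
      finally have "- (h * k \<alpha> * ln (\<alpha> \<bullet> x)) \<le> f a + h * total * (A * \<rho>)" using le by simp
      then have "- ln (\<alpha> \<bullet> x) \<le> D"
        unfolding D_def using h k_pos[OF al] by (subst pos_le_divide_eq) (auto simp: algebra_simps)
      then have "- D \<le> ln (\<alpha> \<bullet> x)" by simp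
      then show ?thesis using C_D[OF x al] by (simp add: ln_ge_iff)
    qed
    then show ?thesis by (intro exI[of _ "exp (- D)"]) auto
  qed
  then obtain e where e: "\<And>\<alpha>. \<alpha> \<in> S \<Longrightarrow> e \<alpha> > 0"
    "\<And>\<alpha> x. \<alpha> \<in> S \<Longrightarrow> x \<in> C \<Longrightarrow> f x \<le> f a \<Longrightarrow> e \<alpha> \<le> \<alpha> \<bullet> x" by metis
  \<comment> \<open>A compact subset of the open chamber that contains the sublevel set of
    \<open>f a\<close>; hence a minimum over \<open>Q\<close> is a minimum over
    \<open>C\<close>.\<close>
  define Q where "Q = cball 0 \<rho> \<inter> (\<Inter>\<alpha>\<in>S. {x. e \<alpha> \<le> \<alpha> \<bullet> x})"
  have "closed (\<Inter>\<alpha>\<in>S. {x. e \<alpha> \<le> \<alpha> \<bullet> x})"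
    by (intro closed_INT ballI closed_Collect_le continuous_intros)
  then have comp: "compact Q" unfolding Q_def by (intro compact_Int_closed compact_cball)
  have QC: "Q \<subseteq> C" using e(1) by (force simp: Q_def weyl_chamber_def)
  have sub: "x \<in> Q" if "x \<in> C" "f x \<le> f a" for x
    using bounded[OF that] e(2)[OF _ that] by (auto simp: Q_def)
  have deriv: "(f has_derivative (\<lambda>v. v \<bullet> (x - z - h *\<^sub>R drift x))) (at x)" if x: "x \<in> C" for x
  proof -
    have 1: "((\<lambda>x. x - z) has_derivative (\<lambda>v. v)) (at x)"
      by (auto intro!: derivative_eq_intros)
    have "(f has_derivative
        (\<lambda>v. (1 / 2) * ((x - z) \<bullet> v + v \<bullet> (x - z)) + h * (v \<bullet> - drift x))) (at x)"
      unfolding f_def using has_derivative_inner[OF 1 1] GDERIV_Phi[OF x, unfolded gderiv_def]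
      by (intro has_derivative_add has_derivative_mult_right)
    moreover have "(\<lambda>v. (1 / 2) * ((x - z) \<bullet> v + v \<bullet> (x - z)) + h * (v \<bullet> - drift x))
        = (\<lambda>v. v \<bullet> (x - z - h *\<^sub>R drift x))"
      by (simp add: inner_commute[of "x - z"] inner_diff_right diff_divide_distrib)
    ultimately show ?thesis by simp
  qed
  have "continuous_on Q f"
    using deriv QC by (meson has_derivative_continuous continuous_at_imp_continuous_on subsetD)
  then obtain x where x: "x \<in> Q" "\<And>y. y \<in> Q \<Longrightarrow> f x \<le> f y"
    using continuous_attains_inf[OF comp, of f] sub[OF a] by blast
  have xC: "x \<in> C" using x QC by auto
  have min: "f x \<le> f y" if "y \<in> C" for y
    using x(2)[OF sub[OF a]] x(2)[of y] sub[OF that] by (cases "f y \<le> f a") auto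
  have "(\<lambda>v. v \<bullet> (x - z - h *\<^sub>R drift x)) = (\<lambda>v. 0)"
    using differential_zero_maxmin[OF xC open_C deriv[OF xC]] min by blast
  then have "(x - z - h *\<^sub>R drift x) \<bullet> (x - z - h *\<^sub>R drift x) = 0" by meson
  then have "x - z - h *\<^sub>R drift x = 0" by (simp only: inner_eq_zero_iff)
  then have "x - h *\<^sub>R drift x = z" by (simp add: algebra_simps)
  with xC show ?thesis by blast
qed

text \<open>By monotonicity the pairing of \<open>x - y\<close> with the difference on the right is
  at least the square of \<open>norm (x - y)\<close>; Cauchy-Schwarz then cancels one factor.
  Uniqueness and continuity of the resolvent both follow.\<close>

lemma resolvent_nonexpansive:
  assumes "0 < h" "x \<in> C" "y \<in> C"
  shows "norm (x - y) \<le> norm ((x - h *\<^sub>R drift x) - (y - h *\<^sub>R drift y))"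
proof -
  let ?w = "(x - h *\<^sub>R drift x) - (y - h *\<^sub>R drift y)"
  have "(x - y) \<bullet> ?w = (x - y) \<bullet> (x - y) - h * ((x - y) \<bullet> (drift x - drift y))"
    by (simp add: inner_diff algebra_simps)
  then have "(norm (x - y))\<^sup>2 \<le> (x - y) \<bullet> ?w"
    using drift_mono[OF assms(2,3)] assms(1) by (simp add: power2_norm_eq_inner mult_nonneg_nonpos)
  also have "\<dots> \<le> norm (x - y) * norm ?w" by (rule norm_cauchy_schwarz)
  finally show ?thesis
    by (cases "norm (x - y) = 0") (auto simp: power2_eq_square)
qed

definition resolvent :: "real \<Rightarrow> 'a \<Rightarrow> 'a" where
  "resolvent h z = (SOME x. x \<in> C \<and> x - h *\<^sub>R drift x = z)"

lemma
  assumes "0 < h"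
  shows resolvent_in_C: "resolvent h z \<in> C"
    and resolvent_eq: "resolvent h z - h *\<^sub>R drift (resolvent h z) = z"
proof -
  have "\<exists>x. x \<in> C \<and> x - h *\<^sub>R drift x = z" using resolvent_exists[OF assms] by blast
  from someI_ex[OF this] show "resolvent h z \<in> C" "resolvent h z - h *\<^sub>R drift (resolvent h z) = z"
    by (auto simp: resolvent_def)
qed

lemma continuous_on_resolvent: "0 < h \<Longrightarrow> continuous_on UNIV (resolvent h)"
proof -
  assume h: "0 < h"
  have "norm (resolvent h x - resolvent h y) \<le> norm (x - y)" for x y
    using resolvent_nonexpansive[OF h resolvent_in_C[OF h] resolvent_in_C[OF h], of x y]
    by (simp only: resolvent_eq[OF h])
  then show ?thesis
    by (intro continuous_on_eq_continuous_within[THEN iffD2] ballI)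
       (auto simp: continuous_at_eps_delta dist_norm intro: le_less_trans)
qed

text \<open>The drift may be huge near a wall, but the displacement n of one step satisfies n^2
  \<le> n |d| + \<open>h * total\<close>: paired with the displacement, the drift at the new point
  contributes at most \<open>total\<close>. This bounds a single push independently of the distance
  to the walls.\<close>

lemma resolvent_step:
  assumes h: "0 < h" and x: "\<And>\<alpha>. \<alpha> \<in> S \<Longrightarrow> 0 \<le> \<alpha> \<bullet> x"
  shows "norm (h *\<^sub>R drift (resolvent h (x + d))) \<le> 2 * norm d + sqrt (h * total)"
proof -
  let ?y = "resolvent h (x + d)"
  have yC: "?y \<in> C" using resolvent_in_C[OF h] .
  have eq: "?y - x = d + h *\<^sub>R drift ?y" using resolvent_eq[OF h, of "x + d"] by (simp add: algebra_simps)
  define n r where "n = norm (?y - x)" and "r = sqrt (h * total)"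
  have r0: "r \<ge> 0" "r * r = h * total" using h total_nonneg by (auto simp: r_def)
  have "n\<^sup>2 = (?y - x) \<bullet> d + h * (drift ?y \<bullet> (?y - x))"
    unfolding n_def power2_norm_eq_inner by (subst (2) eq) (simp add: inner_add_right inner_commute)
  also have "\<dots> \<le> n * norm d + h * total"
    unfolding n_def using h
    by (intro add_mono mult_left_mono norm_cauchy_schwarz drift_inner_diff_le[OF yC x]) auto
  finally have n2: "n * n \<le> n * norm d + r * r" unfolding r0(2) by (simp add: power2_eq_square)
  have "n \<le> norm d + r"
  proof (rule ccontr)
    assume "\<not> n \<le> norm d + r"
    then have g: "norm d + r < n" by simp
    have "n * n = n * norm d + n * (n - norm d)" by (simp add: algebra_simps)
    moreover have "n * (n - norm d) > r * r"
      using g r0(1) norm_ge_zero[of d] by (intro mult_strict_mono') linarith+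
    ultimately show False using n2 by simp
  qed
  moreover have "norm (h *\<^sub>R drift ?y) \<le> norm (?y - x) + norm d"
    using eq norm_triangle_ineq4[of "?y - x" d] by simp
  ultimately show ?thesis by (simp add: n_def r_def)
qed

end

section \<open>The implicit Euler scheme along a path\<close>

text \<open>The integrated form of (|D|^2)' = 2 D \<bullet> f for D the indefinite integral of
  \<open>f\<close>. As \<open>f\<close> is merely integrable, D need not be differentiable
  everywhere; instead |D|^2 is telescoped over a partition, and D at the grid point is replaced by D
  at the running time at the cost of its modulus of continuity. The a priori bound, the convergence
  of the scheme and uniqueness all rest on this estimate.\<close>

lemma energy_estimate:
  fixes f :: "real \<Rightarrow> 'a::euclidean_space" and c :: "real \<Rightarrow> real"
  assumes T: "0 \<le> T" and f: "f absolutely_integrable_on {0..T}" and c: "c integrable_on {0..T}"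
    and le: "\<And>s. s \<in> {0..T} \<Longrightarrow> integral {0..s} f \<bullet> f s \<le> c s"
  shows "(norm (integral {0..T} f))\<^sup>2 \<le> 2 * integral {0..T} c"
proof -
  define D where "D t = integral {0..t} f" for t
  define L where "L = integral {0..T} (\<lambda>s. norm (f s))"
  have fi: "f integrable_on {0..T}" and ni: "(\<lambda>s. norm (f s)) integrable_on {0..T}"
    using f by (auto simp: absolutely_integrable_on_def)
  have L0: "L \<ge> 0" unfolding L_def by (intro integral_nonneg ni) auto
  have "continuous_on {0..T} D" unfolding D_def by (rule indefinite_integral_continuous_1[OF fi])
  then have uc: "uniformly_continuous_on {0..T} D" by (intro compact_uniformly_continuous) auto
  have main: "(norm (D T))\<^sup>2 \<le> 2 * integral {0..T} c + 2 * e * L" if e: "e > 0" for e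
  proof -
    obtain d where d: "d > 0" "\<And>x y. x \<in> {0..T} \<Longrightarrow> y \<in> {0..T} \<Longrightarrow> \<bar>x - y\<bar> < d \<Longrightarrow> norm (D x - D y) < e"
      using uc e unfolding uniformly_continuous_on_def dist_norm real_norm_def by (metis abs_minus_commute)
    obtain N where N: "N > 0" "T / real N < d"
    proof -
      obtain N where "T / d < real N" using reals_Archimedean2 by blast
      moreover then have "N > 0" using T d(1) by (metis divide_nonneg_pos gr0I of_nat_0 not_less)
      ultimately show ?thesis using d(1) that[of N] by (auto simp: field_simps)
    qed
    define t where "t i = real i * (T / real N)" for i
    have t: "0 \<le> t i" "t i \<le> t (Suc i)" "t (Suc i) = t i + T / real N" for i
      using T by (auto simp: t_def algebra_simps add_divide_distrib)
    have tT: "t i \<le> T" if "i \<le> N" for i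
    proof -
      have "t i \<le> real N * (T / real N)" unfolding t_def using that T by (intro mult_right_mono) auto
      with N show ?thesis by simp
    qed
    have "(norm (D (t i)))\<^sup>2 \<le> 2 * integral {0..t i} c + 2 * e * integral {0..t i} (\<lambda>s. norm (f s))" if "i \<le> N" for i
      using that
    proof (induction i)
      case 0
      then show ?case by (simp add: t_def D_def)
    next
      case (Suc i)
      let ?I = "{t i..t (Suc i)}"
      have ti: "t (Suc i) \<le> T" using tT Suc by auto
      have sub: "g integrable_on {0..t (Suc i)}" "g integrable_on ?I" if "g integrable_on {0..T}" for g :: "real \<Rightarrow> 'c::banach"
        using integrable_subinterval_real[OF that] t ti by (auto simp del: t(3))
      have comb: "integral {0..t (Suc i)} g = integral {0..t i} g + integral ?I g" if "g integrable_on {0..T}" for g :: "real \<Rightarrow> 'c::banach"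
        using Henstock_Kurzweil_Integration.integral_combine[OF _ _ sub(1)[OF that], of "t i"] t(1)[of i] t(2)[of i] by simp
      have inc: "D (t (Suc i)) - D (t i) = integral ?I f" unfolding D_def comb[OF fi] by simp
      have "D (t (Suc i)) \<bullet> integral ?I f = integral ?I (\<lambda>s. D (t (Suc i)) \<bullet> f s)"
        using integral_linear[OF sub(2)[OF fi] bounded_linear_inner_right] by (simp add: o_def)
      also have "\<dots> \<le> integral ?I (\<lambda>s. c s + e * norm (f s))"
      proof (rule integral_le)
        show "(\<lambda>s. D (t (Suc i)) \<bullet> f s) integrable_on ?I"
          using integrable_linear[OF sub(2)[OF fi] bounded_linear_inner_right] by (simp add: o_def)
        show "(\<lambda>s. c s + e * norm (f s)) integrable_on ?I"
          using sub(2)[OF c] sub(2)[OF ni] by (intro integrable_add integrable_on_mult_right)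
        fix s assume s: "s \<in> ?I"
        have s': "s \<in> {0..T}" using s t(1)[of i] ti by auto
        have "\<bar>t (Suc i) - s\<bar> < d" using s t(3)[of i] N(2) by auto
        then have "norm (D (t (Suc i)) - D s) \<le> e"
          using d(2)[of "t (Suc i)" s] s' t(1)[of "Suc i"] ti by force
        then have "(D (t (Suc i)) - D s) \<bullet> f s \<le> e * norm (f s)"
          by (meson mult_right_mono norm_cauchy_schwarz norm_ge_zero order_trans)
        moreover have "D s \<bullet> f s \<le> c s" using le[OF s'] by (simp add: D_def)
        ultimately show "D (t (Suc i)) \<bullet> f s \<le> c s + e * norm (f s)"
          by (simp add: inner_diff_left)
      qed
      also have "\<dots> = integral ?I c + e * integral ?I (\<lambda>s. norm (f s))"
        using sub(2)[OF c] sub(2)[OF ni] by (subst integral_add) (auto intro: integrable_on_mult_right)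
      finally have 1: "D (t (Suc i)) \<bullet> (D (t (Suc i)) - D (t i)) \<le> integral ?I c + e * integral ?I (\<lambda>s. norm (f s))"
        using inc by simp
      \<comment> \<open>The two sides differ by the squared norm of the increment of
        \<open>D\<close>, whose sign is the useful one when the pairing is taken at the right end
        point.\<close>
      have "(norm (D (t (Suc i))))\<^sup>2 - (norm (D (t i)))\<^sup>2 \<le> 2 * (D (t (Suc i)) \<bullet> (D (t (Suc i)) - D (t i)))"
        using inner_ge_zero[of "D (t (Suc i)) - D (t i)"]
        by (simp add: power2_norm_eq_inner inner_diff inner_commute)
      with 1 Suc show ?case by (simp add: comb[OF c] comb[OF ni] distrib_left)
    qed
    from this[of N] show ?thesis using N(1) by (simp add: t_def L_def)
  qed
  have "(norm (D T))\<^sup>2 \<le> 2 * integral {0..T} c + e" if e: "e > 0" for e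
  proof -
    have "2 * (e / (2 * (L + 1))) * L \<le> e" using e L0 by (simp add: field_simps)
    moreover have "e / (2 * (L + 1)) > 0" using e L0 by simp
    ultimately show ?thesis using main[of "e / (2 * (L + 1))"] by linarith
  qed
  then show ?thesis unfolding D_def by (rule field_le_epsilon)
qed

lemma nat_ceiling_divide_eq:
  assumes h: "0 < h" and s: "real j * h < s" "s \<le> real (Suc j) * h"
  shows "nat \<lceil>s / h\<rceil> = Suc j"
proof -
  have "\<lceil>s / h\<rceil> = int (Suc j)"
    using h s by (intro ceiling_unique) (auto simp: field_simps)
  then show ?thesis by simp
qed

text \<open>On the half-open cell from \<open>real j * h\<close> to \<open>real (Suc j) * h\<close>
  the ceiling selects the right index \<open>Suc j\<close>; at the left end point it selects
  \<open>j\<close>, so only the interior of the cell is compared.\<close>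

lemma has_integral_step_cell:
  fixes \<phi> :: "nat \<Rightarrow> 'b::banach" and h :: real
  assumes h: "0 < h" and t: "real j * h \<le> t" "t \<le> real (Suc j) * h"
  shows "((\<lambda>s. \<phi> (nat \<lceil>s / h\<rceil>)) has_integral (t - real j * h) *\<^sub>R \<phi> (Suc j)) {real j * h..t}"
proof -
  have "((\<lambda>s. \<phi> (Suc j)) has_integral (t - real j * h) *\<^sub>R \<phi> (Suc j)) (cbox (real j * h) t)"
    using has_integral_const_real[of "\<phi> (Suc j)" "real j * h" t] t by simp
  then have "((\<lambda>s. \<phi> (nat \<lceil>s / h\<rceil>)) has_integral (t - real j * h) *\<^sub>R \<phi> (Suc j)) (cbox (real j * h) t)"
  proof (rule has_integral_spike_interior)
    fix s assume "s \<in> box (real j * h) t"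
    then have "nat \<lceil>s / h\<rceil> = Suc j" using t by (intro nat_ceiling_divide_eq[OF h]) auto
    then show "\<phi> (nat \<lceil>s / h\<rceil>) = \<phi> (Suc j)" by simp
  qed
  then show ?thesis by simp
qed

lemma has_integral_step:
  fixes \<phi> :: "nat \<Rightarrow> 'b::banach" and h :: real
  assumes h: "0 < h"
  shows "((\<lambda>s. \<phi> (nat \<lceil>s / h\<rceil>)) has_integral (\<Sum>i<j. h *\<^sub>R \<phi> (Suc i))) {0..real j * h}"
proof (induction j)
  case 0
  then show ?case by (simp add: has_integral_refl)
next
  case (Suc j)
  have "((\<lambda>s. \<phi> (nat \<lceil>s / h\<rceil>)) has_integral h *\<^sub>R \<phi> (Suc j)) {real j * h..real (Suc j) * h}"
    using has_integral_step_cell[OF h, of j "real (Suc j) * h" \<phi>] h by (simp add: algebra_simps)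
  from has_integral_combine[OF _ _ Suc this] show ?case using h by simp
qed

lemma step_integrable:
  fixes \<phi> :: "nat \<Rightarrow> 'b::banach" and h :: real
  assumes h: "0 < h"
  shows "(\<lambda>s. \<phi> (nat \<lceil>s / h\<rceil>)) integrable_on {0..t}"
proof -
  obtain j where j: "t / h < real j" using reals_Archimedean2 by blast
  then have "t \<le> real j * h" using h by (simp add: field_simps)
  with has_integral_step[OF h, of \<phi> j] show ?thesis
    by (meson atLeastatMost_subset_iff has_integral_integrable integrable_subinterval_real order_refl)
qed

context wall_repulsion
begin

text \<open>\<open>w\<close> carries both the initial value and the noise. The drift is evaluated at
  the new point, which keeps every iterate in the chamber whatever the increment of
  \<open>w\<close>.\<close>

primrec euler :: "real \<Rightarrow> (real \<Rightarrow> 'a) \<Rightarrow> nat \<Rightarrow> 'a" where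
  "euler h w 0 = w 0"
| "euler h w (Suc j) = resolvent h (euler h w j + (w (real (Suc j) * h) - w (real j * h)))"

text \<open>The ceiling spreads the right end value over its cell. This matches the implicit drift,
  so that \<open>w\<close> plus the integrated drift meets the scheme exactly at grid
  points.\<close>

definition eulerc :: "real \<Rightarrow> (real \<Rightarrow> 'a) \<Rightarrow> real \<Rightarrow> 'a" where
  "eulerc h w s = euler h w (nat \<lceil>s / h\<rceil>)"

definition push :: "real \<Rightarrow> (real \<Rightarrow> 'a) \<Rightarrow> real \<Rightarrow> 'a" where
  "push h w t = integral {0..t} (\<lambda>s. drift (eulerc h w s))"

definition pushvar :: "real \<Rightarrow> (real \<Rightarrow> 'a) \<Rightarrow> real \<Rightarrow> real" where
  "pushvar h w t = integral {0..t} (\<lambda>s. norm (drift (eulerc h w s)))"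

lemma euler_in_C: "0 < h \<Longrightarrow> w 0 \<in> C \<Longrightarrow> euler h w j \<in> C"
  by (cases j) (auto simp: resolvent_in_C)

lemma eulerc_in_C: "0 < h \<Longrightarrow> w 0 \<in> C \<Longrightarrow> eulerc h w s \<in> C"
  by (simp add: eulerc_def euler_in_C)

lemma eulerc_integrable:
  fixes g :: "'a \<Rightarrow> 'b::banach"
  shows "0 < h \<Longrightarrow> (\<lambda>s. g (eulerc h w s)) integrable_on {0..t}"
  unfolding eulerc_def by (rule step_integrable)

lemma eulerc_absolutely_integrable:
  fixes g :: "'a \<Rightarrow> 'b::euclidean_space"
  shows "0 < h \<Longrightarrow> (\<lambda>s. g (eulerc h w s)) absolutely_integrable_on {0..t}"
  by (intro absolutely_integrable_onI eulerc_integrable)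

lemma integral_eulerc:
  fixes g :: "'a \<Rightarrow> 'b::banach"
  shows "0 < h \<Longrightarrow> integral {0..real j * h} (\<lambda>s. g (eulerc h w s)) = (\<Sum>i<j. h *\<^sub>R g (euler h w (Suc i)))"
  unfolding eulerc_def by (rule integral_unique[OF has_integral_step])

lemma euler_Suc_diff:
  assumes "0 < h"
  shows "euler h w (Suc j) = euler h w j + (w (real (Suc j) * h) - w (real j * h)) + h *\<^sub>R drift (euler h w (Suc j))"
  using resolvent_eq[OF assms, of "euler h w j + (w (real (Suc j) * h) - w (real j * h))"]
  by (simp add: algebra_simps)

lemma euler_drift_eq:
  assumes "0 < h"
  shows "h *\<^sub>R drift (euler h w (Suc j)) = euler h w (Suc j) - euler h w j - (w (real (Suc j) * h) - w (real j * h))"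
  by (subst (2) euler_Suc_diff[OF assms]) simp

lemma push_grid:
  assumes h: "0 < h"
  shows "push h w (real j * h) = euler h w j - w (real j * h)"
  unfolding push_def integral_eulerc[OF h]
proof (induction j)
  case (Suc j)
  then show ?case by (simp only: sum.lessThan_Suc euler_drift_eq[OF h]) simp
qed simp

lemma euler_increment_le:
  assumes h: "0 < h" and w0: "w 0 \<in> C"
  shows "norm (h *\<^sub>R drift (euler h w (Suc j))) \<le> 2 * norm (w (real (Suc j) * h) - w (real j * h)) + sqrt (h * total)"
  unfolding euler.simps
  by (rule resolvent_step[OF h]) (auto intro!: less_imp_le C_D euler_in_C[where w=w] h w0)

text \<open>Within a cell, \<open>w + push\<close> misses the right end value by an increment of
  \<open>w\<close> and at most one push \<open>h *\<^sub>R drift\<close>. The former costs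
  \<open>r\<close>; by the one-step bound the latter costs \<open>2 * r + sqrt (h * total)\<close>.
  Oscillation is measured up to \<open>T + h\<close> because the right grid point may lie beyond
  \<open>T\<close>.\<close>

lemma eulerc_error:
  assumes h: "0 < h" and w0: "w 0 \<in> C" and s: "0 \<le> s" "s \<le> T"
    and osc: "\<And>s t. 0 \<le> s \<Longrightarrow> s \<le> T + h \<Longrightarrow> 0 \<le> t \<Longrightarrow> t \<le> T + h \<Longrightarrow> \<bar>s - t\<bar> \<le> h \<Longrightarrow> norm (w s - w t) \<le> r"
  shows "norm (w s + push h w s - eulerc h w s) \<le> 3 * r + sqrt (h * total)"
proof (cases "s = 0")
  case True
  have "0 \<le> r" using osc[of 0 0] s h by simp
  with True h total_nonneg show ?thesis by (simp add: push_def eulerc_def)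
next
  case False
  define j where "j = nat \<lceil>s / h\<rceil> - 1"
  have "\<lceil>s / h\<rceil> \<ge> 1" using False s h by (simp add: one_le_ceiling)
  then have j1: "nat \<lceil>s / h\<rceil> = Suc j" by (simp add: j_def)
  then have "\<lceil>s / h\<rceil> = int j + 1" using \<open>\<lceil>s / h\<rceil> \<ge> 1\<close> by simp
  then have "real j < s / h" "s / h \<le> real j + 1" by (simp_all add: ceiling_eq_iff)
  then have jh: "real j * h < s" "s \<le> real (Suc j) * h" using h by (simp_all add: field_simps)
  let ?t = "real (Suc j) * h" and ?u = "real j * h"
  have tu: "?t = ?u + h" by (simp add: algebra_simps)
  let ?x = "euler h w (Suc j)"
  have "push h w s = push h w ?u + (s - ?u) *\<^sub>R drift ?x"
  proof -
    have "integral {?u..s} (\<lambda>s. drift (eulerc h w s)) = (s - ?u) *\<^sub>R drift ?x"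
      unfolding eulerc_def using has_integral_step_cell[OF h, of j s "\<lambda>i. drift (euler h w i)"] jh
      by (intro integral_unique) (simp del: euler.simps)
    moreover have "push h w s = push h w ?u + integral {?u..s} (\<lambda>s. drift (eulerc h w s))"
      unfolding push_def using jh h Henstock_Kurzweil_Integration.integral_combine[OF _ _ eulerc_integrable[OF h], of ?u s drift w] by simp
    ultimately show ?thesis by simp
  qed
  moreover have "push h w ?t = push h w ?u + h *\<^sub>R drift ?x"
    by (simp only: push_grid[OF h] euler_drift_eq[OF h]) simp
  ultimately have ps: "push h w s = push h w ?t - (?t - s) *\<^sub>R drift ?x"
    using tu by (simp add: algebra_simps)
  have "w s + push h w s - eulerc h w s = (w s - w ?t) - (?t - s) *\<^sub>R drift ?x"
    unfolding ps push_grid[OF h] eulerc_def j1 by simp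
  then have "norm (w s + push h w s - eulerc h w s) \<le> norm (w s - w ?t) + norm ((?t - s) *\<^sub>R drift ?x)"
    by (simp only: norm_triangle_ineq4)
  also have "norm (w s - w ?t) \<le> r" using s jh tu h by (intro osc) auto
  also have "norm ((?t - s) *\<^sub>R drift ?x) \<le> norm (h *\<^sub>R drift ?x)"
    using jh tu h by (auto intro!: mult_right_mono simp del: euler.simps)
  also have "\<dots> \<le> 2 * norm (w ?t - w ?u) + sqrt (h * total)" by (rule euler_increment_le[where w=w, OF h w0])
  also have "norm (w ?t - w ?u) \<le> r" using s jh tu h by (intro osc) auto
  finally show ?thesis by simp
qed

text \<open>A self-improving bound. Coercivity bounds the variation linearly by the size v of the
  push, while the energy estimate bounds v^2 linearly by the variation. Thus v^2 \<le> P + Q v,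
  which forces v \<le> 1 + P + Q.\<close>

lemma push_bounds:
  assumes a: "a \<in> C" and c: "0 < c" "\<And>x. x \<in> C \<Longrightarrow> norm (drift x) \<le> c * (drift x \<bullet> a)"
    and h: "0 < h" and w0: "w 0 \<in> C" and t: "0 \<le> t"
    and W: "\<And>s. 0 \<le> s \<Longrightarrow> s \<le> t \<Longrightarrow> norm (w s) \<le> W"
    and err: "\<And>s. 0 \<le> s \<Longrightarrow> s \<le> t \<Longrightarrow> norm (w s + push h w s - eulerc h w s) \<le> e"
  shows "pushvar h w t \<le> c * norm a * (1 + 2 * total * t + 2 * (W + e) * c * norm a)"
proof -
  let ?b = "\<lambda>s. drift (eulerc h w s)"
  note xC = eulerc_in_C[where w=w, OF h w0]
  have We: "0 \<le> W + e" using W[OF order_refl t] err[OF order_refl t] norm_ge_zero[of "w 0"]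
      norm_ge_zero[of "w 0 + push h w 0 - eulerc h w 0"] by linarith
  have bi: "?b integrable_on {0..t}" and ni: "(\<lambda>s. norm (?b s)) integrable_on {0..t}"
    using eulerc_integrable[OF h, of drift] eulerc_integrable[OF h, of "\<lambda>x. norm (drift x)"] by blast+
  have "pushvar h w t \<le> integral {0..t} (\<lambda>s. c * (?b s \<bullet> a))"
    unfolding pushvar_def using c(2)[OF xC] eulerc_integrable[OF h, of "\<lambda>x. c * (drift x \<bullet> a)"]
    by (intro integral_le ni) auto
  also have "\<dots> = c * (push h w t \<bullet> a)"
    unfolding push_def using integral_linear[OF bi bounded_linear_inner_left] by (simp add: o_def)
  also have "\<dots> \<le> c * (norm (push h w t) * norm a)"
    using c(1) norm_cauchy_schwarz by (intro mult_left_mono) auto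
  finally have V: "pushvar h w t \<le> c * norm a * norm (push h w t)" by (simp add: ac_simps)
  have "(norm (push h w t))\<^sup>2 \<le> 2 * integral {0..t} (\<lambda>s. total + (W + e) * norm (?b s))"
    unfolding push_def
  proof (rule energy_estimate[OF t eulerc_absolutely_integrable[OF h]])
    show "(\<lambda>s. total + (W + e) * norm (?b s)) integrable_on {0..t}"
      by (rule eulerc_integrable[OF h, of "\<lambda>x. total + (W + e) * norm (drift x)"])
    fix s assume s: "s \<in> {0..t}"
    let ?r = "w s + push h w s - eulerc h w s"
    \<comment> \<open>The push is the position minus \<open>w\<close> plus the interpolation error,
      and the position pairs with its own drift to exactly \<open>total\<close>.\<close>
    have "push h w s \<bullet> ?b s = (eulerc h w s - w s + ?r) \<bullet> ?b s" by simp
    then have "push h w s \<bullet> ?b s = total - w s \<bullet> ?b s + ?r \<bullet> ?b s"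
      unfolding inner_add_left[of "eulerc h w s - w s"] inner_diff_left[of "eulerc h w s"]
        inner_commute[of "eulerc h w s"] drift_inner_self[OF xC] .
    moreover have "- (w s \<bullet> ?b s) \<le> W * norm (?b s)"
      using norm_cauchy_schwarz[of "- w s" "?b s"] mult_right_mono[OF W[of s] norm_ge_zero[of "?b s"]] s
      by simp
    moreover have "?r \<bullet> ?b s \<le> e * norm (?b s)"
      using order_trans[OF norm_cauchy_schwarz[of ?r "?b s"] mult_right_mono[OF err[of s] norm_ge_zero]] s
      by auto
    ultimately show "integral {0..s} ?b \<bullet> ?b s \<le> total + (W + e) * norm (?b s)"
      unfolding push_def[symmetric] distrib_right by linarith
  qed
  also have "integral {0..t} (\<lambda>s. total + (W + e) * norm (?b s)) = total * t + (W + e) * pushvar h w t"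
    unfolding pushvar_def using ni t by (subst integral_add) (auto intro: integrable_on_mult_right simp: mult.commute)
  finally have sq: "(norm (push h w t))\<^sup>2 \<le> 2 * (total * t + (W + e) * pushvar h w t)" .
  let ?v = "norm (push h w t)"
  have "(W + e) * pushvar h w t \<le> (W + e) * (c * norm a * ?v)" using V We by (rule mult_left_mono)
  then have "2 * (total * t + (W + e) * pushvar h w t) \<le> 2 * (total * t + (W + e) * (c * norm a * ?v))" by simp
  also have "\<dots> = 2 * total * t + 2 * (W + e) * c * norm a * ?v" by (simp add: algebra_simps)
  finally have sq2: "?v * ?v \<le> 2 * total * t + 2 * (W + e) * c * norm a * ?v"
    using sq unfolding power2_eq_square by (rule order_trans[rotated])
  have p1: "0 \<le> 2 * total * t" using t total_nonneg by simp
  have p2: "0 \<le> 2 * (W + e) * c * norm a" using We c(1) by simp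
  have "?v \<le> 1 + 2 * total * t + 2 * (W + e) * c * norm a"
  proof (cases "?v \<le> 1")
    case False
    then have "2 * total * t \<le> 2 * total * t * ?v" using mult_left_mono[OF _ p1, of 1 ?v] by simp
    with sq2 have "?v * ?v \<le> (2 * total * t + 2 * (W + e) * c * norm a) * ?v" by (simp add: distrib_right)
    with False have "?v \<le> 2 * total * t + 2 * (W + e) * c * norm a"
      by (subst (asm) mult_le_cancel_right_pos) auto
    then show ?thesis by simp
  qed (use p1 p2 in linarith)
  then have "c * norm a * ?v \<le> c * norm a * (1 + 2 * total * t + 2 * (W + e) * c * norm a)"
    using c(1) by (intro mult_left_mono) auto
  with V show ?thesis by (rule order_trans)
qed

text \<open>In the energy estimate for the difference of two meshes monotonicity discards the main
  term. Only the interpolation errors paired with the drifts remain, and these vanish with the mesh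
  as long as the variations stay bounded.\<close>

lemma push_Cauchy:
  assumes h: "0 < h" "0 < h'" and w0: "w 0 \<in> C" and t: "0 \<le> t"
    and err: "\<And>s. 0 \<le> s \<Longrightarrow> s \<le> t \<Longrightarrow> norm (w s + push h w s - eulerc h w s) \<le> e"
    and err': "\<And>s. 0 \<le> s \<Longrightarrow> s \<le> t \<Longrightarrow> norm (w s + push h' w s - eulerc h' w s) \<le> e'"
  shows "(norm (push h w t - push h' w t))\<^sup>2 \<le> 2 * ((e + e') * (pushvar h w t + pushvar h' w t))"
proof -
  let ?b = "\<lambda>s. drift (eulerc h w s)" and ?b' = "\<lambda>s. drift (eulerc h' w s)"
  note xC = eulerc_in_C[where w=w, OF h(1) w0] and xC' = eulerc_in_C[where w=w, OF h(2) w0]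
  have diff: "push h w s - push h' w s = integral {0..s} (\<lambda>s. ?b s - ?b' s)" for s
    unfolding push_def by (rule integral_diff[symmetric]) (rule eulerc_integrable[OF h(1)] eulerc_integrable[OF h(2)])+
  have "(norm (push h w t - push h' w t))\<^sup>2 \<le> 2 * integral {0..t} (\<lambda>s. (e + e') * (norm (?b s) + norm (?b' s)))"
    unfolding diff
  proof (rule energy_estimate[OF t])
    show "(\<lambda>s. ?b s - ?b' s) absolutely_integrable_on {0..t}"
      using eulerc_absolutely_integrable[OF h(1)] eulerc_absolutely_integrable[OF h(2)]
      by (intro set_integral_diff) auto
    show "(\<lambda>s. (e + e') * (norm (?b s) + norm (?b' s))) integrable_on {0..t}"
      using eulerc_integrable[OF h(1), of "\<lambda>x. norm (drift x)"] eulerc_integrable[OF h(2), of "\<lambda>x. norm (drift x)"]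
      by (intro integrable_on_mult_right integrable_add) auto
    fix s assume s: "s \<in> {0..t}"
    let ?r = "w s + push h w s - eulerc h w s" and ?r' = "w s + push h' w s - eulerc h' w s"
    have "(push h w s - push h' w s) \<bullet> (?b s - ?b' s)
        = (eulerc h w s - eulerc h' w s) \<bullet> (?b s - ?b' s) + (?r - ?r') \<bullet> (?b s - ?b' s)"
      by (simp flip: inner_add_left)
    also have "\<dots> \<le> 0 + norm (?r - ?r') * norm (?b s - ?b' s)"
      by (intro add_mono drift_mono xC xC' norm_cauchy_schwarz)
    also have "\<dots> \<le> (e + e') * (norm (?b s) + norm (?b' s))"
    proof -
      have "norm (?r - ?r') \<le> e + e'"
        using norm_triangle_ineq4[of ?r ?r'] err[of s] err'[of s] s by auto
      then show ?thesis
        using norm_triangle_ineq4[of "?b s" "?b' s"] order_trans[OF norm_ge_zero \<open>norm (?r - ?r') \<le> e + e'\<close>]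
        unfolding add_0 by (intro mult_mono) simp_all
    qed
    finally show "integral {0..s} (\<lambda>s. ?b s - ?b' s) \<bullet> (?b s - ?b' s) \<le> (e + e') * (norm (?b s) + norm (?b' s))"
      unfolding diff[symmetric] .
  qed
  also have "integral {0..t} (\<lambda>s. (e + e') * (norm (?b s) + norm (?b' s))) = (e + e') * (pushvar h w t + pushvar h' w t)"
    unfolding pushvar_def
    using eulerc_integrable[OF h(1), of "\<lambda>x. norm (drift x)"] eulerc_integrable[OF h(2), of "\<lambda>x. norm (drift x)"]
    by (simp add: integral_add)
  finally show ?thesis .
qed

end

section \<open>Convergence of the scheme\<close>

text \<open>Dyadic meshes make every natural time \<open>T\<close> a grid point, with index
  \<open>T * 2 ^ n\<close>.\<close>

definition mesh :: "nat \<Rightarrow> real" where "mesh n = 1 / 2 ^ n"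

lemma mesh_pos: "0 < mesh n" by (simp add: mesh_def)

lemma mesh_le_1: "mesh n \<le> 1" by (simp add: mesh_def)

lemma mesh_tendsto_0: "mesh \<longlonglongrightarrow> 0"
  unfolding mesh_def by (rule LIMSEQ_divide_realpow_zero) simp

locale repelled_path = wall_repulsion +
  fixes w :: "real \<Rightarrow> 'a"
  assumes cont: "continuous_on {0..} w" and start: "w 0 \<in> weyl_chamber S"
begin

lemma eulerc_mesh_in_C: "eulerc (mesh n) w s \<in> C"
  by (rule eulerc_in_C[where w=w, OF mesh_pos start])

lemma error_small:
  assumes T: "0 \<le> T" and e: "0 < e"
  shows "\<exists>N. \<forall>n\<ge>N. \<forall>s\<in>{0..T}. norm (w s + push (mesh n) w s - eulerc (mesh n) w s) \<le> e"
proof -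
  have "uniformly_continuous_on {0..T + 1} w"
    by (intro compact_uniformly_continuous continuous_on_subset[OF cont]) auto
  then obtain d where d: "d > 0" "\<And>x y. x \<in> {0..T + 1} \<Longrightarrow> y \<in> {0..T + 1} \<Longrightarrow> \<bar>y - x\<bar> < d \<Longrightarrow> norm (w y - w x) < e / 6"
  proof -
    have "0 < e / 6" using e by simp
    with \<open>uniformly_continuous_on {0..T + 1} w\<close> show ?thesis
      using that unfolding uniformly_continuous_on_def dist_norm real_norm_def by blast
  qed
  have "(\<lambda>n. sqrt (mesh n * total)) \<longlonglongrightarrow> sqrt (0 * total)"
    by (intro tendsto_intros mesh_tendsto_0)
  then have "\<forall>\<^sub>F n in sequentially. sqrt (mesh n * total) < e / 2"
    using e by (intro order_tendstoD) auto
  moreover have "\<forall>\<^sub>F n in sequentially. mesh n < d"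
    using d(1) mesh_tendsto_0 by (intro order_tendstoD)
  ultimately have "\<forall>\<^sub>F n in sequentially. sqrt (mesh n * total) < e / 2 \<and> mesh n < d"
    by (rule eventually_conj)
  then obtain N where N: "\<And>n. n \<ge> N \<Longrightarrow> sqrt (mesh n * total) < e / 2 \<and> mesh n < d"
    by (auto simp: eventually_sequentially)
  show ?thesis
  proof (intro exI allI impI ballI)
    fix n s assume n: "n \<ge> N" and s: "s \<in> {0..T}"
    have "norm (w s + push (mesh n) w s - eulerc (mesh n) w s) \<le> 3 * (e / 6) + sqrt (mesh n * total)"
    proof (rule eulerc_error[where w=w, OF mesh_pos start])
      fix s t assume "0 \<le> s" "s \<le> T + mesh n" "0 \<le> t" "t \<le> T + mesh n" "\<bar>s - t\<bar> \<le> mesh n"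
      then show "norm (w s - w t) \<le> e / 6"
        using d(2)[of t s] N[OF n] mesh_le_1[of n] by (auto intro!: less_imp_le)
    qed (use s in auto)
    with N[OF n] show "norm (w s + push (mesh n) w s - eulerc (mesh n) w s) \<le> e" by linarith
  qed
qed

lemma pushvar_bounded:
  assumes T: "0 \<le> T"
  shows "\<exists>V>0. \<exists>N. \<forall>n\<ge>N. \<forall>t\<in>{0..T}. pushvar (mesh n) w t \<le> V"
proof -
  obtain c where c: "0 < c" "\<And>x. x \<in> C \<Longrightarrow> norm (drift x) \<le> c * (drift x \<bullet> w 0)"
    using drift_coercive[OF start] by blast
  have "compact (w ` {0..T})"
    by (intro compact_continuous_image continuous_on_subset[OF cont]) auto
  then have "bounded (w ` {0..T})" by (rule compact_imp_bounded)
  then obtain W where "\<forall>x\<in>w ` {0..T}. norm x \<le> W" unfolding bounded_iff by blast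
  then have W: "\<And>s. s \<in> {0..T} \<Longrightarrow> norm (w s) \<le> W" by blast
  have W0: "0 \<le> W" using W[of 0] T by (auto intro: order_trans[OF norm_ge_zero])
  obtain N where N: "\<And>n s. n \<ge> N \<Longrightarrow> s \<in> {0..T} \<Longrightarrow> norm (w s + push (mesh n) w s - eulerc (mesh n) w s) \<le> 1"
    using error_small[OF T zero_less_one] by blast
  define V where "V = c * norm (w 0) * (1 + 2 * total * T + 2 * (W + 1) * c * norm (w 0))"
  have "pushvar (mesh n) w t \<le> \<bar>V\<bar> + 1" if n: "n \<ge> N" and t: "t \<in> {0..T}" for n t
  proof -
    have "pushvar (mesh n) w t \<le> c * norm (w 0) * (1 + 2 * total * t + 2 * (W + 1) * c * norm (w 0))"
      using t by (intro push_bounds[where w=w, OF start c mesh_pos start] W N[OF n]) auto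
    also have "\<dots> \<le> V"
      unfolding V_def using t c(1) total_nonneg W0 by (intro mult_left_mono add_mono) auto
    finally show ?thesis by simp
  qed
  moreover have "0 < \<bar>V\<bar> + 1" by simp
  ultimately show ?thesis by blast
qed

lemma push_uniformly_Cauchy:
  assumes T: "0 \<le> T" and e: "0 < e"
  shows "\<exists>N. \<forall>m\<ge>N. \<forall>n\<ge>N. \<forall>t\<in>{0..T}. norm (push (mesh m) w t - push (mesh n) w t) \<le> e"
proof -
  obtain V N where V: "0 < V" "\<And>n t. n \<ge> N \<Longrightarrow> t \<in> {0..T} \<Longrightarrow> pushvar (mesh n) w t \<le> V"
    using pushvar_bounded[OF T] by blast
  \<comment> \<open>Chosen so that the Cauchy estimate, with both errors at most \<open>r\<close>
    and both variations at most \<open>V\<close>, reads 8 r V = e^2.\<close>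
  define r where "r = e\<^sup>2 / (8 * V)"
  have r: "0 < r" using e V by (simp add: r_def)
  obtain N' where N': "\<And>n s. n \<ge> N' \<Longrightarrow> s \<in> {0..T} \<Longrightarrow> norm (w s + push (mesh n) w s - eulerc (mesh n) w s) \<le> r"
    using error_small[OF T r] by blast
  have "norm (push (mesh m) w t - push (mesh n) w t) \<le> e"
    if "m \<ge> max N N'" "n \<ge> max N N'" and t: "t \<in> {0..T}" for m n t
  proof -
    have "(norm (push (mesh m) w t - push (mesh n) w t))\<^sup>2
        \<le> 2 * ((r + r) * (pushvar (mesh m) w t + pushvar (mesh n) w t))"
      using that by (intro push_Cauchy[where w=w, OF mesh_pos mesh_pos start] N') auto
    also have "\<dots> \<le> 2 * ((r + r) * (V + V))"
      using V(2)[OF _ t] that r by (intro mult_left_mono add_mono) auto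
    also have "\<dots> = e\<^sup>2" using V(1) by (simp add: r_def field_simps)
    finally show ?thesis using e by (simp add: power2_le_iff_abs_le)
  qed
  then show ?thesis by blast
qed

text \<open>The limit path, defined for the continuous interpolation; the step functions
  \<open>eulerc\<close> converge to it as well, uniformly on compact time intervals.\<close>

definition flow :: "real \<Rightarrow> 'a" where
  "flow t = lim (\<lambda>n. w t + push (mesh n) w t)"

lemma flow_uniform:
  assumes T: "0 \<le> T" and e: "0 < e"
  shows "\<exists>N. \<forall>n\<ge>N. \<forall>t\<in>{0..T}. norm (w t + push (mesh n) w t - flow t) \<le> e"
proof -
  have "uniformly_Cauchy_on {0..T} (\<lambda>n t. w t + push (mesh n) w t)"
  proof (rule uniformly_Cauchy_onI)
    fix e :: real assume "e > 0"
    then obtain N where N: "\<forall>m\<ge>N. \<forall>n\<ge>N. \<forall>t\<in>{0..T}. norm (push (mesh m) w t - push (mesh n) w t) \<le> e / 2"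
      using push_uniformly_Cauchy[OF T, of "e / 2"] by auto
    show "\<exists>M. \<forall>x\<in>{0..T}. \<forall>m\<ge>M. \<forall>n\<ge>M. dist (w x + push (mesh m) w x) (w x + push (mesh n) w x) < e"
    proof (intro exI ballI allI impI)
      fix x m n assume "x \<in> {0..T}" "N \<le> m" "N \<le> n"
      with N have "norm (push (mesh m) w x - push (mesh n) w x) \<le> e / 2" by blast
      with \<open>e > 0\<close> show "dist (w x + push (mesh m) w x) (w x + push (mesh n) w x) < e"
        by (simp add: dist_norm)
    qed
  qed
  then have "uniformly_convergent_on {0..T} (\<lambda>n t. w t + push (mesh n) w t)"
    by (rule Cauchy_uniformly_convergent)
  then have "uniform_limit {0..T} (\<lambda>n t. w t + push (mesh n) w t) flow sequentially"
    unfolding flow_def by (rule uniformly_convergent_uniform_limit_iff[THEN iffD1])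
  from uniform_limitD[OF this e] obtain N
    where "\<forall>n\<ge>N. \<forall>t\<in>{0..T}. norm (w t + push (mesh n) w t - flow t) < e"
    unfolding eventually_sequentially dist_norm by blast
  then show ?thesis by (meson less_imp_le)
qed

lemma eulerc_uniform:
  assumes T: "0 \<le> T" and e: "0 < e"
  shows "\<exists>N. \<forall>n\<ge>N. \<forall>t\<in>{0..T}. norm (eulerc (mesh n) w t - flow t) \<le> e"
proof -
  have e2: "0 < e / 2" using e by simp
  obtain N where N: "\<And>n t. n \<ge> N \<Longrightarrow> t \<in> {0..T} \<Longrightarrow> norm (w t + push (mesh n) w t - flow t) \<le> e / 2"
    using flow_uniform[OF T e2] by blast
  obtain N' where N': "\<And>n t. n \<ge> N' \<Longrightarrow> t \<in> {0..T} \<Longrightarrow> norm (w t + push (mesh n) w t - eulerc (mesh n) w t) \<le> e / 2"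
    using error_small[OF T e2] by blast
  have "norm (eulerc (mesh n) w t - flow t) \<le> e" if "n \<ge> max N N'" "t \<in> {0..T}" for n t
  proof -
    have "norm ((w t + push (mesh n) w t - flow t) - (w t + push (mesh n) w t - eulerc (mesh n) w t)) \<le> e / 2 + e / 2"
      using that by (intro order_trans[OF norm_triangle_ineq4] add_mono N N') auto
    then show ?thesis by simp
  qed
  then show ?thesis by blast
qed

lemma continuous_on_flow: "continuous_on {0..} flow"
proof (rule continuous_on_Ici)
  fix T :: real assume T: "0 \<le> T"
  show "continuous_on {0..T} flow"
  proof (rule uniform_limit_theorem[OF _ _ trivial_limit_sequentially])
    show "\<forall>\<^sub>F n in sequentially. continuous_on {0..T} (\<lambda>t. w t + push (mesh n) w t)"
      unfolding push_def
      by (intro always_eventually allI continuous_on_add continuous_on_subset[OF cont]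
          indefinite_integral_continuous_1 eulerc_integrable mesh_pos) auto
    show "uniform_limit {0..T} (\<lambda>n t. w t + push (mesh n) w t) flow sequentially"
    proof (rule uniform_limitI)
      fix e :: real assume "e > 0"
      then obtain N where N: "\<forall>n\<ge>N. \<forall>t\<in>{0..T}. norm (w t + push (mesh n) w t - flow t) \<le> e / 2"
        using flow_uniform[OF T, of "e / 2"] by auto
      show "\<forall>\<^sub>F n in sequentially. \<forall>x\<in>{0..T}. dist (w x + push (mesh n) w x) (flow x) < e"
        unfolding eventually_sequentially dist_norm
      proof (intro exI allI impI ballI)
        fix n x assume "N \<le> n" "x \<in> {0..T}"
        with N have "norm (w x + push (mesh n) w x - flow x) \<le> e / 2" by blast
        then show "norm (w x + push (mesh n) w x - flow x) < e" using \<open>e > 0\<close> by simp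
      qed
    qed
  qed
qed

lemma eulerc_tendsto: "0 \<le> t \<Longrightarrow> (\<lambda>n. eulerc (mesh n) w t) \<longlonglongrightarrow> flow t"
proof (rule LIMSEQ_I)
  fix r :: real assume t: "0 \<le> t" and "0 < r"
  then obtain N where "\<forall>n\<ge>N. \<forall>t\<in>{0..t}. norm (eulerc (mesh n) w t - flow t) \<le> r / 2"
    using eulerc_uniform[OF t, of "r / 2"] by auto
  then have "\<forall>n\<ge>N. norm (eulerc (mesh n) w t - flow t) \<le> r / 2" using t by auto
  then show "\<exists>no. \<forall>n\<ge>no. norm (eulerc (mesh n) w t - flow t) < r" using \<open>0 < r\<close>
    by (intro exI[of _ N]) (auto intro: le_less_trans)
qed

lemma flow_in_closure: "0 \<le> t \<Longrightarrow> flow t \<in> closure C"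
  by (rule Lim_in_closed_set[OF closed_closure _ _ eulerc_tendsto])
     (simp_all add: closure_subset[THEN subsetD] eulerc_mesh_in_C)

text \<open>Evaluating at the last grid point before \<open>t\<close> keeps the approximation adapted.\<close>

lemma euler_floor_tendsto:
  assumes t: "0 \<le> t"
  shows "(\<lambda>n. euler (mesh n) w (nat \<lfloor>t / mesh n\<rfloor>)) \<longlonglongrightarrow> flow t"
proof -
  define s where "s n = real (nat \<lfloor>t / mesh n\<rfloor>) * mesh n" for n
  have s: "0 \<le> s n" "s n \<le> t" "t - mesh n \<le> s n" for n
  proof -
    have eq: "real (nat \<lfloor>t / mesh n\<rfloor>) = of_int \<lfloor>t / mesh n\<rfloor>" using t mesh_pos[of n] by simp
    have "of_int \<lfloor>t / mesh n\<rfloor> \<le> t / mesh n" "t / mesh n - 1 \<le> of_int \<lfloor>t / mesh n\<rfloor>"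
      by linarith+
    then show "s n \<le> t" "t - mesh n \<le> s n"
      unfolding s_def eq pos_le_divide_eq[OF mesh_pos]
      using mesh_pos[of n] by (simp_all only: diff_le_eq pos_divide_le_eq) (simp_all add: field_simps)
    show "0 \<le> s n" unfolding s_def using mesh_pos[of n] by simp
  qed
  have "s \<longlonglongrightarrow> t"
  proof (rule tendsto_sandwich[of "\<lambda>n. t - mesh n" _ _ "\<lambda>n. t"])
    show "(\<lambda>n. t - mesh n) \<longlonglongrightarrow> t"
      using tendsto_diff[OF tendsto_const mesh_tendsto_0, of t] by simp
  qed (use s in auto)
  then have lim1: "(\<lambda>n. flow (s n)) \<longlonglongrightarrow> flow t"
    using continuous_on_tendsto_compose[OF continuous_on_flow, of s t] t s(1) by auto
  have lim2: "(\<lambda>n. euler (mesh n) w (nat \<lfloor>t / mesh n\<rfloor>) - flow (s n)) \<longlonglongrightarrow> 0"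
  proof (rule LIMSEQ_I)
    fix r :: real assume "0 < r"
    then obtain N where N: "\<forall>n\<ge>N. \<forall>t\<in>{0..t}. norm (w t + push (mesh n) w t - flow t) \<le> r / 2"
      using flow_uniform[OF t, of "r / 2"] by auto
    show "\<exists>no. \<forall>n\<ge>no. norm (euler (mesh n) w (nat \<lfloor>t / mesh n\<rfloor>) - flow (s n) - 0) < r"
    proof (intro exI allI impI)
      fix n assume "N \<le> n"
      moreover have "euler (mesh n) w (nat \<lfloor>t / mesh n\<rfloor>) = w (s n) + push (mesh n) w (s n)"
        unfolding s_def push_grid[OF mesh_pos] by simp
      moreover have "s n \<in> {0..t}" using s by auto
      ultimately have "norm (euler (mesh n) w (nat \<lfloor>t / mesh n\<rfloor>) - flow (s n)) \<le> r / 2"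
        using N by simp
      with \<open>0 < r\<close> show "norm (euler (mesh n) w (nat \<lfloor>t / mesh n\<rfloor>) - flow (s n) - 0) < r" by simp
    qed
  qed
  from tendsto_add[OF lim2 lim1] show ?thesis by simp
qed

end

section \<open>The limit equation\<close>

lemma inverse_max_Lipschitz:
  fixes u v :: real
  assumes "0 < \<delta>"
  shows "\<bar>1 / max \<delta> u - 1 / max \<delta> v\<bar> \<le> \<bar>u - v\<bar> / \<delta>\<^sup>2"
proof -
  define a b where "a = max \<delta> u" and "b = max \<delta> v"
  have ab: "\<delta> \<le> a" "\<delta> \<le> b" "\<bar>b - a\<bar> \<le> \<bar>u - v\<bar>" by (auto simp: a_def b_def)
  have "\<bar>1 / a - 1 / b\<bar> = \<bar>b - a\<bar> / (a * b)"
    using ab assms by (simp add: diff_frac_eq abs_mult)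
  also have "\<dots> \<le> \<bar>u - v\<bar> / (\<delta> * \<delta>)"
    using ab assms by (intro frac_le mult_mono) auto
  finally show ?thesis by (simp add: a_def b_def power2_eq_square)
qed

section \<open>Truncating the singularity of the drift\<close>

context wall_repulsion
begin

text \<open>Capping the reciprocals at 1/\<delta> makes the drift globally Lipschitz, so that its
  integral passes to the limit along the scheme.\<close>

definition cut_drift :: "real \<Rightarrow> 'a \<Rightarrow> 'a" where
  "cut_drift \<delta> x = (\<Sum>\<alpha>\<in>S. (k \<alpha> / max \<delta> (\<alpha> \<bullet> x)) *\<^sub>R \<alpha>)"

text \<open>What truncation at \<delta> may discard: the share of \<open>weight\<close> due to walls
  closer than \<delta>. Uniform smallness of its time integral is the absence of lost mass.\<close>

definition tail :: "real \<Rightarrow> 'a \<Rightarrow> real" where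
  "tail \<delta> x = (\<Sum>\<alpha>\<in>S. if \<alpha> \<bullet> x \<le> \<delta> then 1 / (\<alpha> \<bullet> x) else 0)"

lemma tail_nonneg: "x \<in> C \<Longrightarrow> 0 \<le> tail \<delta> x"
  unfolding tail_def using C_D by (intro sum_nonneg) (auto simp: less_imp_le)

lemma tail_mono: "x \<in> C \<Longrightarrow> \<delta> \<le> \<delta>' \<Longrightarrow> tail \<delta> x \<le> tail \<delta>' x"
  unfolding tail_def using C_D by (intro sum_mono) (auto simp: less_imp_le)

lemma inner_Lipschitz: "\<bar>\<alpha> \<bullet> x - \<alpha> \<bullet> y\<bar> \<le> norm \<alpha> * norm (x - y)" for \<alpha> x y :: 'a
  using Cauchy_Schwarz_ineq2[of \<alpha> "x - y"] by (simp add: inner_diff_right)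

lemma cut_drift_Lipschitz:
  assumes "0 < \<delta>"
  shows "\<exists>M>0. \<forall>x y. norm (cut_drift \<delta> x - cut_drift \<delta> y) \<le> M * norm (x - y)"
proof -
  let ?M = "\<Sum>\<alpha>\<in>S. k \<alpha> * norm \<alpha> * norm \<alpha> / \<delta>\<^sup>2"
  have M0: "0 \<le> ?M" using k_pos by (intro sum_nonneg) (auto simp: less_imp_le)
  have "norm (cut_drift \<delta> x - cut_drift \<delta> y) \<le> ?M * norm (x - y)" for x y
  proof -
    have "cut_drift \<delta> x - cut_drift \<delta> y = (\<Sum>\<alpha>\<in>S. (k \<alpha> * (1 / max \<delta> (\<alpha> \<bullet> x) - 1 / max \<delta> (\<alpha> \<bullet> y))) *\<^sub>R \<alpha>)"
      unfolding cut_drift_def by (simp add: sum_subtractf[symmetric] scaleR_diff_left[symmetric] right_diff_distrib)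
    also have "norm \<dots> \<le> (\<Sum>\<alpha>\<in>S. norm ((k \<alpha> * (1 / max \<delta> (\<alpha> \<bullet> x) - 1 / max \<delta> (\<alpha> \<bullet> y))) *\<^sub>R \<alpha>))"
      by (rule norm_sum)
    also have "\<dots> \<le> (\<Sum>\<alpha>\<in>S. k \<alpha> * norm \<alpha> * norm \<alpha> / \<delta>\<^sup>2 * norm (x - y))"
    proof (rule sum_mono)
      fix \<alpha> assume al: "\<alpha> \<in> S"
      have "\<bar>1 / max \<delta> (\<alpha> \<bullet> x) - 1 / max \<delta> (\<alpha> \<bullet> y)\<bar> \<le> \<bar>\<alpha> \<bullet> x - \<alpha> \<bullet> y\<bar> / \<delta>\<^sup>2"
        by (rule inverse_max_Lipschitz[OF assms])
      also have "\<dots> \<le> norm \<alpha> * norm (x - y) / \<delta>\<^sup>2"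
        by (intro divide_right_mono inner_Lipschitz) auto
      finally have "k \<alpha> * \<bar>1 / max \<delta> (\<alpha> \<bullet> x) - 1 / max \<delta> (\<alpha> \<bullet> y)\<bar> * norm \<alpha>
          \<le> k \<alpha> * (norm \<alpha> * norm (x - y) / \<delta>\<^sup>2) * norm \<alpha>"
        using k_pos[OF al] by (intro mult_right_mono mult_left_mono) auto
      then show "norm ((k \<alpha> * (1 / max \<delta> (\<alpha> \<bullet> x) - 1 / max \<delta> (\<alpha> \<bullet> y))) *\<^sub>R \<alpha>)
          \<le> k \<alpha> * norm \<alpha> * norm \<alpha> / \<delta>\<^sup>2 * norm (x - y)"
        using k_pos[OF al] by (simp add: abs_mult ac_simps)
    qed
    finally show ?thesis by (simp add: sum_distrib_right)
  qed
  then have "norm (cut_drift \<delta> x - cut_drift \<delta> y) \<le> (?M + 1) * norm (x - y)" for x y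
    by (rule order_trans) (auto intro!: mult_right_mono)
  moreover have "0 < ?M + 1" using M0 by simp
  ultimately show ?thesis by blast
qed

lemma cut_drift_error:
  "\<exists>M>0. \<forall>x\<in>C. \<forall>\<delta>>0. norm (drift x - cut_drift \<delta> x) \<le> M * (\<Sum>\<alpha>\<in>S. 1 / (\<alpha> \<bullet> x) - 1 / max \<delta> (\<alpha> \<bullet> x))"
proof -
  obtain M where M: "0 < M" "\<And>\<alpha>. \<alpha> \<in> S \<Longrightarrow> k \<alpha> * norm \<alpha> \<le> M"
    using finite_upper_bound[OF fin, of "\<lambda>\<alpha>. k \<alpha> * norm \<alpha>"] by blast
  have "norm (drift x - cut_drift \<delta> x) \<le> M * (\<Sum>\<alpha>\<in>S. 1 / (\<alpha> \<bullet> x) - 1 / max \<delta> (\<alpha> \<bullet> x))"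
    if x: "x \<in> C" and d: "0 < \<delta>" for x \<delta>
  proof -
    have "drift x - cut_drift \<delta> x = (\<Sum>\<alpha>\<in>S. (k \<alpha> * (1 / (\<alpha> \<bullet> x) - 1 / max \<delta> (\<alpha> \<bullet> x))) *\<^sub>R \<alpha>)"
      unfolding cut_drift_def drift_def by (simp add: sum_subtractf[symmetric] scaleR_diff_left[symmetric] right_diff_distrib)
    also have "norm \<dots> \<le> (\<Sum>\<alpha>\<in>S. norm ((k \<alpha> * (1 / (\<alpha> \<bullet> x) - 1 / max \<delta> (\<alpha> \<bullet> x))) *\<^sub>R \<alpha>))"
      by (rule norm_sum)
    also have "\<dots> \<le> (\<Sum>\<alpha>\<in>S. M * (1 / (\<alpha> \<bullet> x) - 1 / max \<delta> (\<alpha> \<bullet> x)))"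
    proof (rule sum_mono)
      fix \<alpha> assume al: "\<alpha> \<in> S"
      have p: "0 \<le> 1 / (\<alpha> \<bullet> x) - 1 / max \<delta> (\<alpha> \<bullet> x)"
        using C_D[OF x al] d by (simp add: frac_le)
      have "norm ((k \<alpha> * (1 / (\<alpha> \<bullet> x) - 1 / max \<delta> (\<alpha> \<bullet> x))) *\<^sub>R \<alpha>)
          = (k \<alpha> * norm \<alpha>) * (1 / (\<alpha> \<bullet> x) - 1 / max \<delta> (\<alpha> \<bullet> x))"
        using k_pos[OF al] p by (simp add: abs_mult)
      also have "\<dots> \<le> M * (1 / (\<alpha> \<bullet> x) - 1 / max \<delta> (\<alpha> \<bullet> x))"
        using M(2)[OF al] p by (rule mult_right_mono)
      finally show "norm ((k \<alpha> * (1 / (\<alpha> \<bullet> x) - 1 / max \<delta> (\<alpha> \<bullet> x))) *\<^sub>R \<alpha>)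
        \<le> M * (1 / (\<alpha> \<bullet> x) - 1 / max \<delta> (\<alpha> \<bullet> x))" .
    qed
    finally show ?thesis by (simp add: sum_distrib_left)
  qed
  with M(1) show ?thesis by blast
qed

lemma inverse_diff_le_tail:
  assumes "x \<in> C" "0 < \<delta>"
  shows "(\<Sum>\<alpha>\<in>S. 1 / (\<alpha> \<bullet> x) - 1 / max \<delta> (\<alpha> \<bullet> x)) \<le> tail \<delta> x"
  unfolding tail_def using C_D[OF assms(1)] assms(2) by (intro sum_mono) (auto simp: max_def)

end

section \<open>Integrability of the drift along the limit path\<close>

context repelled_path
begin

lemma integral_eulerc_flow:
  fixes g :: "'a \<Rightarrow> 'b::euclidean_space"
  assumes T: "0 \<le> T" and e: "0 < e" and M: "0 < M" "\<And>x y. norm (g x - g y) \<le> M * norm (x - y)"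
  shows "(\<lambda>s. g (flow s)) integrable_on {0..T}"
    and "\<exists>N. \<forall>n\<ge>N. \<forall>t\<in>{0..T}. norm (integral {0..t} (\<lambda>s. g (eulerc (mesh n) w s)) - integral {0..t} (\<lambda>s. g (flow s))) \<le> e"
proof -
  have gc: "continuous_on UNIV g"
  proof -
    have "lipschitz_on M UNIV g" using M by (intro lipschitz_onI) (auto simp: dist_norm)
    then show ?thesis by (rule lipschitz_on_continuous_on)
  qed
  have gi: "(\<lambda>s. g (flow s)) integrable_on {0..t}" for t
    by (intro integrable_continuous_interval continuous_on_compose2[OF gc] continuous_on_subset[OF continuous_on_flow]) auto
  then show "(\<lambda>s. g (flow s)) integrable_on {0..T}" .
  define r where "r = e / (M * (T + 1))"
  have r: "0 < r" using e M T by (simp add: r_def)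
  obtain N where N: "\<And>n t. n \<ge> N \<Longrightarrow> t \<in> {0..T} \<Longrightarrow> norm (eulerc (mesh n) w t - flow t) \<le> r"
    using eulerc_uniform[OF T r] by blast
  have "norm (integral {0..t} (\<lambda>s. g (eulerc (mesh n) w s)) - integral {0..t} (\<lambda>s. g (flow s))) \<le> e"
    if n: "n \<ge> N" and t: "t \<in> {0..T}" for n t
  proof -
    have ei: "(\<lambda>s. g (eulerc (mesh n) w s)) integrable_on {0..t}" by (rule eulerc_integrable[OF mesh_pos])
    have "norm (integral {0..t} (\<lambda>s. g (eulerc (mesh n) w s) - g (flow s))) \<le> integral {0..t} (\<lambda>s. M * r)"
    proof (rule integral_norm_bound_integral)
      show "(\<lambda>s. g (eulerc (mesh n) w s) - g (flow s)) integrable_on {0..t}"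
        by (intro integrable_diff ei gi)
      fix s assume "s \<in> {0..t}"
      then have "norm (eulerc (mesh n) w s - flow s) \<le> r" using t by (intro N n) auto
      then show "norm (g (eulerc (mesh n) w s) - g (flow s)) \<le> M * r"
        using M by (meson less_imp_le mult_left_mono order_trans)
    qed auto
    also have "\<dots> = t * (M * r)" using t by simp
    also have "\<dots> \<le> (T + 1) * (M * r)" using t M r by (intro mult_right_mono) auto
    also have "\<dots> = e" using M T by (simp add: r_def)
    finally show ?thesis by (simp add: integral_diff[OF ei gi])
  qed
  then show "\<exists>N. \<forall>n\<ge>N. \<forall>t\<in>{0..T}. norm (integral {0..t} (\<lambda>s. g (eulerc (mesh n) w s)) - integral {0..t} (\<lambda>s. g (flow s))) \<le> e"
    by blast
qed

lemma inverse_max_integrable: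
  assumes "0 \<le> T" "0 < \<delta>"
  shows "(\<lambda>s. 1 / max \<delta> (\<beta> \<bullet> flow s)) integrable_on {0..T}"
  using assms
  by (intro integrable_continuous_interval continuous_intros continuous_on_subset[OF continuous_on_flow]) auto

text \<open>Bounded variation of the push bounds the time integral of \<open>weight\<close> along
  the scheme, and the truncated reciprocal passes to the limit with error at most 1. The mesh used
  depends on \<delta>, but the resulting bound does not.\<close>

lemma inverse_max_bounded:
  assumes T: "0 \<le> T" and b: "\<beta> \<in> S"
  shows "\<exists>V>0. \<forall>\<delta>>0. integral {0..T} (\<lambda>s. 1 / max \<delta> (\<beta> \<bullet> flow s)) \<le> V"
proof -
  obtain c where c: "0 < c" "\<And>x. x \<in> C \<Longrightarrow> weight x \<le> c * (drift x \<bullet> w 0)"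
    using drift_coercive[OF start] by blast
  obtain V N where V: "0 < V" "\<And>n t. n \<ge> N \<Longrightarrow> t \<in> {0..T} \<Longrightarrow> pushvar (mesh n) w t \<le> V"
    using pushvar_bounded[OF T] by blast
  have "integral {0..T} (\<lambda>s. 1 / max \<delta> (\<beta> \<bullet> flow s)) \<le> c * norm (w 0) * V + 1" if d: "0 < \<delta>" for \<delta>
  proof -
    let ?M = "(norm \<beta> + 1) / \<delta>\<^sup>2"
    have lip: "norm (1 / max \<delta> (\<beta> \<bullet> x) - 1 / max \<delta> (\<beta> \<bullet> y)) \<le> ?M * norm (x - y)" for x y
    proof -
      have "\<bar>1 / max \<delta> (\<beta> \<bullet> x) - 1 / max \<delta> (\<beta> \<bullet> y)\<bar> \<le> \<bar>\<beta> \<bullet> x - \<beta> \<bullet> y\<bar> / \<delta>\<^sup>2"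
        by (rule inverse_max_Lipschitz[OF d])
      also have "\<dots> \<le> ((norm \<beta> + 1) * norm (x - y)) / \<delta>\<^sup>2"
        by (intro divide_right_mono order_trans[OF inner_Lipschitz] mult_right_mono) auto
      finally show ?thesis by simp
    qed
    have M0: "0 < ?M" using d by (simp add: add_nonneg_pos)
    obtain N' where N': "\<And>n t. n \<ge> N' \<Longrightarrow> t \<in> {0..T} \<Longrightarrow>
        norm (integral {0..t} (\<lambda>s. 1 / max \<delta> (\<beta> \<bullet> eulerc (mesh n) w s)) - integral {0..t} (\<lambda>s. 1 / max \<delta> (\<beta> \<bullet> flow s))) \<le> 1"
      using integral_eulerc_flow(2)[OF T zero_less_one M0 lip] by blast
    define n where "n = max N N'"
    have "integral {0..T} (\<lambda>s. 1 / max \<delta> (\<beta> \<bullet> flow s)) \<le> integral {0..T} (\<lambda>s. 1 / max \<delta> (\<beta> \<bullet> eulerc (mesh n) w s)) + 1"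
      using N'[of n T] T by (simp add: n_def)
    also have "integral {0..T} (\<lambda>s. 1 / max \<delta> (\<beta> \<bullet> eulerc (mesh n) w s))
        \<le> integral {0..T} (\<lambda>s. c * norm (w 0) * norm (drift (eulerc (mesh n) w s)))"
    proof (rule integral_le)
      show "(\<lambda>s. 1 / max \<delta> (\<beta> \<bullet> eulerc (mesh n) w s)) integrable_on {0..T}"
        by (rule eulerc_integrable[OF mesh_pos])
      show "(\<lambda>s. c * norm (w 0) * norm (drift (eulerc (mesh n) w s))) integrable_on {0..T}"
        by (rule eulerc_integrable[OF mesh_pos])
      fix s
      let ?x = "eulerc (mesh n) w s"
      have x: "?x \<in> C" by (rule eulerc_mesh_in_C)
      have "1 / max \<delta> (\<beta> \<bullet> ?x) \<le> 1 / (\<beta> \<bullet> ?x)" using C_D[OF x b] by (intro frac_le) auto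
      also have "\<dots> \<le> weight ?x" by (rule inverse_le_weight[OF x b])
      also have "\<dots> \<le> c * (drift ?x \<bullet> w 0)" by (rule c(2)[OF x])
      also have "\<dots> \<le> c * (norm (drift ?x) * norm (w 0))"
        using c(1) norm_cauchy_schwarz by (intro mult_left_mono) auto
      finally show "1 / max \<delta> (\<beta> \<bullet> ?x) \<le> c * norm (w 0) * norm (drift ?x)" by (simp add: ac_simps)
    qed
    also have "\<dots> = c * norm (w 0) * pushvar (mesh n) w T" by (simp add: pushvar_def)
    also have "\<dots> \<le> c * norm (w 0) * V"
      using V(2)[of n T] T c(1) by (intro mult_left_mono) (auto simp: n_def)
    finally show ?thesis by simp
  qed
  moreover have "0 < c * norm (w 0) * V + 1" using c(1) V(1) by (intro add_nonneg_pos) auto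
  ultimately show ?thesis by blast
qed

text \<open>On this set of times the truncated reciprocal equals 1/\<delta>, so its measure is at
  most \<open>V * \<delta>\<close> for every \<delta>. The argument is deterministic.\<close>

lemma negligible_wall_time:
  assumes T: "0 \<le> T" and b: "\<beta> \<in> S"
  shows "negligible {s\<in>{0..T}. \<beta> \<bullet> flow s \<le> 0}"
proof -
  let ?Z = "{s\<in>{0..T}. \<beta> \<bullet> flow s \<le> 0}"
  obtain V where V: "0 < V" "\<And>\<delta>. 0 < \<delta> \<Longrightarrow> integral {0..T} (\<lambda>s. 1 / max \<delta> (\<beta> \<bullet> flow s)) \<le> V"
    using inverse_max_bounded[OF T b] by blast
  have "continuous_on {0..T} (\<lambda>s. \<beta> \<bullet> flow s)"
    by (intro continuous_intros continuous_on_subset[OF continuous_on_flow]) auto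
  then have lm: "?Z \<in> lmeasurable" by (rule lmeasurable_compact[OF compact_sublevel])
  have le: "measure lebesgue ?Z / \<delta> \<le> V" if d: "0 < \<delta>" for \<delta>
  proof -
    have sub: "?Z \<inter> {0..T} = ?Z" by auto
    have ind: "indicat_real ?Z integrable_on {0..T}"
      using integrable_on_indicator[of ?Z "{0..T}"] lm unfolding sub by simp
    have "measure lebesgue ?Z = integral {0..T} (indicat_real ?Z)"
      using Equivalence_Lebesgue_Henstock_Integration.integral_indicator[of ?Z "{0..T}"] lm unfolding sub by simp
    then have "measure lebesgue ?Z / \<delta> = integral {0..T} (\<lambda>s. indicat_real ?Z s / \<delta>)" by simp
    also have "\<dots> \<le> integral {0..T} (\<lambda>s. 1 / max \<delta> (\<beta> \<bullet> flow s))"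
    proof (rule integral_le)
      show "(\<lambda>s. indicat_real ?Z s / \<delta>) integrable_on {0..T}"
        using ind integrable_on_divide by blast
      show "(\<lambda>s. 1 / max \<delta> (\<beta> \<bullet> flow s)) integrable_on {0..T}" by (rule inverse_max_integrable[OF T d])
      fix s show "indicat_real ?Z s / \<delta> \<le> 1 / max \<delta> (\<beta> \<bullet> flow s)"
        using d by (auto simp: indicator_def max_def)
    qed
    also have "\<dots> \<le> V" by (rule V(2)[OF d])
    finally show ?thesis .
  qed
  have "measure lebesgue ?Z \<le> 0 + e" if e: "0 < e" for e
  proof -
    have p: "0 < e / V" using e V(1) by simp
    from le[OF p] have "measure lebesgue ?Z \<le> V * (e / V)" by (simp only: pos_divide_le_eq[OF p])
    with V(1) show ?thesis by simp
  qed
  then have "measure lebesgue ?Z \<le> 0" by (rule field_le_epsilon)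
  then have "measure lebesgue ?Z = 0" using measure_nonneg[of lebesgue ?Z] by linarith
  then show ?thesis using lm by (simp add: negligible_iff_measure)
qed

lemma negligible_boundary_time:
  assumes T: "0 \<le> T"
  shows "negligible {s\<in>{0..T}. flow s \<notin> C}"
proof -
  have "{s\<in>{0..T}. flow s \<notin> C} \<subseteq> (\<Union>\<beta>\<in>S. {s\<in>{0..T}. \<beta> \<bullet> flow s \<le> 0})"
    by (auto simp: weyl_chamber_def not_less)
  moreover have "negligible (\<Union>\<beta>\<in>S. {s\<in>{0..T}. \<beta> \<bullet> flow s \<le> 0})"
    using fin negligible_wall_time[OF T] by (intro negligible_Union) auto
  ultimately show ?thesis by (rule negligible_subset[rotated])
qed

text \<open>Monotone convergence as the truncation level decreases to zero; putting zero outside the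
  chamber alters the integrand at a null set of times only.\<close>

lemma inverse_integrable:
  assumes T: "0 \<le> T" and b: "\<beta> \<in> S"
  shows "(\<lambda>s. if flow s \<in> C then 1 / (\<beta> \<bullet> flow s) else 0) integrable_on {0..T}"
    and "(\<lambda>m. integral {0..T} (\<lambda>s. 1 / max (1 / real (Suc m)) (\<beta> \<bullet> flow s)))
      \<longlonglongrightarrow> integral {0..T} (\<lambda>s. if flow s \<in> C then 1 / (\<beta> \<bullet> flow s) else 0)"
proof -
  let ?g = "\<lambda>s. if flow s \<in> C then 1 / (\<beta> \<bullet> flow s) else 0"
  let ?h = "\<lambda>m s. 1 / max (1 / real (Suc m)) (\<beta> \<bullet> flow s)"
  let ?f = "\<lambda>m s. if flow s \<in> C then ?h m s else 0"
  let ?N = "{s\<in>{0..T}. flow s \<notin> C}"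
  obtain V where V: "0 < V" "\<And>\<delta>. 0 < \<delta> \<Longrightarrow> integral {0..T} (\<lambda>s. 1 / max \<delta> (\<beta> \<bullet> flow s)) \<le> V"
    using inverse_max_bounded[OF T b] by blast
  note neg = negligible_boundary_time[OF T]
  have hi: "?h m integrable_on {0..T}" for m by (rule inverse_max_integrable[OF T]) simp
  have fi: "?f m integrable_on {0..T}" for m
    by (rule integrable_spike[OF hi[of m] neg]) auto
  have eq: "integral {0..T} (?f m) = integral {0..T} (?h m)" for m
    by (rule integral_spike[OF neg]) auto
  have mc: "?g integrable_on {0..T} \<and> (\<lambda>m. integral {0..T} (?f m)) \<longlonglongrightarrow> integral {0..T} ?g"
  proof (rule monotone_convergence_increasing[OF fi])
    fix m s
    have "1 / real (Suc (Suc m)) \<le> 1 / real (Suc m)" by (intro frac_le) auto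
    then show "?f m s \<le> ?f (Suc m) s"
      using frac_le[of 1 1 "max (1 / real (Suc (Suc m))) (\<beta> \<bullet> flow s)" "max (1 / real (Suc m)) (\<beta> \<bullet> flow s)"]
      by (auto simp: less_max_iff_disj simp del: of_nat_Suc)
  next
    fix s assume s: "s \<in> {0..T}"
    show "(\<lambda>m. ?f m s) \<longlonglongrightarrow> ?g s"
    proof (cases "flow s \<in> C")
      case True
      then have p: "0 < \<beta> \<bullet> flow s" using C_D b by blast
      have "(\<lambda>m. max (1 / real (Suc m)) (\<beta> \<bullet> flow s)) \<longlonglongrightarrow> max 0 (\<beta> \<bullet> flow s)"
        by (intro tendsto_max tendsto_const LIMSEQ_Suc lim_1_over_n)
      then have "(\<lambda>m. ?h m s) \<longlonglongrightarrow> 1 / max 0 (\<beta> \<bullet> flow s)"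
        using p by (intro tendsto_divide tendsto_const) auto
      with True p show ?thesis by (simp add: max_def)
    qed simp
  next
    have "0 \<le> integral {0..T} (?h m)" for m by (intro integral_nonneg hi) (auto simp: le_max_iff_disj)
    then show "bounded (range (\<lambda>m. integral {0..T} (?f m)))"
      unfolding eq bounded_iff using V(2) by (intro exI[of _ V]) auto
  qed
  then show "?g integrable_on {0..T}" "(\<lambda>m. integral {0..T} (?h m)) \<longlonglongrightarrow> integral {0..T} ?g"
    by (simp_all add: eq)
qed

end

section \<open>Transfer between Lebesgue and gauge integrals; measurability of the scheme\<close>

context wall_repulsion
begin

lemma drift_measurable [measurable]: "drift \<in> borel_measurable borel"
  unfolding drift_def by measurable

lemma C_sets [measurable]: "C \<in> sets borel"
  using open_C by (rule borel_open)

text \<open>The value zero outside the chamber reproduces the convention of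
  \<open>sde_solution\<close>, where only times in the chamber are integrated.\<close>

definition path_drift :: "(real \<Rightarrow> 'a) \<Rightarrow> real \<Rightarrow> 'a" where
  "path_drift x s = (if x s \<in> C then drift (x s) else 0)"

text \<open>Bridge from the notion of solution, stated with the Borel-Lebesgue integral of the
  gradient, to the gauge integrals of the pathwise analysis. The minus sign comes from
  \<open>grad_Phi\<close>.\<close>

lemma path_drift_lborel:
  assumes "set_integrable lborel {s\<in>{0..t}. x s \<in> C} (\<lambda>s. grad (Phi k S) (x s))"
  shows "path_drift x absolutely_integrable_on {0..t}"
    and "(LINT s:{s\<in>{0..t}. x s \<in> C}|lborel. grad (Phi k S) (x s)) = - integral {0..t} (path_drift x)"
proof -
  let ?\<psi> = "\<lambda>s. indicator {0..t} s *\<^sub>R path_drift x s"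
  have eq: "indicator {s\<in>{0..t}. x s \<in> C} s *\<^sub>R grad (Phi k S) (x s) = - ?\<psi> s" for s
    by (auto simp: indicator_def path_drift_def grad_Phi)
  have i: "integrable lborel ?\<psi>" using assms unfolding set_integrable_def eq by simp
  then have m: "?\<psi> \<in> borel_measurable lborel" by (rule borel_measurable_integrable)
  show ai: "path_drift x absolutely_integrable_on {0..t}"
    unfolding set_integrable_def using i integrable_completion[OF m] by simp
  have "(LINT s:{s\<in>{0..t}. x s \<in> C}|lborel. grad (Phi k S) (x s)) = - integral\<^sup>L lborel ?\<psi>"
    unfolding set_lebesgue_integral_def eq by simp
  also have "integral\<^sup>L lborel ?\<psi> = integral\<^sup>L lebesgue ?\<psi>" by (rule integral_completion[OF m, symmetric])
  also have "\<dots> = integral {0..t} (path_drift x)"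
    using set_lebesgue_integral_eq_integral(2)[OF ai] by (simp add: set_lebesgue_integral_def)
  finally show "(LINT s:{s\<in>{0..t}. x s \<in> C}|lborel. grad (Phi k S) (x s)) = - integral {0..t} (path_drift x)" .
qed

lemma euler_measurable:
  assumes h: "0 < h" and w: "\<And>i. i \<le> j \<Longrightarrow> (\<lambda>\<omega>. w \<omega> (real i * h)) \<in> borel_measurable N"
  shows "(\<lambda>\<omega>. euler h (w \<omega>) j) \<in> borel_measurable N"
  using w
proof (induction j)
  case 0
  from 0[of 0] show ?case by simp
next
  case (Suc j)
  have [measurable]: "(\<lambda>\<omega>. euler h (w \<omega>) j) \<in> borel_measurable N" using Suc by simp
  have [measurable]: "(\<lambda>\<omega>. w \<omega> (real (Suc j) * h)) \<in> borel_measurable N" "(\<lambda>\<omega>. w \<omega> (real j * h)) \<in> borel_measurable N"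
    by (intro Suc.prems; simp)+
  have [measurable]: "resolvent h \<in> borel_measurable borel"
    by (rule borel_measurable_continuous_onI[OF continuous_on_resolvent[OF h]])
  show ?case unfolding euler.simps by measurable
qed

end

context repelled_path
begin

lemma flow_drift_absolutely_integrable:
  assumes T: "0 \<le> T"
  shows "path_drift flow absolutely_integrable_on {0..T}"
proof -
  obtain M where M: "0 < M" "\<And>x. x \<in> C \<Longrightarrow> norm (drift x) \<le> M * weight x"
    using norm_drift_le_weight by blast
  let ?g = "\<lambda>s. M * (\<Sum>\<beta>\<in>S. if flow s \<in> C then 1 / (\<beta> \<bullet> flow s) else 0)"
  show ?thesis
  proof (rule measurable_bounded_by_integrable_imp_absolutely_integrable)
    have "flow \<in> borel_measurable (lebesgue_on {0..T})"
      by (intro continuous_imp_measurable_on_sets_lebesgue continuous_on_subset[OF continuous_on_flow]) auto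
    then show "path_drift flow \<in> borel_measurable (lebesgue_on {0..T})"
      unfolding path_drift_def by measurable
    show "?g integrable_on {0..T}"
      by (intro integrable_on_mult_right integrable_sum fin inverse_integrable T)
    fix s
    have "(\<Sum>\<beta>\<in>S. if flow s \<in> C then 1 / (\<beta> \<bullet> flow s) else 0) = weight (flow s)" if "flow s \<in> C"
      using that by (simp add: weight_def)
    then show "norm (path_drift flow s) \<le> ?g s"
      unfolding path_drift_def using M(2)[of "flow s"] by auto
  qed auto
qed

text \<open>Truncate, pass to the limit in the Lipschitz part, and remove the truncation again.
  Tightness is required only for infinitely many \<open>n\<close>, since convergence along all
  meshes is known and a single sufficiently fine mesh is used for each \<open>e\<close>. Natural
  horizons keep the condition countable.\<close>

lemma flow_equation:
  assumes tight: "\<And>(T :: nat) e. 0 < e \<Longrightarrow>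
      \<exists>\<delta>>0. \<exists>\<^sub>F n in sequentially. integral {0..real T} (\<lambda>s. tail \<delta> (eulerc (mesh n) w s)) \<le> e"
    and t: "0 \<le> t"
  shows "flow t = w t + integral {0..t} (path_drift flow)"
proof -
  obtain T :: nat where T: "t \<le> real T" using real_arch_simple by blast
  have T0: "0 \<le> real T" by simp
  obtain M where M: "0 < M" "\<And>x \<delta>. x \<in> C \<Longrightarrow> 0 < \<delta> \<Longrightarrow>
      norm (drift x - cut_drift \<delta> x) \<le> M * (\<Sum>\<alpha>\<in>S. 1 / (\<alpha> \<bullet> x) - 1 / max \<delta> (\<alpha> \<bullet> x))"
    using cut_drift_error by blast
  let ?g = "\<lambda>\<beta> s. if flow s \<in> C then 1 / (\<beta> \<bullet> flow s) else 0"
  let ?h = "\<lambda>\<delta> \<beta> s. 1 / max \<delta> (\<beta> \<bullet> flow s)"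
  \<comment> \<open>Truncation error along the limit path, summed over the roots; it tends to zero
    by the convergence in \<open>inverse_integrable\<close>.\<close>
  define R where "R m = (\<Sum>\<beta>\<in>S. integral {0..real T} (?g \<beta>) - integral {0..real T} (?h (1 / real (Suc m)) \<beta>))" for m
  have "R \<longlonglongrightarrow> (\<Sum>\<beta>\<in>S. integral {0..real T} (?g \<beta>) - integral {0..real T} (?g \<beta>))"
    unfolding R_def by (intro tendsto_sum tendsto_diff tendsto_const inverse_integrable(2)) auto
  then have R: "R \<longlonglongrightarrow> 0" by simp
  have main: "norm (flow t - (w t + integral {0..t} (path_drift flow))) \<le> (2 * M + 2) * e" if e: "0 < e" for e
  proof -
    obtain \<delta>0 where d0: "0 < \<delta>0"
      "\<exists>\<^sub>F n in sequentially. integral {0..real T} (\<lambda>s. tail \<delta>0 (eulerc (mesh n) w s)) \<le> e"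
      using tight[OF e] by blast
    have "\<forall>\<^sub>F m in sequentially. R m < e" using R e by (intro order_tendstoD)
    moreover have "\<forall>\<^sub>F m in sequentially. 1 / real (Suc m) < \<delta>0"
      using d0(1) LIMSEQ_Suc[OF lim_1_over_n[where 'a=real]] by (intro order_tendstoD)
    ultimately have "\<forall>\<^sub>F m in sequentially. R m < e \<and> 1 / real (Suc m) < \<delta>0" by (rule eventually_conj)
    then obtain m where m: "R m < e" "1 / real (Suc m) < \<delta>0"
      unfolding eventually_sequentially by blast
    \<comment> \<open>One level serves both sides: it makes \<open>R\<close> small for the limit
      path and lies below the tail level \<open>\<delta>0\<close> of the scheme.\<close>
    define \<delta> where "\<delta> = 1 / real (Suc m)"
    have d: "0 < \<delta>" "\<delta> \<le> \<delta>0" using m by (auto simp: \<delta>_def)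
    obtain L where L: "0 < L" "\<And>x y. norm (cut_drift \<delta> x - cut_drift \<delta> y) \<le> L * norm (x - y)"
      using cut_drift_Lipschitz[OF d(1)] by blast
    obtain N1 where N1: "\<And>n s. n \<ge> N1 \<Longrightarrow> s \<in> {0..real T} \<Longrightarrow>
        norm (integral {0..s} (\<lambda>s. cut_drift \<delta> (eulerc (mesh n) w s)) - integral {0..s} (\<lambda>s. cut_drift \<delta> (flow s))) \<le> e"
      using integral_eulerc_flow(2)[OF T0 e L] by blast
    obtain N2 where N2: "\<And>n s. n \<ge> N2 \<Longrightarrow> s \<in> {0..real T} \<Longrightarrow> norm (w s + push (mesh n) w s - flow s) \<le> e"
      using flow_uniform[OF T0 e] by blast
    obtain n where n: "n \<ge> max N1 N2" "integral {0..real T} (\<lambda>s. tail \<delta>0 (eulerc (mesh n) w s)) \<le> e"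
      using d0(2) unfolding frequently_sequentially by blast
    let ?x = "eulerc (mesh n) w"
    note ei = eulerc_integrable[OF mesh_pos]
    have A: "norm (push (mesh n) w t - integral {0..t} (\<lambda>s. cut_drift \<delta> (?x s))) \<le> M * e"
    proof -
      have "norm (push (mesh n) w t - integral {0..t} (\<lambda>s. cut_drift \<delta> (?x s))) = norm (integral {0..t} (\<lambda>s. drift (?x s) - cut_drift \<delta> (?x s)))"
        unfolding push_def by (rule arg_cong[where f=norm, OF integral_diff[symmetric]]) (rule ei)+
      also have "\<dots> \<le> integral {0..t} (\<lambda>s. M * tail \<delta>0 (?x s))"
      proof (rule integral_norm_bound_integral)
        show "(\<lambda>s. drift (?x s) - cut_drift \<delta> (?x s)) integrable_on {0..t}"
          by (rule ei[of "\<lambda>x. drift x - cut_drift \<delta> x"])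
        show "(\<lambda>s. M * tail \<delta>0 (?x s)) integrable_on {0..t}" by (rule ei)
        fix s
        have x: "?x s \<in> C" by (rule eulerc_mesh_in_C)
        have "(\<Sum>\<alpha>\<in>S. 1 / (\<alpha> \<bullet> ?x s) - 1 / max \<delta> (\<alpha> \<bullet> ?x s)) \<le> tail \<delta>0 (?x s)"
          using inverse_diff_le_tail[OF x d(1)] tail_mono[OF x d(2)] by (rule order_trans)
        then show "norm (drift (?x s) - cut_drift \<delta> (?x s)) \<le> M * tail \<delta>0 (?x s)"
          using M(2)[OF x d(1)] M(1) by (meson less_imp_le mult_left_mono order_trans)
      qed
      also have "\<dots> \<le> integral {0..real T} (\<lambda>s. M * tail \<delta>0 (?x s))"
        using T M(1) tail_nonneg[OF eulerc_mesh_in_C]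
        by (intro integral_subset_le ei) auto
      also have "\<dots> = M * integral {0..real T} (\<lambda>s. tail \<delta>0 (?x s))" by simp
      also have "\<dots> \<le> M * e" using n(2) M(1) by simp
      finally show ?thesis .
    qed
    have B: "norm (integral {0..t} (\<lambda>s. cut_drift \<delta> (flow s)) - integral {0..t} (path_drift flow)) \<le> M * e"
    proof -
      let ?c = "\<lambda>s. if flow s \<in> C then cut_drift \<delta> (flow s) else 0"
      let ?hc = "\<lambda>\<beta> s. if flow s \<in> C then ?h \<delta> \<beta> s else 0"
      have neg: "negligible {s\<in>{0..t}. flow s \<notin> C}" by (rule negligible_boundary_time[OF t])
      have negT: "negligible {s\<in>{0..real T}. flow s \<notin> C}" by (rule negligible_boundary_time[OF T0])
      have ci: "?c integrable_on {0..t}"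
        by (rule integrable_spike[OF integral_eulerc_flow(1)[OF t e L] neg]) auto
      have ceq: "integral {0..t} (\<lambda>s. cut_drift \<delta> (flow s)) = integral {0..t} ?c"
        by (rule integral_spike[OF neg]) auto
      have hi: "?hc \<beta> integrable_on {0..real T}" for \<beta>
        by (rule integrable_spike[OF inverse_max_integrable[OF T0 d(1), of \<beta>] negT]) auto
      have heq: "integral {0..real T} (?hc \<beta>) = integral {0..real T} (?h \<delta> \<beta>)" for \<beta>
        by (rule integral_spike[OF negT]) auto
      have gi: "?g \<beta> integrable_on {0..real T}" if "\<beta> \<in> S" for \<beta>
        by (rule inverse_integrable(1)[OF T0 that])
      have fi: "path_drift flow integrable_on {0..t}"
        using flow_drift_absolutely_integrable[OF t] by (simp add: absolutely_integrable_on_def)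
      have bi: "(\<lambda>s. M * (\<Sum>\<beta>\<in>S. ?g \<beta> s - ?hc \<beta> s)) integrable_on {0..real T}"
        by (intro integrable_on_mult_right integrable_sum fin integrable_diff gi hi)
      have nn: "0 \<le> M * (\<Sum>\<beta>\<in>S. ?g \<beta> s - ?hc \<beta> s)" for s
        using M(1) d(1) C_D by (intro mult_nonneg_nonneg sum_nonneg) (auto intro!: frac_le)
      have "norm (integral {0..t} (\<lambda>s. cut_drift \<delta> (flow s)) - integral {0..t} (path_drift flow)) = norm (integral {0..t} (\<lambda>s. ?c s - path_drift flow s))"
        unfolding ceq by (rule arg_cong[where f=norm, OF integral_diff[symmetric, OF ci fi]])
      also have "\<dots> \<le> integral {0..t} (\<lambda>s. M * (\<Sum>\<beta>\<in>S. ?g \<beta> s - ?hc \<beta> s))"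
      proof (rule integral_norm_bound_integral)
        show "(\<lambda>s. ?c s - path_drift flow s) integrable_on {0..t}" by (rule integrable_diff[OF ci fi])
        show "(\<lambda>s. M * (\<Sum>\<beta>\<in>S. ?g \<beta> s - ?hc \<beta> s)) integrable_on {0..t}"
          by (rule integrable_subinterval_real[OF bi]) (use T in auto)
        fix s
        show "norm (?c s - path_drift flow s) \<le> M * (\<Sum>\<beta>\<in>S. ?g \<beta> s - ?hc \<beta> s)"
        proof (cases "flow s \<in> C")
          case True
          with M(2)[OF True d(1)] show ?thesis by (simp add: path_drift_def norm_minus_commute)
        next
          case False
          then show ?thesis by (simp add: path_drift_def)
        qed
      qed
      also have "\<dots> \<le> integral {0..real T} (\<lambda>s. M * (\<Sum>\<beta>\<in>S. ?g \<beta> s - ?hc \<beta> s))"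
      proof (rule integral_subset_le[OF _ _ bi])
        show "{0..t} \<subseteq> {0..real T}" using T by simp
        then show "(\<lambda>s. M * (\<Sum>\<beta>\<in>S. ?g \<beta> s - ?hc \<beta> s)) integrable_on {0..t}"
          by (rule integrable_subinterval_real[OF bi])
        show "\<forall>s\<in>{0..real T}. 0 \<le> M * (\<Sum>\<beta>\<in>S. ?g \<beta> s - ?hc \<beta> s)" using nn by blast
      qed
      also have "\<dots> = M * (\<Sum>\<beta>\<in>S. integral {0..real T} (\<lambda>s. ?g \<beta> s - ?hc \<beta> s))"
      proof -
        have "(\<lambda>s. ?g \<beta> s - ?hc \<beta> s) integrable_on {0..real T}" if "\<beta> \<in> S" for \<beta>
          by (rule integrable_diff[OF gi[OF that] hi])
        from integral_sum[OF fin this] show ?thesis by simp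
      qed
      also have "\<dots> = M * R m"
        unfolding R_def \<delta>_def[symmetric] heq[symmetric]
        by (intro arg_cong[where f="(*) M"] sum.cong refl integral_diff gi hi)
      also have "\<dots> \<le> M * e" using m(1) M(1) by simp
      finally show ?thesis .
    qed
    let ?I = "integral {0..t} (\<lambda>s. cut_drift \<delta> (?x s))" and ?J = "integral {0..t} (\<lambda>s. cut_drift \<delta> (flow s))"
    have c1: "norm (?I - ?J) \<le> e" using n(1) t T by (intro N1) auto
    have c2: "norm (w t + push (mesh n) w t - flow t) \<le> e" using n(1) t T by (intro N2) auto
    \<comment> \<open>Four errors: truncation of the scheme (\<open>M * e\<close>), Lipschitz
      passage to the limit (\<open>e\<close>), truncation of the limit path (\<open>M * e\<close>),
      and convergence of \<open>w + push\<close> (\<open>e\<close>).\<close>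
    have "flow t - (w t + integral {0..t} (path_drift flow))
      = (push (mesh n) w t - ?I) + (?I - ?J) + (?J - integral {0..t} (path_drift flow)) - (w t + push (mesh n) w t - flow t)"
      by simp
    also have "norm \<dots> \<le> (M * e + e + M * e) + e"
      by (intro order_trans[OF norm_triangle_ineq4] order_trans[OF norm_triangle_ineq] add_mono A B c1 c2)
    finally show ?thesis by (simp add: algebra_simps)
  qed
  have "norm (flow t - (w t + integral {0..t} (path_drift flow))) \<le> 0 + e" if "0 < e" for e
    using main[of "e / (2 * M + 2)"] that M(1) by simp
  then have "norm (flow t - (w t + integral {0..t} (path_drift flow))) \<le> 0" by (rule field_le_epsilon)
  then show ?thesis by simp
qed

end

section \<open>Increments of Brownian motion\<close>

locale filtered_brownian = prob_space M for M :: "'w measure" +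
  fixes F :: "real \<Rightarrow> 'w measure" and B :: "real \<Rightarrow> 'w \<Rightarrow> 'a::euclidean_space"
  assumes filtration: "filtration_on M F" and brownian: "brownian_motion M F B"
begin

lemma subalgebra_F: "0 \<le> t \<Longrightarrow> subalgebra M (F t)"
  using filtration by (simp add: filtration_on_def)

lemma space_F: "0 \<le> t \<Longrightarrow> space (F t) = space M"
  using subalgebra_F by (simp add: subalgebra_def)

lemma measurable_F_mono:
  assumes "0 \<le> s" "s \<le> t" "f \<in> measurable (F s) N"
  shows "f \<in> measurable (F t) N"
proof -
  have "sets (F s) \<subseteq> sets (F t)" "space (F s) = space (F t)"
    using filtration assms(1,2) space_F[of s] space_F[of t] by (auto simp: filtration_on_def)
  with assms(3) show ?thesis unfolding measurable_def by auto
qed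

lemma measurable_F_M: "0 \<le> t \<Longrightarrow> f \<in> measurable (F t) N \<Longrightarrow> f \<in> measurable M N"
  by (rule measurable_from_subalg[OF subalgebra_F])

lemma B_adapted: "0 \<le> t \<Longrightarrow> B t \<in> borel_measurable (F t)"
  using brownian by (simp add: brownian_motion_def)

lemma B_measurable: "0 \<le> t \<Longrightarrow> B t \<in> borel_measurable M"
  by (rule measurable_F_M[OF _ B_adapted])

lemma increment_distributed:
  assumes "0 \<le> s" "s < t"
  shows "distributed M lborel (\<lambda>\<omega>. B t \<omega> - B s \<omega>)
          (\<lambda>x. ennreal (\<Prod>b\<in>Basis. normal_density 0 (sqrt (t - s)) (x \<bullet> b)))"
  using brownian assms unfolding brownian_motion_def by blast

lemma increment_indep:
  assumes "0 \<le> s" "s < t"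
  shows "indep_set (sets (F s)) {(\<lambda>\<omega>. B t \<omega> - B s \<omega>) -` A \<inter> space M | A. A \<in> sets borel}"
  using brownian assms unfolding brownian_motion_def by blast

lemma increment_measurable:
  assumes "0 \<le> s" "s < t"
  shows "(\<lambda>\<omega>. B t \<omega> - B s \<omega>) \<in> borel_measurable M"
  using B_measurable[of s] B_measurable[of t] assms by (intro borel_measurable_diff) auto

text \<open>The Gaussian density is a product over the basis, so the remaining coordinates integrate
  to one.\<close>

lemma increment_component:
  assumes st: "0 \<le> s" "s < t" and b: "b \<in> Basis"
  shows "distributed M lborel (\<lambda>\<omega>. (B t \<omega> - B s \<omega>) \<bullet> b) (normal_density 0 (sqrt (t - s)))"
  unfolding distributed_def
proof (intro conjI)
  let ?N = "normal_density 0 (sqrt (t - s))"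
  let ?X = "\<lambda>\<omega>. (B t \<omega> - B s \<omega>) \<bullet> b"
  have X: "?X \<in> borel_measurable M" using increment_measurable[OF st] by measurable
  then show "?X \<in> measurable M lborel" by simp
  show "(\<lambda>x. ennreal (?N x)) \<in> borel_measurable lborel" by measurable
  show "distr M lborel ?X = density lborel (\<lambda>x. ennreal (?N x))"
  proof (rule measure_eqI)
    fix A assume "A \<in> sets (distr M lborel ?X)"
    then have A[measurable]: "A \<in> sets borel" by simp
    \<comment> \<open>The indicator is placed on the factor of coordinate \<open>b\<close> alone,
      which turns the integrand into a product to which Tonelli applies.\<close>
    let ?f = "\<lambda>b'::'a. \<lambda>y. ennreal (?N y) * (if b' = b then indicator A y else 1)"
    have meas: "(\<lambda>x. indicator A (x \<bullet> b) :: ennreal) \<in> borel_measurable lborel" by measurable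
    have "emeasure (distr M lborel ?X) A = emeasure M (?X -` A \<inter> space M)"
      using X A by (subst emeasure_distr) auto
    also have "\<dots> = (\<integral>\<^sup>+\<omega>. indicator A (?X \<omega>) \<partial>M)"
    proof -
      have S: "?X -` A \<inter> space M \<in> sets M" using X A by (rule measurable_sets)
      have "emeasure M (?X -` A \<inter> space M) = (\<integral>\<^sup>+\<omega>. indicator (?X -` A \<inter> space M) \<omega> \<partial>M)"
        using S by simp
      also have "\<dots> = (\<integral>\<^sup>+\<omega>. indicator A (?X \<omega>) \<partial>M)"
        by (intro nn_integral_cong) (simp add: indicator_def)
      finally show ?thesis .
    qed
    also have "\<dots> = (\<integral>\<^sup>+x. ennreal (\<Prod>b\<in>Basis. ?N (x \<bullet> b)) * indicator A (x \<bullet> b) \<partial>lborel)"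
      using distributed_nn_integral[OF increment_distributed[OF st] meas] by simp
    also have "\<dots> = (\<integral>\<^sup>+x. (\<Prod>b'\<in>Basis. ?f b' (x \<bullet> b')) \<partial>lborel)"
    proof (intro nn_integral_cong)
      fix x :: 'a
      have "(\<Prod>b'\<in>Basis. (if b' = b then indicator A (x \<bullet> b') else 1)) = (indicator A (x \<bullet> b) :: ennreal)"
        using b by (subst prod.delta) auto
      then show "ennreal (\<Prod>b\<in>Basis. ?N (x \<bullet> b)) * indicator A (x \<bullet> b) = (\<Prod>b'\<in>Basis. ?f b' (x \<bullet> b'))"
        by (simp add: prod.distrib prod_ennreal)
    qed
    also have "\<dots> = (\<Prod>b'\<in>Basis. (\<integral>\<^sup>+y. ?f b' y \<partial>lborel))"
      by (rule nn_integral_lborel_prod) auto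
    also have "\<dots> = (\<Prod>b'\<in>Basis. if b' = b then (\<integral>\<^sup>+y. ennreal (?N y) * indicator A y \<partial>lborel) else 1)"
    proof (intro prod.cong refl)
      fix b' :: 'a
      have "(\<integral>\<^sup>+y. ennreal (?N y) \<partial>lborel) = 1"
        using st prob_space.emeasure_space_1[OF prob_space_normal_density[of "sqrt (t - s)" 0]]
        by (simp add: emeasure_density)
      then show "(\<integral>\<^sup>+y. ?f b' y \<partial>lborel) = (if b' = b then (\<integral>\<^sup>+y. ennreal (?N y) * indicator A y \<partial>lborel) else 1)"
        by simp
    qed
    also have "\<dots> = (\<integral>\<^sup>+y. ennreal (?N y) * indicator A y \<partial>lborel)"
      using b by (subst prod.delta) auto
    also have "\<dots> = emeasure (density lborel (\<lambda>x. ennreal (?N x))) A"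
      by (subst emeasure_density) auto
    finally show "emeasure (distr M lborel ?X) A = emeasure (density lborel (\<lambda>x. ennreal (?N x))) A" .
  qed simp
qed

lemma component_moment:
  assumes st: "0 \<le> s" "s < t" and b: "b \<in> Basis"
  shows "integrable M (\<lambda>\<omega>. ((B t \<omega> - B s \<omega>) \<bullet> b) ^ (2 * p))"
    and "(\<integral>\<omega>. ((B t \<omega> - B s \<omega>) \<bullet> b) ^ (2 * p) \<partial>M) = fact (2 * p) / ((2 / (t - s)) ^ p * fact p)"
proof -
  have s: "0 < sqrt (t - s)" "(sqrt (t - s))\<^sup>2 = t - s" using st by auto
  note m = normal_moment_even[OF s(1), of 0 p, unfolded s(2)]
  have "integrable lborel (\<lambda>x. normal_density 0 (sqrt (t - s)) x * x ^ (2 * p))"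
    using integrable.intros[OF m] by simp
  then show "integrable M (\<lambda>\<omega>. ((B t \<omega> - B s \<omega>) \<bullet> b) ^ (2 * p))"
    by (subst (asm) distributed_integrable[OF increment_component[OF st b]]) auto
  have "(\<integral>x. normal_density 0 (sqrt (t - s)) x * x ^ (2 * p) \<partial>lborel) = fact (2 * p) / ((2 / (t - s)) ^ p * fact p)"
    using has_bochner_integral_integral_eq[OF m] by simp
  then show "(\<integral>\<omega>. ((B t \<omega> - B s \<omega>) \<bullet> b) ^ (2 * p) \<partial>M) = fact (2 * p) / ((2 / (t - s)) ^ p * fact p)"
    by (subst (asm) distributed_integral[OF increment_component[OF st b]]) auto
qed

lemma component_mean:
  assumes st: "0 \<le> s" "s < t" and b: "b \<in> Basis"
  shows "integrable M (\<lambda>\<omega>. (B t \<omega> - B s \<omega>) \<bullet> b)"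
    and "(\<integral>\<omega>. (B t \<omega> - B s \<omega>) \<bullet> b \<partial>M) = 0"
proof -
  have s: "0 < sqrt (t - s)" using st by auto
  note m = normal_moment_odd[OF s, of 0 0]
  have "integrable lborel (\<lambda>x. normal_density 0 (sqrt (t - s)) x * x)"
    using integrable.intros[OF m] by simp
  then show "integrable M (\<lambda>\<omega>. (B t \<omega> - B s \<omega>) \<bullet> b)"
    by (subst (asm) distributed_integrable[OF increment_component[OF st b]]) auto
  show "(\<integral>\<omega>. (B t \<omega> - B s \<omega>) \<bullet> b \<partial>M) = 0"
    by (rule normal_distributed_expectation[OF s increment_component[OF st b]])
qed

lemma increment_mean:
  assumes st: "0 \<le> s" "s < t"
  shows "integrable M (\<lambda>\<omega>. (B t \<omega> - B s \<omega>) \<bullet> e)"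
    and "(\<integral>\<omega>. (B t \<omega> - B s \<omega>) \<bullet> e \<partial>M) = 0"
proof -
  have eq: "(B t \<omega> - B s \<omega>) \<bullet> e = (\<Sum>b\<in>Basis. ((B t \<omega> - B s \<omega>) \<bullet> b) * (e \<bullet> b))" for \<omega>
    by (rule euclidean_inner)
  show "integrable M (\<lambda>\<omega>. (B t \<omega> - B s \<omega>) \<bullet> e)"
    unfolding eq using component_mean(1)[OF st] by (intro Bochner_Integration.integrable_sum integrable_mult_left) auto
  show "(\<integral>\<omega>. (B t \<omega> - B s \<omega>) \<bullet> e \<partial>M) = 0"
    unfolding eq using component_mean[OF st] by (subst Bochner_Integration.integral_sum) auto
qed

lemma increment_second_moment:
  fixes s t :: real
  assumes st: "0 \<le> s" "s < t"
  shows "integrable M (\<lambda>\<omega>. (norm (B t \<omega> - B s \<omega>))\<^sup>2)"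
    and "(\<integral>\<omega>. (norm (B t \<omega> - B s \<omega>))\<^sup>2 \<partial>M) = (t - s) * DIM('a)"
proof -
  have eq: "(norm (B t \<omega> - B s \<omega>))\<^sup>2 = (\<Sum>b\<in>Basis. ((B t \<omega> - B s \<omega>) \<bullet> b) ^ (2 * 1))" for \<omega>
    unfolding power2_norm_eq_inner by (subst euclidean_inner) (simp add: power2_eq_square)
  show "integrable M (\<lambda>\<omega>. (norm (B t \<omega> - B s \<omega>))\<^sup>2)"
    unfolding eq by (intro Bochner_Integration.integrable_sum component_moment(1)[OF st])
  have "(\<integral>\<omega>. (norm (B t \<omega> - B s \<omega>))\<^sup>2 \<partial>M) = (\<Sum>b\<in>Basis. \<integral>\<omega>. ((B t \<omega> - B s \<omega>) \<bullet> b) ^ (2 * 1) \<partial>M)"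
    unfolding eq by (rule Bochner_Integration.integral_sum) (rule component_moment(1)[OF st])
  also have "\<dots> = (\<Sum>b\<in>(Basis::'a set). (t - s))"
  proof (rule sum.cong[OF refl])
    fix b :: 'a assume "b \<in> Basis"
    from component_moment(2)[OF st this, of 1] st
    show "(\<integral>\<omega>. ((B t \<omega> - B s \<omega>) \<bullet> b) ^ (2 * 1) \<partial>M) = t - s"
      by (simp add: fact_numeral field_simps)
  qed
  finally have "(\<integral>\<omega>. (norm (B t \<omega> - B s \<omega>))\<^sup>2 \<partial>M) = (\<Sum>b\<in>(Basis::'a set). (t - s))" .
  then show "(\<integral>\<omega>. (norm (B t \<omega> - B s \<omega>))\<^sup>2 \<partial>M) = (t - s) * DIM('a)" by simp
qed

text \<open>Cauchy-Schwarz over the basis bounds the fourth power of the norm by the dimension times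
  the sum of the fourth powers of the coordinates. Each of these has mean
  \<open>3 * (t - s)\<^sup>2\<close>, and the sum supplies the second factor of the
  dimension.\<close>

lemma increment_fourth_moment:
  fixes s t :: real
  assumes st: "0 \<le> s" "s < t"
  shows "integrable M (\<lambda>\<omega>. (norm (B t \<omega> - B s \<omega>)) ^ 4)"
    and "(\<integral>\<omega>. (norm (B t \<omega> - B s \<omega>)) ^ 4 \<partial>M) \<le> 3 * (DIM('a))\<^sup>2 * (t - s)\<^sup>2"
proof -
  let ?g = "\<lambda>\<omega>. real DIM('a) * (\<Sum>b\<in>Basis. ((B t \<omega> - B s \<omega>) \<bullet> b) ^ (2 * 2))"
  have le: "(norm (B t \<omega> - B s \<omega>)) ^ 4 \<le> ?g \<omega>" for \<omega>
  proof -
    let ?x = "B t \<omega> - B s \<omega>"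
    have "(norm ?x) ^ 4 = ((norm ?x)\<^sup>2)\<^sup>2" by simp
    also have "(norm ?x)\<^sup>2 = (\<Sum>b\<in>Basis. (?x \<bullet> b)\<^sup>2 * 1)"
      unfolding power2_norm_eq_inner by (subst euclidean_inner) (simp add: power2_eq_square)
    also have "\<dots>\<^sup>2 \<le> (\<Sum>b\<in>Basis. ((?x \<bullet> b)\<^sup>2)\<^sup>2) * (\<Sum>b\<in>(Basis::'a set). 1\<^sup>2)"
      by (rule Cauchy_Schwarz_ineq_sum)
    finally show ?thesis by (simp add: mult.commute)
  qed
  have gi: "integrable M ?g"
    by (intro integrable_mult_right Bochner_Integration.integrable_sum component_moment(1)[OF st])
  have [measurable]: "(\<lambda>\<omega>. B t \<omega> - B s \<omega>) \<in> borel_measurable M" by (rule increment_measurable[OF st])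
  show i: "integrable M (\<lambda>\<omega>. (norm (B t \<omega> - B s \<omega>)) ^ 4)"
  proof (rule Bochner_Integration.integrable_bound[OF gi])
    show "AE \<omega> in M. norm ((norm (B t \<omega> - B s \<omega>)) ^ 4) \<le> norm (?g \<omega>)"
    proof (rule AE_I2)
      fix \<omega>
      have "norm ((norm (B t \<omega> - B s \<omega>)) ^ 4) = (norm (B t \<omega> - B s \<omega>)) ^ 4" by simp
      also have "\<dots> \<le> norm (?g \<omega>)" unfolding real_norm_def by (rule order_trans[OF le abs_ge_self])
      finally show "norm ((norm (B t \<omega> - B s \<omega>)) ^ 4) \<le> norm (?g \<omega>)" .
    qed
  qed measurable
  have "(\<integral>\<omega>. (norm (B t \<omega> - B s \<omega>)) ^ 4 \<partial>M) \<le> (\<integral>\<omega>. ?g \<omega> \<partial>M)"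
    by (rule integral_mono[OF i gi le])
  also have "\<dots> = real DIM('a) * (\<Sum>b\<in>(Basis::'a set). fact (2 * 2) / ((2 / (t - s)) ^ 2 * fact 2))"
  proof -
    have "(\<integral>\<omega>. (\<Sum>b\<in>Basis. ((B t \<omega> - B s \<omega>) \<bullet> b) ^ (2 * 2)) \<partial>M)
        = (\<Sum>b\<in>Basis. \<integral>\<omega>. ((B t \<omega> - B s \<omega>) \<bullet> b) ^ (2 * 2) \<partial>M)"
      by (rule Bochner_Integration.integral_sum) (rule component_moment(1)[OF st])
    also have "\<dots> = (\<Sum>b\<in>(Basis::'a set). fact (2 * 2) / ((2 / (t - s)) ^ 2 * fact 2))"
      by (intro sum.cong refl component_moment(2)[OF st])
    finally show ?thesis by simp
  qed
  also have "\<dots> = 3 * (DIM('a))\<^sup>2 * (t - s)\<^sup>2"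
    by (simp add: fact_numeral power2_eq_square divide_simps)
  finally show "(\<integral>\<omega>. (norm (B t \<omega> - B s \<omega>)) ^ 4 \<partial>M) \<le> 3 * (DIM('a))\<^sup>2 * (t - s)\<^sup>2" .
qed

text \<open>Independence descends to smaller sigma-algebras: that of \<open>U\<close> lies in
  \<open>F s\<close>, that of \<open>h\<close> of the increment in the one generated by the
  increment.\<close>

lemma increment_indep_var:
  fixes U :: "'w \<Rightarrow> real" and h :: "'a \<Rightarrow> real"
  assumes st: "0 \<le> s" "s < t" and U: "U \<in> borel_measurable (F s)" and h: "h \<in> borel_measurable borel"
  shows "indep_var borel U borel (\<lambda>\<omega>. h (B t \<omega> - B s \<omega>))"
  unfolding indep_var_eq
proof (intro conjI)
  let ?D = "\<lambda>\<omega>. B t \<omega> - B s \<omega>"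
  let ?\<D> = "{?D -` A \<inter> space M | A. A \<in> sets borel}"
  have D: "?D \<in> borel_measurable M" by (rule increment_measurable[OF st])
  show "random_variable borel U" by (rule measurable_F_M[OF st(1) U])
  show "random_variable borel (\<lambda>\<omega>. h (?D \<omega>))" using D h by measurable
  have D_sigma: "?\<D> = sets (vimage_algebra (space M) ?D borel)"
    by (subst sets_vimage_algebra2) auto
  have 1: "sigma_sets (space M) {U -` A \<inter> space M | A. A \<in> sets borel} \<subseteq> sets (F s)"
    using measurable_sets[OF U] space_F[OF st(1)]
    by (subst space_F[OF st(1), symmetric], intro sets.sigma_sets_subset) auto
  have "{(\<lambda>\<omega>. h (?D \<omega>)) -` A \<inter> space M | A. A \<in> sets borel} \<subseteq> ?\<D>"
  proof safe
    fix A :: "real set" assume "A \<in> sets borel"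
    then have "h -` A \<in> sets borel" using measurable_sets[OF h] by auto
    then show "\<exists>A'. (\<lambda>\<omega>. h (?D \<omega>)) -` A \<inter> space M = ?D -` A' \<inter> space M \<and> A' \<in> sets borel"
      by (intro exI[of _ "h -` A"]) auto
  qed
  then have 2: "sigma_sets (space M) {(\<lambda>\<omega>. h (?D \<omega>)) -` A \<inter> space M | A. A \<in> sets borel} \<subseteq> ?\<D>"
    unfolding D_sigma using sets.sigma_sets_subset[of _ "vimage_algebra (space M) ?D borel"] by simp
  show "indep_set (sigma_sets (space M) {U -` A \<inter> space M | A. A \<in> sets borel})
      (sigma_sets (space M) {(\<lambda>\<omega>. h (?D \<omega>)) -` A \<inter> space M | A. A \<in> sets borel})"
    using increment_indep[OF st] unfolding indep_set_def
    by (rule indep_sets_mono_sets) (use 1 2 in \<open>auto split: bool.splits\<close>)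
qed

lemma indep_expectation:
  fixes U :: "'w \<Rightarrow> real" and h :: "'a \<Rightarrow> real"
  assumes st: "0 \<le> s" "s < t" and U: "U \<in> borel_measurable (F s)" "integrable M U"
    and h: "h \<in> borel_measurable borel" "integrable M (\<lambda>\<omega>. h (B t \<omega> - B s \<omega>))"
  shows "integrable M (\<lambda>\<omega>. U \<omega> * h (B t \<omega> - B s \<omega>))"
    and "(\<integral>\<omega>. U \<omega> * h (B t \<omega> - B s \<omega>) \<partial>M) = (\<integral>\<omega>. U \<omega> \<partial>M) * (\<integral>\<omega>. h (B t \<omega> - B s \<omega>) \<partial>M)"
  using increment_indep_var[OF st U(1) h(1)] U(2) h(2)
  by (rule indep_var_integrable, rule indep_var_lebesgue_integral)

end

section \<open>The scheme driven by Brownian motion\<close>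

lemma le_one_plus_square: "x \<le> 1 + x\<^sup>2" for x :: real
  using zero_le_power2[of "x - 1 / 2"] by (simp add: power2_eq_square algebra_simps)

text \<open>The bounded initial value \<open>Z\<close> gives the scheme finite moments. It lies in
  the chamber for every \<omega>, so that the scheme is defined and stays inside without exceptional
  sets.\<close>

locale noisy_walls = wall_repulsion S k + filtered_brownian M F B
  for S :: "'a::euclidean_space set" and k :: "'a \<Rightarrow> real" and M :: "'w measure" and F and B :: "real \<Rightarrow> 'w \<Rightarrow> 'a" +
  fixes Z :: "'w \<Rightarrow> 'a" and r :: real
  assumes Z_adapted: "Z \<in> borel_measurable (F 0)" and Z_in_C: "\<And>\<omega>. Z \<omega> \<in> weyl_chamber S"
    and Z_bounded: "\<And>\<omega>. norm (Z \<omega>) \<le> r"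
begin

text \<open>Subtracting \<open>B 0\<close>, which vanishes only almost surely, makes the path start
  at \<open>Z\<close> for every \<omega>.\<close>

definition path :: "'w \<Rightarrow> real \<Rightarrow> 'a" where
  "path \<omega> t = Z \<omega> + (B t \<omega> - B 0 \<omega>)"

definition X :: "real \<Rightarrow> nat \<Rightarrow> 'w \<Rightarrow> 'a" where
  "X h j \<omega> = euler h (path \<omega>) j"

definition incr :: "real \<Rightarrow> nat \<Rightarrow> 'w \<Rightarrow> 'a" where
  "incr h j \<omega> = B (real (Suc j) * h) \<omega> - B (real j * h) \<omega>"

lemma path_0: "path \<omega> 0 = Z \<omega>" by (simp add: path_def)

lemma X_0: "X h 0 \<omega> = Z \<omega>" by (simp add: X_def path_0)

lemma X_Suc: "X h (Suc j) \<omega> = resolvent h (X h j \<omega> + incr h j \<omega>)"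
  by (simp add: X_def path_def incr_def)

lemma X_in_C: "0 < h \<Longrightarrow> X h j \<omega> \<in> C"
  unfolding X_def by (rule euler_in_C) (simp_all add: path_0 Z_in_C)

lemma X_step: "0 < h \<Longrightarrow> X h (Suc j) \<omega> - h *\<^sub>R drift (X h (Suc j) \<omega>) = X h j \<omega> + incr h j \<omega>"
  unfolding X_Suc by (rule resolvent_eq)

lemma grid: "0 < h \<Longrightarrow> 0 \<le> real j * h" "0 < h \<Longrightarrow> real j * h < real (Suc j) * h"
  by simp_all

lemma X_adapted:
  assumes h: "0 < h"
  shows "X h j \<in> borel_measurable (F (real j * h))"
proof -
  have "(\<lambda>\<omega>. path \<omega> (real i * h)) \<in> borel_measurable (F (real j * h))" if "i \<le> j" for i
  proof -
    have i: "0 \<le> real i * h" "real i * h \<le> real j * h" "0 \<le> real j * h" using that h by auto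
    note [measurable] = measurable_F_mono[OF i(1,2) B_adapted[OF i(1)]]
      measurable_F_mono[OF order_refl i(3) B_adapted[OF order_refl]] measurable_F_mono[OF order_refl i(3) Z_adapted]
    show ?thesis unfolding path_def by measurable
  qed
  then have "(\<lambda>\<omega>. euler h (path \<omega>) j) \<in> borel_measurable (F (real j * h))"
    by (rule euler_measurable[OF h])
  then show ?thesis unfolding X_def[abs_def] .
qed

lemma X_measurable: "0 < h \<Longrightarrow> X h j \<in> borel_measurable M"
  by (rule measurable_F_M[OF _ X_adapted]) simp_all

lemma X_indep:
  fixes f g :: "'a \<Rightarrow> real"
  assumes h: "0 < h" and f: "f \<in> borel_measurable borel" "integrable M (\<lambda>\<omega>. f (X h j \<omega>))"
    and g: "g \<in> borel_measurable borel" "integrable M (\<lambda>\<omega>. g (incr h j \<omega>))"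
  shows "integrable M (\<lambda>\<omega>. f (X h j \<omega>) * g (incr h j \<omega>))"
    and "(\<integral>\<omega>. f (X h j \<omega>) * g (incr h j \<omega>) \<partial>M) = (\<integral>\<omega>. f (X h j \<omega>) \<partial>M) * (\<integral>\<omega>. g (incr h j \<omega>) \<partial>M)"
proof -
  have "(\<lambda>\<omega>. f (X h j \<omega>)) \<in> borel_measurable (F (real j * h))"
    using X_adapted[OF h] f(1) by (rule measurable_compose)
  from indep_expectation[OF grid[OF h] this f(2) g(1)] g(2)
  show "integrable M (\<lambda>\<omega>. f (X h j \<omega>) * g (incr h j \<omega>))"
    and "(\<integral>\<omega>. f (X h j \<omega>) * g (incr h j \<omega>) \<partial>M) = (\<integral>\<omega>. f (X h j \<omega>) \<partial>M) * (\<integral>\<omega>. g (incr h j \<omega>) \<partial>M)"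
    unfolding incr_def by blast+
qed

lemma incr_mean:
  assumes h: "0 < h"
  shows "integrable M (\<lambda>\<omega>. incr h j \<omega> \<bullet> e)" "(\<integral>\<omega>. incr h j \<omega> \<bullet> e \<partial>M) = 0"
  unfolding incr_def using increment_mean[OF grid[OF h]] by blast+

lemma incr_second:
  fixes h :: real
  assumes h: "0 < h"
  shows "integrable M (\<lambda>\<omega>. (norm (incr h j \<omega>))\<^sup>2)" "(\<integral>\<omega>. (norm (incr h j \<omega>))\<^sup>2 \<partial>M) = h * DIM('a)"
proof -
  have "real (Suc j) * h - real j * h = h" by (simp add: algebra_simps)
  then show "integrable M (\<lambda>\<omega>. (norm (incr h j \<omega>))\<^sup>2)" "(\<integral>\<omega>. (norm (incr h j \<omega>))\<^sup>2 \<partial>M) = h * DIM('a)"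
    unfolding incr_def using increment_second_moment[OF grid(1)[OF h, of j] grid(2)[OF h, of j]] by (simp_all only:)
qed

lemma incr_fourth:
  fixes h :: real
  assumes h: "0 < h"
  shows "integrable M (\<lambda>\<omega>. (norm (incr h j \<omega>)) ^ 4)" "(\<integral>\<omega>. (norm (incr h j \<omega>)) ^ 4 \<partial>M) \<le> 3 * (DIM('a))\<^sup>2 * h\<^sup>2"
proof -
  have "real (Suc j) * h - real j * h = h" by (simp add: algebra_simps)
  then show "integrable M (\<lambda>\<omega>. (norm (incr h j \<omega>)) ^ 4)" "(\<integral>\<omega>. (norm (incr h j \<omega>)) ^ 4 \<partial>M) \<le> 3 * (DIM('a))\<^sup>2 * h\<^sup>2"
    unfolding incr_def using increment_fourth_moment[OF grid(1)[OF h, of j] grid(2)[OF h, of j]] by (simp_all only:)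
qed

lemma incr_measurable: "0 < h \<Longrightarrow> incr h j \<in> borel_measurable M"
  using increment_measurable[OF grid, of h j] unfolding incr_def by simp

text \<open>One implicit step adds at most \<open>2 * h * total\<close> to the squared norm, since
  the drift pairs with the new position to \<open>total\<close>; the noise adds its variance, and
  the cross term has mean zero.\<close>

lemma X_square:
  fixes h :: real
  assumes h: "0 < h"
  shows "integrable M (\<lambda>\<omega>. (norm (X h j \<omega>))\<^sup>2) \<and>
    (\<integral>\<omega>. (norm (X h j \<omega>))\<^sup>2 \<partial>M) \<le> r\<^sup>2 + real j * h * (DIM('a) + 2 * total)"
proof (induction j)
  case 0
  have [measurable]: "Z \<in> borel_measurable M" by (rule measurable_F_M[OF order_refl Z_adapted])
  have le: "(norm (Z \<omega>))\<^sup>2 \<le> r\<^sup>2" for \<omega> using Z_bounded by (simp add: power_mono)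
  have i: "integrable M (\<lambda>\<omega>. (norm (Z \<omega>))\<^sup>2)"
    by (rule integrable_const_bound[where B="r\<^sup>2"]) (use le in auto)
  have "(\<integral>\<omega>. (norm (Z \<omega>))\<^sup>2 \<partial>M) \<le> (\<integral>\<omega>. r\<^sup>2 \<partial>M)" by (rule integral_mono[OF i _ le]) simp
  then show ?case using i by (simp add: X_0 prob_space)
next
  case (Suc j)
  let ?x = "X h j" and ?y = "X h (Suc j)" and ?d = "incr h j"
  note [measurable] = X_measurable[OF h] incr_measurable[OF h]
  have xi: "integrable M (\<lambda>\<omega>. ?x \<omega> \<bullet> b)" if "b \<in> Basis" for b
  proof (rule Bochner_Integration.integrable_bound)
    show "integrable M (\<lambda>\<omega>. 1 + (norm (?x \<omega>))\<^sup>2)" using Suc by simp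
    show "AE \<omega> in M. norm (?x \<omega> \<bullet> b) \<le> norm (1 + (norm (?x \<omega>))\<^sup>2)"
    proof (rule AE_I2)
      fix \<omega>
      have "\<bar>?x \<omega> \<bullet> b\<bar> \<le> norm (?x \<omega>)" using Basis_le_norm[OF that] by blast
      also have "\<dots> \<le> 1 + (norm (?x \<omega>))\<^sup>2"
        by (rule le_one_plus_square)
      finally show "norm (?x \<omega> \<bullet> b) \<le> norm (1 + (norm (?x \<omega>))\<^sup>2)" by simp
    qed
  qed measurable
  have pi: "integrable M (\<lambda>\<omega>. (?x \<omega> \<bullet> b) * (?d \<omega> \<bullet> b))"
    and pe: "(\<integral>\<omega>. (?x \<omega> \<bullet> b) * (?d \<omega> \<bullet> b) \<partial>M) = 0" if "b \<in> Basis" for b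
    using X_indep[OF h _ xi[OF that] _ incr_mean(1)[OF h, of _ b]] incr_mean(2)[OF h, of j b] by simp_all
  \<comment> \<open>Independence is available for products of scalar functions, so the inner product
    is expanded in coordinates.\<close>
  have eq: "?x \<omega> \<bullet> ?d \<omega> = (\<Sum>b\<in>Basis. (?x \<omega> \<bullet> b) * (?d \<omega> \<bullet> b))" for \<omega> by (rule euclidean_inner)
  have ci: "integrable M (\<lambda>\<omega>. ?x \<omega> \<bullet> ?d \<omega>)"
    unfolding eq by (intro Bochner_Integration.integrable_sum pi)
  have ce: "(\<integral>\<omega>. ?x \<omega> \<bullet> ?d \<omega> \<partial>M) = 0"
    unfolding eq by (subst Bochner_Integration.integral_sum) (auto simp: pi pe)
  let ?g = "\<lambda>\<omega>. (norm (?x \<omega>))\<^sup>2 + 2 * (?x \<omega> \<bullet> ?d \<omega>) + (norm (?d \<omega>))\<^sup>2 + 2 * h * total"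
  have gi: "integrable M ?g" using Suc ci incr_second(1)[OF h] by simp
  have le: "(norm (?y \<omega>))\<^sup>2 \<le> ?g \<omega>" for \<omega>
  proof -
    let ?b = "drift (?y \<omega>)"
    \<comment> \<open>Squaring the implicit relation for the point before the drift acts; the term
      with \<open>h\<^sup>2\<close> has the favourable sign and is dropped.\<close>
    have "(norm (?x \<omega> + ?d \<omega>))\<^sup>2 = (norm (?y \<omega>))\<^sup>2 - 2 * h * (?b \<bullet> ?y \<omega>) + h\<^sup>2 * (norm ?b)\<^sup>2"
      unfolding X_step[OF h, symmetric] power2_norm_eq_inner
      by (simp add: inner_diff_left inner_diff_right inner_commute power2_eq_square algebra_simps)
    moreover have "(norm (?x \<omega> + ?d \<omega>))\<^sup>2 = (norm (?x \<omega>))\<^sup>2 + 2 * (?x \<omega> \<bullet> ?d \<omega>) + (norm (?d \<omega>))\<^sup>2"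
      unfolding power2_norm_eq_inner by (simp add: inner_add_left inner_add_right inner_commute)
    moreover have "0 \<le> h\<^sup>2 * (norm ?b)\<^sup>2" by simp
    ultimately show ?thesis unfolding drift_inner_self[OF X_in_C[OF h]] by linarith
  qed
  have i: "integrable M (\<lambda>\<omega>. (norm (?y \<omega>))\<^sup>2)"
  proof (rule Bochner_Integration.integrable_bound[OF gi])
    show "AE \<omega> in M. norm ((norm (?y \<omega>))\<^sup>2) \<le> norm (?g \<omega>)"
    proof (rule AE_I2)
      fix \<omega> show "norm ((norm (?y \<omega>))\<^sup>2) \<le> norm (?g \<omega>)"
        using order_trans[OF le[of \<omega>] abs_ge_self] by simp
    qed
  qed measurable
  have "(\<integral>\<omega>. (norm (?y \<omega>))\<^sup>2 \<partial>M) \<le> (\<integral>\<omega>. ?g \<omega> \<partial>M)" by (rule integral_mono[OF i gi le])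
  also have "\<dots> = (\<integral>\<omega>. (norm (?x \<omega>))\<^sup>2 \<partial>M) + h * DIM('a) + 2 * h * total"
    using Suc ci ce incr_second[OF h] by (simp add: prob_space)
  also have "\<dots> \<le> r\<^sup>2 + real (Suc j) * h * (DIM('a) + 2 * total)"
    using Suc by (simp add: algebra_simps)
  finally show ?case using i by simp
qed

lemma X_integrable:
  fixes h :: real
  assumes h: "0 < h"
  shows "integrable M (\<lambda>\<omega>. norm (X h j \<omega>))" "(\<integral>\<omega>. norm (X h j \<omega>) \<partial>M) \<le> 1 + r\<^sup>2 + real j * h * (DIM('a) + 2 * total)"
    "integrable M (\<lambda>\<omega>. X h j \<omega> \<bullet> e)"
proof -
  note [measurable] = X_measurable[OF h]
  have le: "norm (X h j \<omega>) \<le> 1 + (norm (X h j \<omega>))\<^sup>2" for \<omega>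
    by (rule le_one_plus_square)
  have gi: "integrable M (\<lambda>\<omega>. 1 + (norm (X h j \<omega>))\<^sup>2)" using X_square[OF h] by simp
  show i: "integrable M (\<lambda>\<omega>. norm (X h j \<omega>))"
    by (rule Bochner_Integration.integrable_bound[OF gi]) (use le in auto)
  have "(\<integral>\<omega>. norm (X h j \<omega>) \<partial>M) \<le> (\<integral>\<omega>. 1 + (norm (X h j \<omega>))\<^sup>2 \<partial>M)" by (rule integral_mono[OF i gi le])
  also have "\<dots> = 1 + (\<integral>\<omega>. (norm (X h j \<omega>))\<^sup>2 \<partial>M)" using X_square[OF h] by (simp add: prob_space)
  finally show "(\<integral>\<omega>. norm (X h j \<omega>) \<partial>M) \<le> 1 + r\<^sup>2 + real j * h * (DIM('a) + 2 * total)"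
    using X_square[OF h, of j] by simp
  show "integrable M (\<lambda>\<omega>. X h j \<omega> \<bullet> e)"
  proof (rule Bochner_Integration.integrable_bound[of _ "\<lambda>\<omega>. norm e * norm (X h j \<omega>)"])
    show "integrable M (\<lambda>\<omega>. norm e * norm (X h j \<omega>))" using i by simp
    show "AE \<omega> in M. norm (X h j \<omega> \<bullet> e) \<le> norm (norm e * norm (X h j \<omega>))"
      using Cauchy_Schwarz_ineq2[of _ e] by (intro AE_I2) (simp add: abs_mult mult.commute[of "norm e"])
  qed measurable
qed

text \<open>Expected time integral of \<open>f\<close> along the scheme up to time
  \<open>real J * h\<close>. Right end points are used, as in \<open>eulerc\<close>.\<close>

definition occ :: "real \<Rightarrow> nat \<Rightarrow> ('a \<Rightarrow> real) \<Rightarrow> real" where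
  "occ h J f = (\<Sum>j<J. h * (\<integral>\<omega>. f (X h (Suc j) \<omega>) \<partial>M))"

text \<open>The singular drift inherits integrability from the step identity, which expresses it
  through two positions and one increment. The increment has mean zero, so expected drifts telescope
  in \<open>j\<close>.\<close>

lemma drift_inner_integrable:
  assumes h: "0 < h"
  shows "integrable M (\<lambda>\<omega>. drift (X h (Suc j) \<omega>) \<bullet> e)"
    and "h * (\<integral>\<omega>. drift (X h (Suc j) \<omega>) \<bullet> e \<partial>M) = (\<integral>\<omega>. X h (Suc j) \<omega> \<bullet> e \<partial>M) - (\<integral>\<omega>. X h j \<omega> \<bullet> e \<partial>M)"
proof -
  have eq: "h * (drift (X h (Suc j) \<omega>) \<bullet> e) = X h (Suc j) \<omega> \<bullet> e - X h j \<omega> \<bullet> e - incr h j \<omega> \<bullet> e" for \<omega>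
  proof -
    have "h *\<^sub>R drift (X h (Suc j) \<omega>) = X h (Suc j) \<omega> - X h j \<omega> - incr h j \<omega>"
      using X_step[OF h, of j \<omega>] by (simp add: algebra_simps)
    then show ?thesis by (metis inner_diff_left inner_scaleR_left)
  qed
  have "integrable M (\<lambda>\<omega>. h * (drift (X h (Suc j) \<omega>) \<bullet> e))"
    unfolding eq using X_integrable(3)[OF h] incr_mean(1)[OF h] by simp
  then show "integrable M (\<lambda>\<omega>. drift (X h (Suc j) \<omega>) \<bullet> e)" using h by simp
  have "h * (\<integral>\<omega>. drift (X h (Suc j) \<omega>) \<bullet> e \<partial>M) = (\<integral>\<omega>. h * (drift (X h (Suc j) \<omega>) \<bullet> e) \<partial>M)" by simp
  also have "\<dots> = (\<integral>\<omega>. X h (Suc j) \<omega> \<bullet> e \<partial>M) - (\<integral>\<omega>. X h j \<omega> \<bullet> e \<partial>M)"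
    unfolding eq using X_integrable(3)[OF h] incr_mean[OF h] by simp
  finally show "h * (\<integral>\<omega>. drift (X h (Suc j) \<omega>) \<bullet> e \<partial>M) = (\<integral>\<omega>. X h (Suc j) \<omega> \<bullet> e \<partial>M) - (\<integral>\<omega>. X h j \<omega> \<bullet> e \<partial>M)" .
qed

lemma weight_measurable [measurable]: "weight \<in> borel_measurable borel"
  unfolding weight_def by measurable

lemma weight_integrable: "0 < h \<Longrightarrow> integrable M (\<lambda>\<omega>. weight (X h (Suc j) \<omega>))"
proof -
  assume h: "0 < h"
  note [measurable] = X_measurable[OF h]
  obtain a where a: "a \<in> C" using chamber_nonempty by blast
  obtain c where c: "0 < c" "\<And>x. x \<in> C \<Longrightarrow> weight x \<le> c * (drift x \<bullet> a)"
    using drift_coercive[OF a] by blast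
  show ?thesis
  proof (rule Bochner_Integration.integrable_bound)
    show "integrable M (\<lambda>\<omega>. c * (drift (X h (Suc j) \<omega>) \<bullet> a))" using drift_inner_integrable(1)[OF h] by simp
    show "AE \<omega> in M. norm (weight (X h (Suc j) \<omega>)) \<le> norm (c * (drift (X h (Suc j) \<omega>) \<bullet> a))"
    proof (rule AE_I2)
      fix \<omega>
      show "norm (weight (X h (Suc j) \<omega>)) \<le> norm (c * (drift (X h (Suc j) \<omega>) \<bullet> a))"
        using order_trans[OF c(2)[OF X_in_C[OF h]] abs_ge_self] weight_nonneg[OF X_in_C[OF h]] by simp
    qed
  qed measurable
qed

text \<open>Coercivity reduces \<open>weight\<close> to \<open>drift \<bullet> a\<close>, whose
  expected sum telescopes to a difference of mean positions. The bound is uniform in the step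
  size.\<close>

lemma occ_weight_bounded:
  "\<exists>A>0. \<forall>h>0. \<forall>J. real J * h \<le> T \<longrightarrow> occ h J weight \<le> A"
proof -
  obtain a where a: "a \<in> C" using chamber_nonempty by blast
  obtain c where c: "0 < c" "\<And>x. x \<in> C \<Longrightarrow> weight x \<le> c * (drift x \<bullet> a)"
    using drift_coercive[OF a] by blast
  let ?A = "c * (norm a * (1 + r\<^sup>2 + \<bar>T\<bar> * (DIM('a) + 2 * total)) + norm a * (1 + r\<^sup>2))"
  have "occ h J weight \<le> ?A" if h: "0 < h" and J: "real J * h \<le> T" for h J
  proof -
    have "occ h J weight \<le> (\<Sum>j<J. c * (h * (\<integral>\<omega>. drift (X h (Suc j) \<omega>) \<bullet> a \<partial>M)))"
      unfolding occ_def
    proof (rule sum_mono)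
      fix j
      have "(\<integral>\<omega>. weight (X h (Suc j) \<omega>) \<partial>M) \<le> (\<integral>\<omega>. c * (drift (X h (Suc j) \<omega>) \<bullet> a) \<partial>M)"
        by (rule integral_mono[OF weight_integrable[OF h]]) (simp_all add: drift_inner_integrable(1)[OF h] c(2)[OF X_in_C[OF h]])
      then have "h * (\<integral>\<omega>. weight (X h (Suc j) \<omega>) \<partial>M) \<le> h * (c * (\<integral>\<omega>. drift (X h (Suc j) \<omega>) \<bullet> a \<partial>M))"
        using h by simp
      then show "h * (\<integral>\<omega>. weight (X h (Suc j) \<omega>) \<partial>M) \<le> c * (h * (\<integral>\<omega>. drift (X h (Suc j) \<omega>) \<bullet> a \<partial>M))"
        by (simp add: ac_simps)
    qed
    also have "\<dots> = c * ((\<integral>\<omega>. X h J \<omega> \<bullet> a \<partial>M) - (\<integral>\<omega>. X h 0 \<omega> \<bullet> a \<partial>M))"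
      unfolding drift_inner_integrable(2)[OF h] sum_distrib_left[symmetric]
      by (rule arg_cong[where f="(*) c"], rule sum_lessThan_telescope)
    also have "\<dots> \<le> ?A"
    proof (rule mult_left_mono)
      have b: "\<bar>\<integral>\<omega>. X h j \<omega> \<bullet> a \<partial>M\<bar> \<le> norm a * (1 + r\<^sup>2 + real j * h * (DIM('a) + 2 * total))" for j
      proof -
        have "\<bar>\<integral>\<omega>. X h j \<omega> \<bullet> a \<partial>M\<bar> \<le> (\<integral>\<omega>. norm a * norm (X h j \<omega>) \<partial>M)"
          by (rule order_trans[OF integral_abs_bound integral_mono])
             (use X_integrable[OF h] Cauchy_Schwarz_ineq2[of _ a] in \<open>auto simp: mult.commute[of "norm a"]\<close>)
        also have "\<dots> \<le> norm a * (1 + r\<^sup>2 + real j * h * (DIM('a) + 2 * total))"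
          using X_integrable(2)[OF h, of j] by (simp add: mult_left_mono)
        finally show ?thesis .
      qed
      have "norm a * (1 + r\<^sup>2 + real J * h * (DIM('a) + 2 * total)) \<le> norm a * (1 + r\<^sup>2 + \<bar>T\<bar> * (DIM('a) + 2 * total))"
        using J total_nonneg by (intro mult_left_mono add_mono mult_right_mono) auto
      with b[of J] b[of 0] show "(\<integral>\<omega>. X h J \<omega> \<bullet> a \<partial>M) - (\<integral>\<omega>. X h 0 \<omega> \<bullet> a \<partial>M)
          \<le> norm a * (1 + r\<^sup>2 + \<bar>T\<bar> * (DIM('a) + 2 * total)) + norm a * (1 + r\<^sup>2)" by simp
    qed (use c in auto)
    finally show ?thesis .
  qed
  then have "occ h J weight \<le> \<bar>?A\<bar> + 1" if "0 < h" "real J * h \<le> T" for h J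
    using that by (smt (verit))
  moreover have "0 < \<bar>?A\<bar> + 1" by simp
  ultimately show ?thesis by blast
qed

end

section \<open>Concentration of the drift near the walls\<close>

text \<open>A concave C^1 function with slope 1 at the origin, parabolic up to
  \<open>\<delta>\<close> and constant \<open>\<delta> / 2\<close> afterwards. Being bounded by
  \<open>\<delta> / 2\<close>, it contributes little when telescoped; \<open>cap'\<close> below is
  its derivative.\<close>

definition cap :: "real \<Rightarrow> real \<Rightarrow> real" where
  "cap \<delta> s = \<delta> / 2 * (1 - (max 0 (1 - s / \<delta>))\<^sup>2)"

definition cap' :: "real \<Rightarrow> real \<Rightarrow> real" where
  "cap' \<delta> s = max 0 (1 - s / \<delta>)"

lemma cap_cap': "cap \<delta> s = \<delta> / 2 * (1 - (cap' \<delta> s)\<^sup>2)"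
  by (simp add: cap_def cap'_def)

lemma cap'_bounds:
  assumes "0 < \<delta>"
  shows "0 \<le> cap' \<delta> s" "0 \<le> s \<Longrightarrow> cap' \<delta> s \<le> 1" "s \<le> \<delta> / 2 \<Longrightarrow> 1 / 2 \<le> cap' \<delta> s" "\<delta> \<le> s \<Longrightarrow> cap' \<delta> s = 0"
  using assms by (auto simp: cap'_def max_def field_simps)

lemma cap_bounds:
  assumes "0 < \<delta>" "0 \<le> s"
  shows "0 \<le> cap \<delta> s" "cap \<delta> s \<le> \<delta> / 2"
proof -
  have "(cap' \<delta> s)\<^sup>2 \<le> 1" using cap'_bounds(1,2)[OF assms(1), of s] assms(2) by (simp add: power_le_one)
  then show "0 \<le> cap \<delta> s" "cap \<delta> s \<le> \<delta> / 2" using assms by (simp_all add: cap_cap' mult_le_cancel_left1)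
qed

lemma cap_concave:
  assumes d: "0 < \<delta>"
  shows "cap' \<delta> u * (u - v) \<le> cap \<delta> u - cap \<delta> v"
proof -
  define a b where "a = cap' \<delta> u" and "b = cap' \<delta> v"
  have eq: "cap \<delta> u - cap \<delta> v = \<delta> / 2 * (b\<^sup>2 - a\<^sup>2)" by (simp add: cap_cap' a_def b_def algebra_simps)
  show ?thesis
  proof (cases "a = 0")
    case True
    moreover have "0 \<le> \<delta> / 2 * b\<^sup>2" using d by simp
    ultimately show ?thesis using eq by (simp add: a_def[symmetric])
  next
    case False
    moreover have "0 \<le> a" "a = 0 \<or> a = 1 - u / \<delta>" by (auto simp: a_def cap'_def max_def)
    ultimately have a: "a = 1 - u / \<delta>" "0 < a" by linarith+
    have "1 - v / \<delta> \<le> b" by (simp add: b_def cap'_def)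
    then have "u - v \<le> \<delta> * (b - a)" using a d by (simp add: field_simps)
    then have "a * (u - v) \<le> a * (\<delta> * (b - a))" using a by (intro mult_left_mono) auto
    also have "\<dots> \<le> \<delta> / 2 * (b\<^sup>2 - a\<^sup>2)"
    proof -
      have "0 \<le> \<delta> / 2 * (b - a)\<^sup>2" using d by simp
      also have "\<dots> = \<delta> / 2 * (b\<^sup>2 - a\<^sup>2) - a * (\<delta> * (b - a))" by (simp add: power2_eq_square field_simps)
      finally show ?thesis by simp
    qed
    finally show ?thesis unfolding eq a_def .
  qed
qed

text \<open>The second derivative is -1/\<delta> below \<delta> and zero above, so curvature costs a
  quadratic term near the wall. From beyond 2\<delta> it is felt only after a move of at least
  \<delta>, and then the fourth power over \<delta>^3 dominates the square over \<delta>. This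
  localises the quadratic cost to \<open>s \<le> 2 * \<delta>\<close>.\<close>

lemma cap_taylor:
  assumes d: "0 < \<delta>"
  shows "cap \<delta> s + cap' \<delta> s * \<xi> - of_bool (s \<le> 2 * \<delta>) * \<xi>\<^sup>2 / (2 * \<delta>) - \<xi> ^ 4 / (2 * \<delta> ^ 3) \<le> cap \<delta> (s + \<xi>)"
proof -
  define a b t where "a = cap' \<delta> s" and "b = cap' \<delta> (s + \<xi>)" and "t = \<xi> / \<delta>"
  have xi: "\<xi> = \<delta> * t" using d by (simp add: t_def)
  have t4: "\<xi> ^ 4 / (2 * \<delta> ^ 3) = \<delta> / 2 * t ^ 4" using d by (simp add: xi power_mult_distrib power_eq_if field_simps)
  have t2: "\<xi>\<^sup>2 / (2 * \<delta>) = \<delta> / 2 * t\<^sup>2" using d by (simp add: xi power_mult_distrib power2_eq_square field_simps)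
  have b0: "0 \<le> b" using cap'_bounds(1)[OF d] by (simp add: b_def)
  have be: "b = 0 \<or> b = 1 - s / \<delta> - t" by (auto simp: b_def cap'_def t_def max_def add_divide_distrib)
  have sq: "b\<^sup>2 \<le> a\<^sup>2 - 2 * a * t + of_bool (s \<le> 2 * \<delta>) * t\<^sup>2 + t ^ 4"
  proof (cases "s \<le> 2 * \<delta>")
    case True
    have "1 - s / \<delta> \<le> a" by (simp add: a_def cap'_def)
    with be have "b = 0 \<or> b \<le> a - t" by auto
    then have "b\<^sup>2 \<le> (a - t)\<^sup>2"
    proof
      assume "b \<le> a - t" then show ?thesis using b0 by (intro power_mono)
    qed simp
    also have "\<dots> = a\<^sup>2 - 2 * a * t + t\<^sup>2" by (simp add: power2_eq_square algebra_simps)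
    finally have "b\<^sup>2 \<le> a\<^sup>2 - 2 * a * t + t\<^sup>2" .
    moreover have "0 \<le> t ^ 4" by simp
    ultimately have "b\<^sup>2 \<le> a\<^sup>2 - 2 * a * t + t\<^sup>2 + t ^ 4" by linarith
    then show ?thesis using True by simp
  next
    case False
    then have "2 \<le> s / \<delta>" using d by (simp add: field_simps)
    then have a0: "a = 0" by (simp add: a_def cap'_def)
    have "b\<^sup>2 \<le> t ^ 4"
    proof (cases "b = 0")
      case True then show ?thesis by simp
    next
      case False
      with be \<open>2 \<le> s / \<delta>\<close> b0 have "b \<le> - t" "1 \<le> - t" by auto
      then have "b\<^sup>2 \<le> (- t)\<^sup>2" "(- t)\<^sup>2 \<le> (- t) ^ 4"
        using b0 power_mono[of b "- t" 2] power_increasing[of 2 4 "- t"] by simp_all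
      then show ?thesis by simp
    qed
    then show ?thesis using a0 False by simp
  qed
  have "cap \<delta> (s + \<xi>) - (cap \<delta> s + cap' \<delta> s * \<xi> - of_bool (s \<le> 2 * \<delta>) * \<xi>\<^sup>2 / (2 * \<delta>) - \<xi> ^ 4 / (2 * \<delta> ^ 3))
    = \<delta> / 2 * (a\<^sup>2 - 2 * a * t + of_bool (s \<le> 2 * \<delta>) * t\<^sup>2 + t ^ 4 - b\<^sup>2)"
    unfolding cap_cap' a_def[symmetric] b_def[symmetric] t4 times_divide_eq_right[symmetric] t2
    by (simp add: xi algebra_simps)
  also have "0 \<le> \<dots>" using sq d by simp
  finally show ?thesis by simp
qed

text \<open>A geometric sum is at most twice its largest term, and each term counted is at most
  \<open>u\<close>.\<close>

lemma sum_dyadic_le: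
  fixes u :: real
  assumes "0 \<le> u"
  shows "(\<Sum>i<N. 2 ^ i * of_bool (2 ^ i \<le> u)) \<le> 2 * u"
proof (induction N)
  case (Suc N)
  show ?case
  proof (cases "2 ^ N \<le> u")
    case True
    have "(\<Sum>i<Suc N. 2 ^ i * of_bool (2 ^ i \<le> u)) \<le> (\<Sum>i<Suc N. 2 ^ i :: real)" by (intro sum_mono) auto
    also have "\<dots> = 2 ^ Suc N - 1" using sum_power2[of "Suc N"] by (simp add: atLeast0LessThan geometric_sum)
    also have "\<dots> \<le> 2 * u" using True by simp
    finally show ?thesis .
  qed (use Suc in simp)
qed (use assms in simp)

section \<open>Directions attached to faces, and functions of controlled growth\<close>

context wall_repulsion
begin

text \<open>The point of the convex hull of \<open>I\<close> nearest to the origin pairs positively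
  with all of \<open>I\<close>, and it is nonzero because \<open>I\<close> lies in an open
  half-space. Strict positivity of the coefficients is wanted so that p \<bullet> x controls
  \<open>\<alpha> \<bullet> x\<close> for each \<alpha> in \<open>I\<close>.\<close>

lemma dual_vector:
  assumes I: "I \<subseteq> S" "I \<noteq> {}"
  shows "\<exists>c. (\<forall>\<alpha>\<in>I. 0 < c \<alpha>) \<and> (\<forall>\<beta>\<in>I. 0 < (\<Sum>\<alpha>\<in>I. c \<alpha> *\<^sub>R \<alpha>) \<bullet> \<beta>)"
proof -
  obtain a where a: "a \<in> C" using chamber_nonempty by blast
  have fI: "finite I" using I fin finite_subset by blast
  let ?H = "convex hull I"
  have comp: "compact ?H" by (rule finite_imp_compact_convex_hull[OF fI])
  have "?H \<noteq> {}" using I by simp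
  then obtain p where p: "p \<in> ?H" "\<forall>z\<in>?H. dist 0 p \<le> dist 0 z"
    by (rule distance_attains_inf[OF compact_imp_closed[OF comp], of 0]) blast
  \<comment> \<open>Variational inequality of the projection of the origin onto the hull.\<close>
  have ge: "p \<bullet> p \<le> p \<bullet> \<beta>" if "\<beta> \<in> I" for \<beta>
  proof -
    have "(0 - p) \<bullet> (\<beta> - p) \<le> 0"
      using p that by (intro any_closest_point_dot[of ?H]) (auto simp: compact_imp_closed[OF comp] hull_inc)
    then show ?thesis by (simp add: inner_diff_right)
  qed
  have "I \<subseteq> {x. 0 < a \<bullet> x}" using C_D[OF a] I by (auto simp: inner_commute)
  then have "?H \<subseteq> {x. 0 < a \<bullet> x}" by (intro hull_minimal convex_halfspace_gt)
  with p have "p \<noteq> 0" by auto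
  then have pp: "0 < p \<bullet> p" by simp
  obtain u where u: "\<And>\<alpha>. \<alpha> \<in> I \<Longrightarrow> 0 \<le> u \<alpha>" "(\<Sum>\<alpha>\<in>I. u \<alpha> *\<^sub>R \<alpha>) = p"
    using p(1) unfolding convex_hull_finite[OF fI] by auto
  let ?s = "\<Sum>\<alpha>\<in>I. \<alpha>"
  obtain L where L: "0 < L" "\<And>\<beta>. \<beta> \<in> I \<Longrightarrow> - (?s \<bullet> \<beta>) \<le> L"
    using finite_upper_bound[OF fI, of "\<lambda>\<beta>. - (?s \<bullet> \<beta>)"] by blast
  \<comment> \<open>The nearest point may have zero coefficients. Adding \<open>e\<close> to all of
    them perturbs each pairing downwards by at most half of \<open>p \<bullet> p\<close>.\<close>
  define e where "e = p \<bullet> p / (2 * L)"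
  have e: "0 < e" "e * L < p \<bullet> p" using pp L by (auto simp: e_def)
  have "(\<Sum>\<alpha>\<in>I. (u \<alpha> + e) *\<^sub>R \<alpha>) = p + e *\<^sub>R ?s"
    using u(2) by (simp add: scaleR_add_left sum.distrib scaleR_sum_right)
  moreover have "0 < (p + e *\<^sub>R ?s) \<bullet> \<beta>" if "\<beta> \<in> I" for \<beta>
  proof -
    have "e * (- (?s \<bullet> \<beta>)) \<le> e * L" using L(2)[OF that] e(1) by (intro mult_left_mono) auto
    then show ?thesis using ge[OF that] e(2) by (simp add: inner_add_left)
  qed
  ultimately show ?thesis using u(1) e(1) by (intro exI[of _ "\<lambda>\<alpha>. u \<alpha> + e"]) (auto intro: add_nonneg_pos)
qed

text \<open>The growth allowed to integrands: along the scheme \<open>weight\<close> is integrable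
  after any step, hence so are these functions.\<close>

definition dominated :: "('a \<Rightarrow> real) \<Rightarrow> bool" where
  "dominated f \<longleftrightarrow> f \<in> borel_measurable borel \<and> (\<exists>c. \<forall>x\<in>C. \<bar>f x\<bar> \<le> c * (1 + weight x))"

lemma dominatedI: "f \<in> borel_measurable borel \<Longrightarrow> (\<And>x. x \<in> C \<Longrightarrow> \<bar>f x\<bar> \<le> c * (1 + weight x)) \<Longrightarrow> dominated f"
  unfolding dominated_def by blast

lemma dominated_add: "dominated f \<Longrightarrow> dominated g \<Longrightarrow> dominated (\<lambda>x. f x + g x)"
proof -
  assume "dominated f" "dominated g"
  then obtain c d where cd: "f \<in> borel_measurable borel" "g \<in> borel_measurable borel"
    "\<And>x. x \<in> C \<Longrightarrow> \<bar>f x\<bar> \<le> c * (1 + weight x)" "\<And>x. x \<in> C \<Longrightarrow> \<bar>g x\<bar> \<le> d * (1 + weight x)"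
    unfolding dominated_def by blast
  show ?thesis
  proof (rule dominatedI)
    fix x assume "x \<in> C"
    from cd(3,4)[OF this] show "\<bar>f x + g x\<bar> \<le> (c + d) * (1 + weight x)" unfolding distrib_right by linarith
  qed (use cd in measurable)
qed

lemma dominated_cmult: "dominated f \<Longrightarrow> dominated (\<lambda>x. a * f x)"
proof -
  assume "dominated f"
  then obtain c where c: "f \<in> borel_measurable borel" "\<And>x. x \<in> C \<Longrightarrow> \<bar>f x\<bar> \<le> c * (1 + weight x)"
    unfolding dominated_def by blast
  show ?thesis
  proof (rule dominatedI)
    fix x assume "x \<in> C"
    from c(2)[OF this] show "\<bar>a * f x\<bar> \<le> (\<bar>a\<bar> * c) * (1 + weight x)"
      unfolding abs_mult mult.assoc by (intro mult_left_mono) auto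
  qed (use c in measurable)
qed

lemma dominated_sum: "finite A \<Longrightarrow> (\<And>i. i \<in> A \<Longrightarrow> dominated (f i)) \<Longrightarrow> dominated (\<lambda>x. \<Sum>i\<in>A. f i x)"
proof (induction A rule: finite_induct)
  case empty
  show ?case by (rule dominatedI[where c=0]) auto
next
  case (insert i A)
  then show ?case by (simp add: dominated_add)
qed

lemma dominated_bounded:
  assumes "f \<in> borel_measurable borel" "\<And>x. x \<in> C \<Longrightarrow> \<bar>f x\<bar> \<le> c"
  shows "dominated f"
proof (rule dominatedI[OF assms(1)])
  fix x assume x: "x \<in> C"
  have "\<bar>f x\<bar> \<le> \<bar>c\<bar> * 1" using assms(2)[OF x] by simp
  also have "\<dots> \<le> \<bar>c\<bar> * (1 + weight x)" using weight_nonneg[OF x] by (intro mult_left_mono) auto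
  finally show "\<bar>f x\<bar> \<le> \<bar>c\<bar> * (1 + weight x)" .
qed

lemma dominated_weight:
  assumes "f \<in> borel_measurable borel" "\<And>x. x \<in> C \<Longrightarrow> \<bar>f x\<bar> \<le> c * weight x"
  shows "dominated f"
proof (rule dominatedI[OF assms(1)])
  fix x assume x: "x \<in> C"
  have "\<bar>f x\<bar> \<le> \<bar>c\<bar> * weight x"
    using assms(2)[OF x] weight_nonneg[OF x] by (meson abs_ge_self mult_right_mono order_trans)
  also have "\<dots> \<le> \<bar>c\<bar> * (1 + weight x)" by (intro mult_left_mono) auto
  finally show "\<bar>f x\<bar> \<le> \<bar>c\<bar> * (1 + weight x)" .
qed

end

section \<open>A discrete Ito inequality for the test function\<close>

context noisy_walls
begin

lemma dominated_integrable:
  assumes h: "0 < h" and f: "dominated f"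
  shows "integrable M (\<lambda>\<omega>. f (X h (Suc j) \<omega>))"
proof -
  obtain c where c: "f \<in> borel_measurable borel" "\<And>x. x \<in> C \<Longrightarrow> \<bar>f x\<bar> \<le> c * (1 + weight x)"
    using f unfolding dominated_def by blast
  show ?thesis
  proof (rule Bochner_Integration.integrable_bound)
    show "integrable M (\<lambda>\<omega>. c * (1 + weight (X h (Suc j) \<omega>)))" using weight_integrable[OF h] by simp
    show "(\<lambda>\<omega>. f (X h (Suc j) \<omega>)) \<in> borel_measurable M" by (rule measurable_compose[OF X_measurable[OF h] c(1)])
    show "AE \<omega> in M. norm (f (X h (Suc j) \<omega>)) \<le> norm (c * (1 + weight (X h (Suc j) \<omega>)))"
      by (intro AE_I2) (use order_trans[OF c(2)[OF X_in_C[OF h]] abs_ge_self] in simp)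
  qed
qed

lemma occ_mono:
  assumes h: "0 < h" and "dominated f" "dominated g" "\<And>x. x \<in> C \<Longrightarrow> f x \<le> g x"
  shows "occ h J f \<le> occ h J g"
  unfolding occ_def using assms X_in_C[OF h]
  by (intro sum_mono mult_left_mono integral_mono dominated_integrable) auto

lemma occ_nonneg:
  assumes h: "0 < h" and "\<And>x. x \<in> C \<Longrightarrow> 0 \<le> f x"
  shows "0 \<le> occ h J f"
  unfolding occ_def using assms X_in_C[OF h]
  by (intro sum_nonneg mult_nonneg_nonneg integral_nonneg) auto

lemma occ_add: "0 < h \<Longrightarrow> dominated f \<Longrightarrow> dominated g \<Longrightarrow> occ h J (\<lambda>x. f x + g x) = occ h J f + occ h J g"
  unfolding occ_def by (simp add: dominated_integrable sum.distrib distrib_left)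

lemma occ_cmult: "occ h J (\<lambda>x. a * f x) = a * occ h J f"
  unfolding occ_def by (simp add: sum_distrib_left ac_simps)

lemma occ_sum:
  assumes h: "0 < h" and "finite A" "\<And>i. i \<in> A \<Longrightarrow> dominated (f i)"
  shows "occ h J (\<lambda>x. \<Sum>i\<in>A. f i x) = (\<Sum>i\<in>A. occ h J (f i))"
  using assms(2,3)
proof (induction A rule: finite_induct)
  case empty
  show ?case by (simp add: occ_def)
next
  case (insert i A)
  then show ?case by (simp add: occ_add[OF h] dominated_sum)
qed

lemma dominated_drift_inner:
  assumes "f \<in> borel_measurable borel" "\<And>x. x \<in> C \<Longrightarrow> \<bar>f x\<bar> \<le> 1"
  shows "dominated (\<lambda>x. f x * (drift x \<bullet> p))"
proof -
  obtain L where L: "0 < L" "\<And>x. x \<in> C \<Longrightarrow> norm (drift x) \<le> L * weight x"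
    using norm_drift_le_weight by blast
  show ?thesis
  proof (rule dominated_weight)
    fix x assume x: "x \<in> C"
    have "\<bar>f x * (drift x \<bullet> p)\<bar> \<le> 1 * (norm (drift x) * norm p)"
      unfolding abs_mult using assms(2)[OF x] Cauchy_Schwarz_ineq2 by (intro mult_mono) auto
    also have "\<dots> \<le> (L * norm p) * weight x"
      using mult_right_mono[OF L(2)[OF x] norm_ge_zero[of p]] by (simp add: ac_simps)
    finally show "\<bar>f x * (drift x \<bullet> p)\<bar> \<le> (L * norm p) * weight x" .
  qed (use assms in measurable)
qed

text \<open>Taking expectations removes the linear noise term by independence. The second moment
  gives the curvature cost near \<open>p \<bullet> x = 0\<close>, and the fourth moment an error of
  order \<open>h\<^sup>2\<close>, negligible after summing over a fixed time span at fixed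
  \<open>\<delta>\<close>.\<close>

lemma test_step:
  fixes h :: real
  assumes h: "0 < h" and d: "0 < \<delta>" and p: "\<And>x. x \<in> C \<Longrightarrow> 0 \<le> p \<bullet> x"
  shows "h * (\<integral>\<omega>. cap' \<delta> (p \<bullet> X h (Suc j) \<omega>) * (drift (X h (Suc j) \<omega>) \<bullet> p) \<partial>M)
    \<le> (\<integral>\<omega>. cap \<delta> (p \<bullet> X h (Suc j) \<omega>) \<partial>M) - (\<integral>\<omega>. cap \<delta> (p \<bullet> X h j \<omega>) \<partial>M)
      + (norm p)\<^sup>2 * DIM('a) / (2 * \<delta>) * (h * (\<integral>\<omega>. of_bool (p \<bullet> X h j \<omega> \<le> 2 * \<delta>) \<partial>M))
      + 3 * (norm p) ^ 4 * (DIM('a))\<^sup>2 * h\<^sup>2 / (2 * \<delta> ^ 3)"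
proof -
  let ?x = "X h j" and ?y = "X h (Suc j)" and ?d = "incr h j"
  let ?i = "\<lambda>\<omega>. of_bool (p \<bullet> ?x \<omega> \<le> 2 * \<delta>) :: real"
  note [measurable] = X_measurable[OF h] incr_measurable[OF h]
  have capm[measurable]: "cap \<delta> \<in> borel_measurable borel" "cap' \<delta> \<in> borel_measurable borel"
    unfolding cap_def cap'_def by measurable
  have px: "0 \<le> p \<bullet> X h j \<omega>" for j \<omega> by (rule p[OF X_in_C[OF h]])
  have ci: "integrable M (\<lambda>\<omega>. cap \<delta> (p \<bullet> X h j \<omega>))" for j
    by (rule integrable_const_bound[where B="\<delta> / 2"]) (use cap_bounds[OF d px] in auto)
  have c'i: "integrable M (\<lambda>\<omega>. cap' \<delta> (p \<bullet> ?x \<omega>))"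
    by (rule integrable_const_bound[where B=1]) (use cap'_bounds(1,2)[OF d] px in auto)
  have ii: "integrable M ?i" by (rule integrable_const_bound[where B=1]) auto
  have bi: "integrable M (\<lambda>\<omega>. cap' \<delta> (p \<bullet> ?y \<omega>) * (drift (?y \<omega>) \<bullet> p))"
    by (rule dominated_integrable[OF h dominated_drift_inner]) (use cap'_bounds(1)[OF d] cap'_bounds(2)[OF d p] in auto)
  have m1: "integrable M (\<lambda>\<omega>. cap' \<delta> (p \<bullet> ?x \<omega>) * (?d \<omega> \<bullet> p))"
    "(\<integral>\<omega>. cap' \<delta> (p \<bullet> ?x \<omega>) * (?d \<omega> \<bullet> p) \<partial>M) = 0"
    using X_indep[OF h, where f="\<lambda>x. cap' \<delta> (p \<bullet> x)" and g="\<lambda>v. v \<bullet> p" and j=j] c'i incr_mean[OF h, of j p] by simp_all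
  have m2: "integrable M (\<lambda>\<omega>. ?i \<omega> * (norm (?d \<omega>))\<^sup>2)"
    "(\<integral>\<omega>. ?i \<omega> * (norm (?d \<omega>))\<^sup>2 \<partial>M) = (\<integral>\<omega>. ?i \<omega> \<partial>M) * (h * DIM('a))"
    using X_indep[OF h, where f="\<lambda>x. of_bool (p \<bullet> x \<le> 2 * \<delta>)" and g="\<lambda>v. (norm v)\<^sup>2" and j=j] ii incr_second[OF h, of j] by simp_all
  let ?c2 = "(norm p)\<^sup>2 / (2 * \<delta>)" and ?c4 = "(norm p) ^ 4 / (2 * \<delta> ^ 3)"
  let ?g = "\<lambda>\<omega>. cap \<delta> (p \<bullet> ?y \<omega>) - cap \<delta> (p \<bullet> ?x \<omega>) - cap' \<delta> (p \<bullet> ?x \<omega>) * (?d \<omega> \<bullet> p)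
    + ?c2 * (?i \<omega> * (norm (?d \<omega>))\<^sup>2) + ?c4 * (norm (?d \<omega>)) ^ 4"
  have gi: "integrable M ?g"
    by (intro Bochner_Integration.integrable_add Bochner_Integration.integrable_diff integrable_mult_right ci m1 m2 incr_fourth(1)[OF h])
  have le: "h * (cap' \<delta> (p \<bullet> ?y \<omega>) * (drift (?y \<omega>) \<bullet> p)) \<le> ?g \<omega>" for \<omega>
  proof -
    \<comment> \<open>The step is split at the point before the drift acts. The move from
      \<open>?z\<close> to \<open>?y\<close> is treated by concavity with the slope at the implicit
      end point, the noise from \<open>?x\<close> to \<open>?z\<close> by
      \<open>cap_taylor\<close>.\<close>
    let ?z = "?x \<omega> + ?d \<omega>"
    have "p \<bullet> ?y \<omega> - p \<bullet> ?z = h * (drift (?y \<omega>) \<bullet> p)"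
      unfolding X_step[OF h, symmetric] by (simp add: inner_diff_right inner_commute)
    then have "h * (cap' \<delta> (p \<bullet> ?y \<omega>) * (drift (?y \<omega>) \<bullet> p)) \<le> cap \<delta> (p \<bullet> ?y \<omega>) - cap \<delta> (p \<bullet> ?z)"
      using cap_concave[OF d, of "p \<bullet> ?y \<omega>" "p \<bullet> ?z"] by (simp add: ac_simps)
    moreover have "cap \<delta> (p \<bullet> ?x \<omega>) + cap' \<delta> (p \<bullet> ?x \<omega>) * (?d \<omega> \<bullet> p)
        - ?i \<omega> * (?d \<omega> \<bullet> p)\<^sup>2 / (2 * \<delta>) - (?d \<omega> \<bullet> p) ^ 4 / (2 * \<delta> ^ 3) \<le> cap \<delta> (p \<bullet> ?z)"
      using cap_taylor[OF d, of "p \<bullet> ?x \<omega>" "?d \<omega> \<bullet> p"] by (simp add: inner_add_right inner_commute)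
    moreover have "?i \<omega> * (?d \<omega> \<bullet> p)\<^sup>2 / (2 * \<delta>) \<le> ?c2 * (?i \<omega> * (norm (?d \<omega>))\<^sup>2)"
    proof -
      have "(?d \<omega> \<bullet> p)\<^sup>2 \<le> (norm p)\<^sup>2 * (norm (?d \<omega>))\<^sup>2"
        using power_mono[OF Cauchy_Schwarz_ineq2[of "?d \<omega>" p], of 2] by (simp add: power_mult_distrib mult.commute)
      then show ?thesis using d by (auto simp: divide_right_mono)
    qed
    moreover have "(?d \<omega> \<bullet> p) ^ 4 / (2 * \<delta> ^ 3) \<le> ?c4 * (norm (?d \<omega>)) ^ 4"
    proof -
      have "(?d \<omega> \<bullet> p) ^ 4 \<le> (norm p) ^ 4 * (norm (?d \<omega>)) ^ 4"
        using power_mono[OF Cauchy_Schwarz_ineq2[of "?d \<omega>" p], of 4] by (simp add: power_mult_distrib mult.commute)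
      then show ?thesis using d by (simp add: divide_right_mono)
    qed
    ultimately show ?thesis by linarith
  qed
  have "h * (\<integral>\<omega>. cap' \<delta> (p \<bullet> ?y \<omega>) * (drift (?y \<omega>) \<bullet> p) \<partial>M) = (\<integral>\<omega>. h * (cap' \<delta> (p \<bullet> ?y \<omega>) * (drift (?y \<omega>) \<bullet> p)) \<partial>M)"
    by simp
  also have "\<dots> \<le> (\<integral>\<omega>. ?g \<omega> \<partial>M)"
    by (rule integral_mono[OF integrable_mult_right[OF bi] gi le])
  also have "\<dots> = (\<integral>\<omega>. cap \<delta> (p \<bullet> ?y \<omega>) \<partial>M) - (\<integral>\<omega>. cap \<delta> (p \<bullet> ?x \<omega>) \<partial>M)
      + ?c2 * ((\<integral>\<omega>. ?i \<omega> \<partial>M) * (h * DIM('a))) + ?c4 * (\<integral>\<omega>. (norm (?d \<omega>)) ^ 4 \<partial>M)"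
    using ci[of j] ci[of "Suc j"] m1 m2 incr_fourth(1)[OF h, of j] by simp
  also have "?c4 * (\<integral>\<omega>. (norm (?d \<omega>)) ^ 4 \<partial>M) \<le> ?c4 * (3 * (DIM('a))\<^sup>2 * h\<^sup>2)"
    using d by (intro mult_left_mono incr_fourth(2)[OF h]) auto
  finally show ?thesis by (simp add: ac_simps)
qed

end

section \<open>Tightness by induction over the faces of the chamber\<close>

context noisy_walls
begin

text \<open>Summing the steps, the values of the test function telescope to at most
  \<open>\<delta> / 2\<close>.\<close>

lemma test_occ:
  fixes h :: real
  assumes h: "0 < h" and d: "0 < \<delta>" and p: "\<And>x. x \<in> C \<Longrightarrow> 0 \<le> p \<bullet> x" and J: "real J * h \<le> T"
  shows "occ h J (\<lambda>x. cap' \<delta> (p \<bullet> x) * (drift x \<bullet> p))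
    \<le> \<delta> / 2 + (norm p)\<^sup>2 * DIM('a) / (2 * \<delta>) * (h + occ h J (\<lambda>x. of_bool (p \<bullet> x \<le> 2 * \<delta>)))
      + T * (3 * (norm p) ^ 4 * (real DIM('a))\<^sup>2 * h / (2 * \<delta> ^ 3))"
proof -
  define e where "e j = (\<integral>\<omega>. cap \<delta> (p \<bullet> X h j \<omega>) \<partial>M)" for j
  define i where "i j = h * (\<integral>\<omega>. of_bool (p \<bullet> X h j \<omega> \<le> 2 * \<delta>) \<partial>M)" for j
  define c where "c = (norm p)\<^sup>2 * DIM('a) / (2 * \<delta>)"
  define g where "g = 3 * (norm p) ^ 4 * (real DIM('a))\<^sup>2 * h / (2 * \<delta> ^ 3)"
  note [measurable] = X_measurable[OF h]
  have capm[measurable]: "cap \<delta> \<in> borel_measurable borel" unfolding cap_def by measurable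
  have px: "0 \<le> p \<bullet> X h j \<omega>" for j \<omega> by (rule p[OF X_in_C[OF h]])
  have g0: "0 \<le> g" "0 \<le> c" using d h by (auto simp: g_def c_def)
  have ei: "integrable M (\<lambda>\<omega>. cap \<delta> (p \<bullet> X h j \<omega>))" for j
    by (rule integrable_const_bound[where B="\<delta> / 2"]) (use cap_bounds[OF d px] in auto)
  have e: "0 \<le> e j" "e j \<le> \<delta> / 2" for j
  proof -
    show "0 \<le> e j" unfolding e_def using cap_bounds[OF d px] by (intro Bochner_Integration.integral_nonneg) auto
    have "e j \<le> (\<integral>\<omega>. \<delta> / 2 \<partial>M)" unfolding e_def using cap_bounds[OF d px] by (intro integral_mono ei) auto
    then show "e j \<le> \<delta> / 2" by (simp add: prob_space)
  qed
  have i0: "0 \<le> i j" for j unfolding i_def using h by (intro mult_nonneg_nonneg Bochner_Integration.integral_nonneg) auto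
  have ih: "i j \<le> h" for j
  proof -
    have "(\<integral>\<omega>. of_bool (p \<bullet> X h j \<omega> \<le> 2 * \<delta>) \<partial>M) \<le> (\<integral>\<omega>. (1 :: real) \<partial>M)"
      by (intro integral_mono integrable_const_bound[where B=1]) auto
    then show ?thesis unfolding i_def using h by (simp add: prob_space)
  qed
  have step: "h * (\<integral>\<omega>. cap' \<delta> (p \<bullet> X h (Suc j) \<omega>) * (drift (X h (Suc j) \<omega>) \<bullet> p) \<partial>M)
      \<le> (e (Suc j) - e j) + c * i j + h * g" for j
  proof -
    have hg: "h * g = 3 * (norm p) ^ 4 * (real DIM('a))\<^sup>2 * h\<^sup>2 / (2 * \<delta> ^ 3)"
      by (simp add: g_def power2_eq_square)
    show ?thesis using test_step[OF h d p, of j] unfolding hg e_def i_def c_def by simp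
  qed
  have "occ h J (\<lambda>x. cap' \<delta> (p \<bullet> x) * (drift x \<bullet> p)) \<le> (\<Sum>j<J. (e (Suc j) - e j) + c * i j + h * g)"
    unfolding occ_def by (intro sum_mono step)
  also have "\<dots> = (e J - e 0) + c * (\<Sum>j<J. i j) + real J * h * g"
    by (simp only: sum.distrib sum_lessThan_telescope sum_distrib_left sum_constant card_lessThan mult.assoc)
  \<comment> \<open>The curvature cost is attached to left end points but \<open>occ\<close> counts
    right ones; the shift costs one cell, at most \<open>h\<close>.\<close>
  also have "(\<Sum>j<J. i j) \<le> h + (\<Sum>j<J. i (Suc j))"
  proof -
    have "(\<Sum>j<J. i j) \<le> (\<Sum>j<Suc J. i j)" using i0 by simp
    also have "\<dots> = i 0 + (\<Sum>j<J. i (Suc j))" by (rule sum.lessThan_Suc_shift)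
    finally show ?thesis using ih[of 0] by simp
  qed
  also have "(\<Sum>j<J. i (Suc j)) = occ h J (\<lambda>x. of_bool (p \<bullet> x \<le> 2 * \<delta>))"
    unfolding occ_def i_def ..
  also have "real J * h * g \<le> T * g" using J g0 by (intro mult_right_mono)
  finally have "occ h J (\<lambda>x. cap' \<delta> (p \<bullet> x) * (drift x \<bullet> p))
    \<le> (e J - e 0) + c * (h + occ h J (\<lambda>x. of_bool (p \<bullet> x \<le> 2 * \<delta>))) + T * g"
    using g0 by (simp add: mult_left_mono)
  then show ?thesis using e[of J] e[of 0] unfolding c_def g_def by linarith
qed

text \<open>The part of \<open>weight\<close> due to \<open>I\<close>, counted only when all walls
  of \<open>I\<close> are within \<delta>. For singletons these add up to
  \<open>tail\<close>.\<close>

definition near :: "'a set \<Rightarrow> real \<Rightarrow> 'a \<Rightarrow> real" where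
  "near I \<delta> x = of_bool (\<forall>\<alpha>\<in>I. \<alpha> \<bullet> x \<le> \<delta>) * (\<Sum>\<beta>\<in>I. 1 / (\<beta> \<bullet> x))"

definition tight :: "nat \<Rightarrow> 'a set \<Rightarrow> bool" where
  "tight T I \<longleftrightarrow> (\<forall>e>0. \<exists>\<delta>>0. \<exists>N. \<forall>n\<ge>N. occ (mesh n) (T * 2 ^ n) (near I \<delta>) \<le> e)"

lemma grid_time: "real (T * 2 ^ n) * mesh n = real T" by (simp add: mesh_def)

lemma of_bool_measurable:
  "(\<lambda>x. of_bool (\<forall>\<alpha>\<in>I. \<alpha> \<bullet> x \<le> \<delta>) :: real) \<in> borel_measurable borel"
proof -
  have "{x. \<forall>\<alpha>\<in>I. \<alpha> \<bullet> x \<le> \<delta>} = (\<Inter>\<alpha>\<in>I. {x. \<alpha> \<bullet> x \<le> \<delta>})" by auto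
  then have "closed {x. \<forall>\<alpha>\<in>I. \<alpha> \<bullet> x \<le> \<delta>}"
    by (auto intro!: closed_INT closed_Collect_le continuous_intros)
  then have "indicat_real {x. \<forall>\<alpha>\<in>I. \<alpha> \<bullet> x \<le> \<delta>} \<in> borel_measurable borel"
    by (intro borel_measurable_indicator borel_closed)
  moreover have "indicat_real {x. \<forall>\<alpha>\<in>I. \<alpha> \<bullet> x \<le> \<delta>} = (\<lambda>x. of_bool (\<forall>\<alpha>\<in>I. \<alpha> \<bullet> x \<le> \<delta>))"
    by (auto simp: indicator_def)
  ultimately show ?thesis by simp
qed

lemma partial_weight:
  assumes "I \<subseteq> S" "x \<in> C"
  shows "0 \<le> (\<Sum>\<beta>\<in>I. 1 / (\<beta> \<bullet> x))" "(\<Sum>\<beta>\<in>I. 1 / (\<beta> \<bullet> x)) \<le> weight x"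
  unfolding weight_def using assms C_D[OF assms(2)] fin
  by (auto intro!: sum_nonneg sum_mono2 simp: less_imp_le subset_iff)

lemma dominated_partial:
  assumes f: "f \<in> borel_measurable borel" "\<And>x. x \<in> C \<Longrightarrow> \<bar>f x\<bar> \<le> 1" and I: "I \<subseteq> S"
  shows "dominated (\<lambda>x. f x * (\<Sum>\<beta>\<in>I. 1 / (\<beta> \<bullet> x)))"
proof (rule dominated_weight)
  show "(\<lambda>x. f x * (\<Sum>\<beta>\<in>I. 1 / (\<beta> \<bullet> x))) \<in> borel_measurable borel" using f(1) by measurable
  fix x assume x: "x \<in> C"
  have "\<bar>f x * (\<Sum>\<beta>\<in>I. 1 / (\<beta> \<bullet> x))\<bar> \<le> 1 * weight x"
    unfolding abs_mult using f(2)[OF x] partial_weight[OF I x] by (intro mult_mono) auto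
  then show "\<bar>f x * (\<Sum>\<beta>\<in>I. 1 / (\<beta> \<bullet> x))\<bar> \<le> 1 * weight x" .
qed

lemma dominated_near: "I \<subseteq> S \<Longrightarrow> dominated (near I \<delta>)"
  unfolding near_def by (intro dominated_partial of_bool_measurable) auto

lemma near_mono: "I \<subseteq> S \<Longrightarrow> x \<in> C \<Longrightarrow> \<delta> \<le> \<delta>' \<Longrightarrow> near I \<delta> x \<le> near I \<delta>' x"
  unfolding near_def using partial_weight(1)[of I x] by (intro mult_right_mono) force+

text \<open>Testing with \<open>cap\<close> of \<open>p \<bullet> x\<close> bounds the drift of
  \<open>I\<close> near its face by the drift of the other roots there. If another wall \<beta> is
  close as well, the smaller face of \<open>insert \<beta> I\<close> takes over; if not, its drift
  is bounded and the time near the face is short. The curvature term is made small by choosing the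
  scale.\<close>

lemma tight_step:
  assumes I: "I \<subseteq> S" "I \<noteq> {}" and IH: "\<And>\<beta>. \<beta> \<in> S - I \<Longrightarrow> tight T (insert \<beta> I)"
  shows "tight T I"
  unfolding tight_def
proof (intro allI impI)
  fix e :: real assume e: "0 < e"
  have fI: "finite I" using I fin finite_subset by blast
  let ?J = "\<lambda>n. T * 2 ^ n" and ?D = "real DIM('a)"
  obtain c where c: "\<And>\<alpha>. \<alpha> \<in> I \<Longrightarrow> 0 < c \<alpha>" "\<And>\<beta>. \<beta> \<in> I \<Longrightarrow> 0 < (\<Sum>\<alpha>\<in>I. c \<alpha> *\<^sub>R \<alpha>) \<bullet> \<beta>"
    using dual_vector[OF I] by blast
  define p where "p = (\<Sum>\<alpha>\<in>I. c \<alpha> *\<^sub>R \<alpha>)"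
  have pe: "p \<bullet> x = (\<Sum>\<alpha>\<in>I. c \<alpha> * (\<alpha> \<bullet> x))" for x by (simp add: p_def inner_sum_left)
  have term_le: "c \<alpha> * (\<alpha> \<bullet> x) \<le> p \<bullet> x" if "\<alpha> \<in> I" "x \<in> C" for \<alpha> x
    unfolding pe using that c(1) C_D I fI by (intro member_le_sum) (auto simp: less_imp_le subset_iff)
  have px: "0 < p \<bullet> x" if "x \<in> C" for x
    unfolding pe using I c(1) C_D[OF that] by (intro sum_pos fI) auto
  obtain c0 where c0: "0 < c0" "\<And>\<alpha>. \<alpha> \<in> I \<Longrightarrow> c0 \<le> c \<alpha>" using finite_pos_lower_bound[OF fI, of c] c(1) by blast
  have y_le: "c0 * (\<alpha> \<bullet> x) \<le> p \<bullet> x" if "\<alpha> \<in> I" "x \<in> C" for \<alpha> x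
  proof -
    have "0 < \<alpha> \<bullet> x" using C_D[OF that(2)] I that(1) by auto
    then show ?thesis using order_trans[OF mult_right_mono[OF c0(2)[OF that(1)]] term_le[OF that]] by simp
  qed
  obtain \<alpha>0 where a0: "\<alpha>0 \<in> I" using I by blast
  have inv_p: "1 / (p \<bullet> x) \<le> 1 / c0 * weight x" if x: "x \<in> C" for x
  proof -
    have p0: "0 < \<alpha>0 \<bullet> x" using C_D[OF x] a0 I by auto
    have "1 / (p \<bullet> x) \<le> 1 / (c0 * (\<alpha>0 \<bullet> x))" using y_le[OF a0 x] p0 c0(1) by (intro frac_le) auto
    also have "\<dots> = 1 / c0 * (1 / (\<alpha>0 \<bullet> x))" by simp
    also have "\<dots> \<le> 1 / c0 * weight x" using inverse_le_weight[OF x] a0 I c0(1) by (intro mult_left_mono) auto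
    finally show ?thesis .
  qed
  obtain e0 where e0: "0 < e0" "\<And>\<beta>. \<beta> \<in> I \<Longrightarrow> e0 \<le> k \<beta> * (p \<bullet> \<beta>)"
    using finite_pos_lower_bound[OF fI, of "\<lambda>\<beta>. k \<beta> * (p \<bullet> \<beta>)"] c(2) k_pos I p_def by (metis mult_pos_pos subsetD)
  obtain A where A: "0 < A" "\<And>\<beta>. \<beta> \<in> S \<Longrightarrow> \<bar>k \<beta> * (p \<bullet> \<beta>)\<bar> \<le> A"
    using finite_upper_bound[OF fin, of "\<lambda>\<beta>. \<bar>k \<beta> * (p \<bullet> \<beta>)\<bar>"] by blast
  \<comment> \<open>By the choice of \<open>p\<close> the roots of \<open>I\<close> push in
    direction \<open>p\<close>. The others may pull against it, which costs at most \<open>A\<close>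
    times their reciprocals.\<close>
  have drift_lower: "e0 * (\<Sum>\<beta>\<in>I. 1 / (\<beta> \<bullet> x)) - A * (\<Sum>\<beta>\<in>S - I. 1 / (\<beta> \<bullet> x)) \<le> drift x \<bullet> p" if x: "x \<in> C" for x
  proof -
    have "drift x \<bullet> p = (\<Sum>\<beta>\<in>S - I. k \<beta> * (p \<bullet> \<beta>) / (\<beta> \<bullet> x)) + (\<Sum>\<beta>\<in>I. k \<beta> * (p \<bullet> \<beta>) / (\<beta> \<bullet> x))"
      unfolding drift_inner inner_commute[of p] by (rule sum.subset_diff[OF I(1) fin])
    moreover have "e0 * (\<Sum>\<beta>\<in>I. 1 / (\<beta> \<bullet> x)) \<le> (\<Sum>\<beta>\<in>I. k \<beta> * (p \<bullet> \<beta>) / (\<beta> \<bullet> x))"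
      unfolding sum_distrib_left using e0(2) C_D[OF x] I
      by (intro sum_mono) (auto intro!: divide_right_mono simp: less_imp_le subset_iff)
    moreover have "- (A * (\<Sum>\<beta>\<in>S - I. 1 / (\<beta> \<bullet> x))) \<le> (\<Sum>\<beta>\<in>S - I. k \<beta> * (p \<bullet> \<beta>) / (\<beta> \<bullet> x))"
      unfolding sum_distrib_left sum_negf[symmetric]
    proof (rule sum_mono)
      fix \<beta> assume b: "\<beta> \<in> S - I"
      have "- A / (\<beta> \<bullet> x) \<le> k \<beta> * (p \<bullet> \<beta>) / (\<beta> \<bullet> x)"
        using A(2)[of \<beta>] C_D[OF x, of \<beta>] b by (intro divide_right_mono) auto
      then show "- (A * (1 / (\<beta> \<bullet> x))) \<le> k \<beta> * (p \<bullet> \<beta>) / (\<beta> \<bullet> x)" by simp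
    qed
    ultimately show ?thesis by linarith
  qed
  obtain W where W: "0 < W" "\<And>h J. 0 < h \<Longrightarrow> real J * h \<le> real T \<Longrightarrow> occ h J weight \<le> W"
    using occ_weight_bounded[of "real T"] by blast
  define V where "V = W / c0"
  have V0: "0 < V" using W c0 by (simp add: V_def)
  have dom_inv: "dominated (\<lambda>x. 1 / (p \<bullet> x))"
  proof (rule dominated_weight)
    fix x assume x: "x \<in> C"
    show "\<bar>1 / (p \<bullet> x)\<bar> \<le> 1 / c0 * weight x" using inv_p[OF x] px[OF x] by simp
  qed measurable
  have dom_w: "dominated weight" by (rule dominated_weight[where c=1]) (use weight_nonneg in auto)
  have occ_inv: "occ (mesh n) (?J n) (\<lambda>x. 1 / (p \<bullet> x)) \<le> V" for n
  proof -
    have "occ (mesh n) (?J n) (\<lambda>x. 1 / (p \<bullet> x)) \<le> occ (mesh n) (?J n) (\<lambda>x. 1 / c0 * weight x)"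
      by (intro occ_mono mesh_pos dom_inv dominated_cmult dom_w inv_p)
    also have "\<dots> = 1 / c0 * occ (mesh n) (?J n) weight" by (rule occ_cmult)
    also have "\<dots> \<le> 1 / c0 * W" using c0 by (intro mult_left_mono W(2) mesh_pos eq_refl[OF grid_time]) auto
    finally show ?thesis by (simp add: V_def)
  qed
  \<comment> \<open>The final comparison reads \<open>e0 / 2\<close> times the quantity sought \<le>
    (4 + 2 A |S|) e'; this value turns it into the bound \<open>e\<close>.\<close>
  define e' where "e' = e0 * e / (2 * (4 + A * real (card S) * 2))"
  have den: "0 < 4 + A * real (card S) * 2" using A(1) by (simp add: add_pos_nonneg)
  have e': "0 < e'" using e0(1) e den by (simp add: e'_def)
  have "\<forall>\<beta>\<in>S - I. \<exists>\<delta>>0. \<exists>N. \<forall>n\<ge>N. occ (mesh n) (?J n) (near (insert \<beta> I) \<delta>) \<le> e'"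
    using IH e' unfolding tight_def by blast
  then obtain dl Nl where dN: "\<And>\<beta>. \<beta> \<in> S - I \<Longrightarrow> 0 < dl \<beta>"
    "\<And>\<beta> n. \<beta> \<in> S - I \<Longrightarrow> n \<ge> Nl \<beta> \<Longrightarrow> occ (mesh n) (?J n) (near (insert \<beta> I) (dl \<beta>)) \<le> e'"
    by metis
  have fSI: "finite (S - I)" using fin by simp
  obtain ds where ds: "0 < ds" "\<And>\<beta>. \<beta> \<in> S - I \<Longrightarrow> ds \<le> dl \<beta>" using finite_pos_lower_bound[OF fSI, of dl] dN(1) by blast
  define N1 where "N1 = Max (insert 0 (Nl ` (S - I)))"
  have N1: "Nl \<beta> \<le> N1" if "\<beta> \<in> S - I" for \<beta> unfolding N1_def using fSI that by (intro Max_ge) auto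
  \<comment> \<open>Largest scale used. The three bounds serve the term \<delta>/2 of the test
    inequality, the implication from \<open>p \<bullet> x \<le> \<eta>\<close> to
    \<open>\<alpha> \<bullet> x \<le> ds\<close> on \<open>I\<close>, and the drift of roots farther
    away than \<open>ds\<close>.\<close>
  define \<eta> where "\<eta> = min (min (2 * e') (ds * c0)) (e' * ds / V)"
  have eta: "0 < \<eta>" "\<eta> \<le> 2 * e'" "\<eta> \<le> ds * c0" "\<eta> * V / ds \<le> e'"
  proof -
    show "0 < \<eta>" "\<eta> \<le> 2 * e'" "\<eta> \<le> ds * c0" using e' ds(1) c0(1) V0 by (simp_all add: \<eta>_def)
    have "\<eta> \<le> e' * ds / V" by (simp add: \<eta>_def)
    then show "\<eta> * V / ds \<le> e'" using V0 ds(1) by (simp add: pos_le_divide_eq pos_divide_le_eq)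
  qed
  define K2 where "K2 = (norm p)\<^sup>2 * ?D / 2"
  have K2: "0 \<le> K2" by (simp add: K2_def)
  \<comment> \<open>Number of dyadic scales offered to the pigeonhole argument: the best one has
    curvature cost at most \<open>4 * V * K2 / real N0\<close>.\<close>
  obtain N0 :: nat where N0: "4 * V * K2 / e' < real N0" using reals_Archimedean2 by blast
  have N00: "0 < N0" using N0 V0 K2 e' by (metis divide_nonneg_pos gr0I less_imp_le mult_nonneg_nonneg not_less of_nat_0 zero_le_numeral)
  \<comment> \<open>Lies below every candidate scale. The scale selected later depends on
    \<open>n\<close>, so the conditions on the mesh and the final neighbourhood are fixed in terms
    of \<open>\<delta>m\<close>.\<close>
  define \<delta>m where "\<delta>m = \<eta> / 2 ^ N0"
  have dm: "0 < \<delta>m" using eta by (simp add: \<delta>m_def)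
  have "(\<lambda>n. K2 / \<delta>m * mesh n + real T * (3 * (norm p) ^ 4 * ?D\<^sup>2 * mesh n / (2 * \<delta>m ^ 3))) \<longlonglongrightarrow>
      K2 / \<delta>m * 0 + real T * (3 * (norm p) ^ 4 * ?D\<^sup>2 * 0 / (2 * \<delta>m ^ 3))"
    by (intro tendsto_intros mesh_tendsto_0) (use dm in auto)
  then have "\<forall>\<^sub>F n in sequentially. K2 / \<delta>m * mesh n + real T * (3 * (norm p) ^ 4 * ?D\<^sup>2 * mesh n / (2 * \<delta>m ^ 3)) < e'"
    using e' by (intro order_tendstoD) auto
  then obtain N2 where N2: "\<And>n. n \<ge> N2 \<Longrightarrow> K2 / \<delta>m * mesh n + real T * (3 * (norm p) ^ 4 * ?D\<^sup>2 * mesh n / (2 * \<delta>m ^ 3)) < e'"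
    unfolding eventually_sequentially by blast
  \<comment> \<open>Keeps \<open>p \<bullet> x\<close> below \<open>\<delta>m / 2\<close> whenever
    all walls of \<open>I\<close> are within \<open>\<delta>f\<close>, so that \<open>cap'\<close>
    is at least 1/2 at any candidate scale.\<close>
  define \<delta>f where "\<delta>f = \<delta>m / (2 * (1 + (\<Sum>\<alpha>\<in>I. c \<alpha>)))"
  have sc: "0 \<le> (\<Sum>\<alpha>\<in>I. c \<alpha>)" using c(1) by (intro sum_nonneg) (auto simp: less_imp_le)
  have df: "0 < \<delta>f" using dm sc by (simp add: \<delta>f_def)
  have main: "occ (mesh n) (?J n) (near I \<delta>f) \<le> e" if n: "n \<ge> max N1 N2" for n
  proof -
    let ?o = "occ (mesh n) (?J n)"
    note mp = mesh_pos[of n]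
    define d where "d i = \<eta> / 2 ^ i" for i
    have d: "0 < d i" "d i \<le> \<eta>" for i using eta by (auto simp: d_def field_simps)
    have dom_ind: "dominated (\<lambda>x. of_bool (p \<bullet> x \<le> \<gamma>))" for \<gamma>
      by (rule dominated_bounded[where c=1]) auto
    \<comment> \<open>Pigeonhole: pointwise the sum over all scales of the indicator of
      \<open>p \<bullet> x \<le> 2 * d i\<close> divided by \<open>d i\<close> is at most
      \<open>4 / (p \<bullet> x)\<close>, whose occupation integral is at most
      \<open>4 * V\<close>.\<close>
    have "\<exists>i<N0. ?o (\<lambda>x. of_bool (p \<bullet> x \<le> 2 * d i)) / d i \<le> 4 * V / real N0"
    proof (rule ccontr)
      assume "\<not> ?thesis"
      then have gt: "4 * V / real N0 < ?o (\<lambda>x. of_bool (p \<bullet> x \<le> 2 * d i)) / d i" if "i < N0" for i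
        using that by force
      have "4 * V = (\<Sum>i<N0. 4 * V / real N0)" using N00 by simp
      also have "\<dots> < (\<Sum>i<N0. ?o (\<lambda>x. of_bool (p \<bullet> x \<le> 2 * d i)) / d i)"
        using N00 gt by (intro sum_strict_mono) auto
      also have "\<dots> = (\<Sum>i<N0. ?o (\<lambda>x. 1 / d i * of_bool (p \<bullet> x \<le> 2 * d i)))"
        by (simp only: occ_cmult) simp
      also have "\<dots> = ?o (\<lambda>x. \<Sum>i<N0. 1 / d i * of_bool (p \<bullet> x \<le> 2 * d i))"
        by (intro occ_sum[symmetric] mp dominated_cmult dom_ind) auto
      also have "\<dots> \<le> ?o (\<lambda>x. 4 * (1 / (p \<bullet> x)))"
      proof (intro occ_mono mp dominated_sum dominated_cmult dom_ind dom_inv)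
        fix x assume x: "x \<in> C"
        have "1 / d i * of_bool (p \<bullet> x \<le> 2 * d i) = 1 / \<eta> * (2 ^ i * of_bool (2 ^ i \<le> 2 * \<eta> / (p \<bullet> x)))" for i
          using px[OF x] eta(1) by (simp add: d_def field_simps)
        then have "(\<Sum>i<N0. 1 / d i * of_bool (p \<bullet> x \<le> 2 * d i)) = 1 / \<eta> * (\<Sum>i<N0. 2 ^ i * of_bool (2 ^ i \<le> 2 * \<eta> / (p \<bullet> x)))"
          by (simp only: sum_distrib_left)
        also have "\<dots> \<le> 1 / \<eta> * (2 * (2 * \<eta> / (p \<bullet> x)))"
          using px[OF x] eta(1) by (intro mult_left_mono sum_dyadic_le) auto
        also have "\<dots> = 4 * (1 / (p \<bullet> x))" using eta(1) by simp
        finally show "(\<Sum>i<N0. 1 / d i * of_bool (p \<bullet> x \<le> 2 * d i)) \<le> 4 * (1 / (p \<bullet> x))" .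
      qed auto
      also have "\<dots> = 4 * ?o (\<lambda>x. 1 / (p \<bullet> x))" by (rule occ_cmult)
      also have "\<dots> \<le> 4 * V" using occ_inv by simp
      finally show False by simp
    qed
    then obtain i where i: "i < N0" "?o (\<lambda>x. of_bool (p \<bullet> x \<le> 2 * d i)) / d i \<le> 4 * V / real N0" by blast
    let ?d = "d i"
    have dmi: "\<delta>m \<le> ?d" unfolding \<delta>m_def d_def using i(1) eta(1) by (intro divide_left_mono) auto
    \<comment> \<open>For \<beta> outside \<open>I\<close>: where
      \<open>\<beta> \<bullet> x \<le> ds\<close>, the point is near the face of
      \<open>insert \<beta> I\<close> and the induction hypothesis applies. Elsewhere the reciprocal
      is at most \<open>1 / ds\<close>, hence at most \<open>?d / ds\<close> times
      \<open>1 / (p \<bullet> x)\<close> on the strip.\<close>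
    have other: "?o (\<lambda>x. of_bool (p \<bullet> x \<le> ?d) * (1 / (\<beta> \<bullet> x))) \<le> e' + e'" if b: "\<beta> \<in> S - I" for \<beta>
    proof -
      have bS: "\<beta> \<in> S" using b by simp
      have insS: "insert \<beta> I \<subseteq> S" using b I by auto
      have "?o (\<lambda>x. of_bool (p \<bullet> x \<le> ?d) * (1 / (\<beta> \<bullet> x))) \<le> ?o (\<lambda>x. near (insert \<beta> I) (dl \<beta>) x + ?d / ds * (1 / (p \<bullet> x)))"
      proof (intro occ_mono mp dominated_add dominated_near insS dominated_cmult dom_inv)
        show "dominated (\<lambda>x. of_bool (p \<bullet> x \<le> ?d) * (1 / (\<beta> \<bullet> x)))"
          using dominated_partial[of "\<lambda>x. of_bool (p \<bullet> x \<le> ?d)" "{\<beta>}"] bS by simp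
        fix x assume x: "x \<in> C"
        have y: "0 < \<beta> \<bullet> x" by (rule C_D[OF x bS])
        have nn: "0 \<le> near (insert \<beta> I) (dl \<beta>) x"
          unfolding near_def using partial_weight(1)[OF insS x] by (intro mult_nonneg_nonneg) auto
        have n2: "0 \<le> ?d / ds * (1 / (p \<bullet> x))" using d(1)[of i] ds(1) px[OF x] by simp
        show "of_bool (p \<bullet> x \<le> ?d) * (1 / (\<beta> \<bullet> x)) \<le> near (insert \<beta> I) (dl \<beta>) x + ?d / ds * (1 / (p \<bullet> x))"
        proof (cases "p \<bullet> x \<le> ?d")
          case False then show ?thesis using nn n2 by simp
        next
          case q: True
          show ?thesis
          proof (cases "\<beta> \<bullet> x \<le> ds")
            case True
            have "\<alpha> \<bullet> x \<le> dl \<beta>" if "\<alpha> \<in> insert \<beta> I" for \<alpha>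
            proof (cases "\<alpha> = \<beta>")
              case True then show ?thesis using \<open>\<beta> \<bullet> x \<le> ds\<close> ds(2)[OF b] by simp
            next
              case False
              then have aI: "\<alpha> \<in> I" using that by simp
              have "c0 * (\<alpha> \<bullet> x) \<le> c0 * ds" using y_le[OF aI x] q d(2)[of i] eta(3) by (simp add: mult.commute)
              then show ?thesis using c0(1) ds(2)[OF b] by simp
            qed
            then have "near (insert \<beta> I) (dl \<beta>) x = (\<Sum>\<gamma>\<in>insert \<beta> I. 1 / (\<gamma> \<bullet> x))" by (simp add: near_def)
            moreover have "1 / (\<beta> \<bullet> x) \<le> (\<Sum>\<gamma>\<in>insert \<beta> I. 1 / (\<gamma> \<bullet> x))"
              using fI insS C_D[OF x] by (intro member_le_sum) (auto simp: less_imp_le)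
            ultimately show ?thesis using n2 q by simp
          next
            case False
            have "1 / (\<beta> \<bullet> x) \<le> 1 / ds" using False ds(1) by (intro frac_le) auto
            also have "\<dots> \<le> ?d / ds * (1 / (p \<bullet> x))" using q px[OF x] ds(1) by (simp add: field_simps)
            finally show ?thesis using nn q by simp
          qed
        qed
      qed
      also have "\<dots> = ?o (near (insert \<beta> I) (dl \<beta>)) + ?d / ds * ?o (\<lambda>x. 1 / (p \<bullet> x))"
        by (simp only: occ_add[OF mp dominated_near[OF insS] dominated_cmult[OF dom_inv]] occ_cmult)
      also have "\<dots> \<le> e' + e'"
      proof (rule add_mono)
        show "?o (near (insert \<beta> I) (dl \<beta>)) \<le> e'" using n N1[OF b] by (intro dN(2)[OF b]) auto
        have "?d / ds * ?o (\<lambda>x. 1 / (p \<bullet> x)) \<le> \<eta> / ds * V"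
          using occ_inv[of n] d[of i] ds(1) px
          by (intro mult_mono divide_right_mono occ_nonneg[OF mp]) (auto simp: less_imp_le)
        also have "\<dots> \<le> e'" using eta(4) by simp
        finally show "?d / ds * ?o (\<lambda>x. 1 / (p \<bullet> x)) \<le> e'" .
      qed
      finally show ?thesis .
    qed
    let ?L = "\<lambda>x. e0 / 2 * near I \<delta>f x"
    let ?Q = "\<lambda>x. A * (\<Sum>\<beta>\<in>S - I. of_bool (p \<bullet> x \<le> ?d) * (1 / (\<beta> \<bullet> x)))"
    let ?P = "\<lambda>x. cap' ?d (p \<bullet> x) * (drift x \<bullet> p)"
    have domQ1: "dominated (\<lambda>x. of_bool (p \<bullet> x \<le> ?d) * (1 / (\<beta> \<bullet> x)))" if "\<beta> \<in> S - I" for \<beta>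
      using dominated_partial[of "\<lambda>x. of_bool (p \<bullet> x \<le> ?d)" "{\<beta>}"] that by simp
    have domQ: "dominated ?Q" by (intro dominated_cmult dominated_sum fSI domQ1)
    have domP: "dominated ?P"
    proof (rule dominated_drift_inner)
      show "(\<lambda>x. cap' ?d (p \<bullet> x)) \<in> borel_measurable borel" unfolding cap'_def by measurable
      fix x assume "x \<in> C"
      then show "\<bar>cap' ?d (p \<bullet> x)\<bar> \<le> 1" using cap'_bounds(1,2)[OF d(1)[of i], of "p \<bullet> x"] px[of x] by simp
    qed
    \<comment> \<open>\<open>?L\<close> is the drift of \<open>I\<close> near its face,
      \<open>?P\<close> the tested drift, and \<open>?Q\<close> compensates for the other roots on
      the support of the slope.\<close>
    have "?o ?L \<le> ?o (\<lambda>x. ?P x + ?Q x)"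
    proof (intro occ_mono mp dominated_cmult[OF dominated_near[OF I(1)]] dominated_add domP domQ)
      fix x assume x: "x \<in> C"
      let ?sI = "\<Sum>\<beta>\<in>I. 1 / (\<beta> \<bullet> x)" and ?sO = "\<Sum>\<beta>\<in>S - I. 1 / (\<beta> \<bullet> x)" and ?g = "cap' ?d (p \<bullet> x)"
      have sI: "0 \<le> ?sI" and sO: "0 \<le> ?sO" using partial_weight(1)[OF _ x] I by auto
      have g: "0 \<le> ?g" "?g \<le> of_bool (p \<bullet> x \<le> ?d)"
        using cap'_bounds(1,2,4)[OF d(1)[of i], of "p \<bullet> x"] px[OF x] by simp_all
      have "1 / 2 * near I \<delta>f x \<le> ?g * ?sI"
      proof (cases "\<forall>\<alpha>\<in>I. \<alpha> \<bullet> x \<le> \<delta>f")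
        case True
        have "p \<bullet> x \<le> (\<Sum>\<alpha>\<in>I. c \<alpha> * \<delta>f)"
          unfolding pe using True c(1) by (intro sum_mono mult_left_mono) (auto simp: less_imp_le)
        also have "\<dots> = (\<Sum>\<alpha>\<in>I. c \<alpha>) * \<delta>f" by (simp add: sum_distrib_right)
        also have "\<dots> \<le> (1 + (\<Sum>\<alpha>\<in>I. c \<alpha>)) * \<delta>f" using df by simp
        also have "\<dots> = \<delta>m / 2"
        proof -
          have "s * (\<delta>m / (2 * s)) = \<delta>m / 2" if "s \<noteq> 0" for s :: real using that by simp
          from this[of "1 + (\<Sum>\<alpha>\<in>I. c \<alpha>)"] sc show ?thesis unfolding \<delta>f_def by linarith
        qed
        also have "\<dots> \<le> ?d / 2" using dmi by simp
        finally have "1 / 2 \<le> ?g" by (rule cap'_bounds(3)[OF d(1)])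
        from mult_right_mono[OF this sI] True show ?thesis by (simp add: near_def)
      next
        case False
        then have "near I \<delta>f x = 0" by (auto simp: near_def)
        then show ?thesis using g sI by simp
      qed
      then have "e0 * (1 / 2 * near I \<delta>f x) \<le> e0 * (?g * ?sI)" using e0(1) by (intro mult_left_mono) auto
      also have "\<dots> = ?g * (e0 * ?sI - A * ?sO) + ?g * (A * ?sO)"
        by (simp add: right_diff_distrib mult.left_commute)
      also have "\<dots> \<le> ?P x + ?Q x"
      proof (rule add_mono)
        show "?g * (e0 * ?sI - A * ?sO) \<le> ?P x" using drift_lower[OF x] g(1) by (rule mult_left_mono)
        have "?g * (A * ?sO) \<le> of_bool (p \<bullet> x \<le> ?d) * (A * ?sO)" using g(2) A(1) sO by (intro mult_right_mono) auto
        also have "\<dots> = ?Q x" unfolding sum_distrib_left[symmetric] by (rule mult.left_commute)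
        finally show "?g * (A * ?sO) \<le> ?Q x" .
      qed
      finally show "?L x \<le> ?P x + ?Q x" by simp
    qed
    also have "\<dots> = ?o ?P + ?o ?Q" by (rule occ_add[OF mp domP domQ])
    also have "?o ?Q \<le> A * (real (card S) * (e' + e'))"
    proof -
      have "?o ?Q = A * (\<Sum>\<beta>\<in>S - I. ?o (\<lambda>x. of_bool (p \<bullet> x \<le> ?d) * (1 / (\<beta> \<bullet> x))))"
        unfolding occ_cmult by (simp only: occ_sum[OF mp fSI domQ1])
      also have "\<dots> \<le> A * (\<Sum>\<beta>\<in>S - I. e' + e')" using A(1) other by (intro mult_left_mono sum_mono) auto
      also have "\<dots> = A * (real (card (S - I)) * (e' + e'))" by simp
      also have "\<dots> \<le> A * (real (card S) * (e' + e'))"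
        using A(1) e' fin by (intro mult_left_mono mult_right_mono) (auto intro: card_mono)
      finally show ?thesis .
    qed
    also have "?o ?P \<le> 4 * e'"
    proof -
      have "?o ?P \<le> ?d / 2 + (norm p)\<^sup>2 * ?D / (2 * ?d) * (mesh n + ?o (\<lambda>x. of_bool (p \<bullet> x \<le> 2 * ?d)))
          + real T * (3 * (norm p) ^ 4 * ?D\<^sup>2 * mesh n / (2 * ?d ^ 3))"
        by (rule test_occ[OF mp d(1) _ eq_refl[OF grid_time]]) (rule less_imp_le[OF px])
      also have "(norm p)\<^sup>2 * ?D / (2 * ?d) * (mesh n + ?o (\<lambda>x. of_bool (p \<bullet> x \<le> 2 * ?d)))
          = K2 / ?d * mesh n + K2 * (?o (\<lambda>x. of_bool (p \<bullet> x \<le> 2 * ?d)) / ?d)"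
        by (simp add: K2_def distrib_left)
      also have "K2 / ?d * mesh n \<le> K2 / \<delta>m * mesh n"
        using K2 dm dmi mp by (intro mult_right_mono divide_left_mono mult_pos_pos) auto
      also have "real T * (3 * (norm p) ^ 4 * ?D\<^sup>2 * mesh n / (2 * ?d ^ 3))
          \<le> real T * (3 * (norm p) ^ 4 * ?D\<^sup>2 * mesh n / (2 * \<delta>m ^ 3))"
        using dm dmi mp by (intro mult_left_mono divide_left_mono mult_pos_pos power_mono) auto
      also have "K2 * (?o (\<lambda>x. of_bool (p \<bullet> x \<le> 2 * ?d)) / ?d) \<le> e'"
      proof -
        have "K2 * (?o (\<lambda>x. of_bool (p \<bullet> x \<le> 2 * ?d)) / ?d) \<le> K2 * (4 * V / real N0)"
          using i(2) K2 by (rule mult_left_mono)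
        also have "\<dots> = (4 * V * K2) / real N0" by simp
        also have "\<dots> \<le> e'" using N0 N00 e' by (simp add: pos_divide_less_eq pos_divide_le_eq mult.commute)
        finally show ?thesis .
      qed
      also have "?d / 2 \<le> e'" using d(2)[of i] eta(2) by simp
      finally show ?thesis using N2[of n] n e' by simp
    qed
    finally have "e0 / 2 * ?o (near I \<delta>f) \<le> 4 * e' + A * (real (card S) * (e' + e'))"
      by (simp only: occ_cmult)
    also have "\<dots> = (4 + A * real (card S) * 2) * e'" by (simp add: algebra_simps)
    also have "\<dots> = e0 / 2 * e"
    proof -
      have "s * (e0 * e / (2 * s)) = e0 / 2 * e" if "s \<noteq> 0" for s :: real using that by simp
      from this[OF less_imp_neq[OF den, symmetric]] show ?thesis unfolding e'_def .
    qed
    finally show ?thesis using e0(1) by simp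
  qed
  show "\<exists>\<delta>>0. \<exists>N. \<forall>n\<ge>N. occ (mesh n) (?J n) (near I \<delta>) \<le> e"
    using main df by blast
qed

text \<open>Downward induction on \<open>I\<close>, starting from \<open>I = S\<close>, where no
  further root can be inserted.\<close>

lemma tight_all: "I \<subseteq> S \<Longrightarrow> I \<noteq> {} \<Longrightarrow> tight T I"
proof (induction "card (S - I)" arbitrary: I rule: less_induct)
  case less
  show ?case
  proof (rule tight_step[OF less.prems])
    fix \<beta> assume b: "\<beta> \<in> S - I"
    have "card (S - insert \<beta> I) < card (S - I)"
      using b fin by (intro psubset_card_mono) auto
    then show "tight T (insert \<beta> I)" using b less.prems by (intro less.hyps) auto
  qed
qed

text \<open>Tightness of all singletons, with the smallest of the finitely many thresholds.\<close>

lemma tail_tight: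
  assumes e: "0 < e"
  shows "\<exists>\<delta>>0. \<exists>N. \<forall>n\<ge>N. occ (mesh n) (T * 2 ^ n) (tail \<delta>) \<le> e"
proof -
  define e' where "e' = e / (1 + real (card S))"
  have e': "0 < e'" "real (card S) * e' \<le> e" using e by (auto simp: e'_def field_simps)
  have "\<forall>\<beta>\<in>S. \<exists>\<delta>>0. \<exists>N. \<forall>n\<ge>N. occ (mesh n) (T * 2 ^ n) (near {\<beta>} \<delta>) \<le> e'"
    using tight_all e'(1) unfolding tight_def by blast
  then obtain dl Nl where dN: "\<And>\<beta>. \<beta> \<in> S \<Longrightarrow> 0 < dl \<beta>"
    "\<And>\<beta> n. \<beta> \<in> S \<Longrightarrow> n \<ge> Nl \<beta> \<Longrightarrow> occ (mesh n) (T * 2 ^ n) (near {\<beta>} (dl \<beta>)) \<le> e'"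
    by metis
  obtain ds where ds: "0 < ds" "\<And>\<beta>. \<beta> \<in> S \<Longrightarrow> ds \<le> dl \<beta>" using finite_pos_lower_bound[OF fin, of dl] dN(1) by blast
  define N where "N = Max (insert 0 (Nl ` S))"
  have N: "Nl \<beta> \<le> N" if "\<beta> \<in> S" for \<beta> unfolding N_def using fin that by (intro Max_ge) auto
  have "occ (mesh n) (T * 2 ^ n) (tail ds) \<le> e" if n: "n \<ge> N" for n
  proof -
    have eq: "tail ds = (\<lambda>x. \<Sum>\<beta>\<in>S. near {\<beta>} ds x)"
      by (rule ext) (auto simp: tail_def near_def intro!: sum.cong)
    have "occ (mesh n) (T * 2 ^ n) (tail ds) = (\<Sum>\<beta>\<in>S. occ (mesh n) (T * 2 ^ n) (near {\<beta>} ds))"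
      unfolding eq by (intro occ_sum mesh_pos fin dominated_near) auto
    also have "\<dots> \<le> (\<Sum>\<beta>\<in>S. e')"
    proof (rule sum_mono)
      fix \<beta> assume b: "\<beta> \<in> S"
      have "occ (mesh n) (T * 2 ^ n) (near {\<beta>} ds) \<le> occ (mesh n) (T * 2 ^ n) (near {\<beta>} (dl \<beta>))"
        using b ds(2)[OF b] by (intro occ_mono mesh_pos dominated_near near_mono) auto
      also have "\<dots> \<le> e'" using N[OF b] n by (intro dN(2)[OF b]) auto
      finally show "occ (mesh n) (T * 2 ^ n) (near {\<beta>} ds) \<le> e'" .
    qed
    also have "\<dots> \<le> e" using e'(2) by simp
    finally show ?thesis .
  qed
  with ds(1) show ?thesis by blast
qed

end

section \<open>Existence\<close>

context wall_repulsion
begin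

lemma tail_measurable [measurable]: "tail \<delta> \<in> borel_measurable borel"
  unfolding tail_def by measurable

lemma dominated_tail: "dominated (tail \<delta>)"
proof (rule dominated_weight)
  fix x assume x: "x \<in> C"
  have "tail \<delta> x \<le> weight x"
    unfolding tail_def weight_def using C_D[OF x] by (intro sum_mono) (auto simp: less_imp_le)
  then show "\<bar>tail \<delta> x\<bar> \<le> 1 * weight x" using tail_nonneg[OF x, of \<delta>] by simp
qed measurable

end

context repelled_path
begin

lemma flow_measurable: "(\<lambda>s. indicator {0..t} s *\<^sub>R flow s) \<in> borel_measurable borel"
  by (rule borel_measurable_continuous_on_indicator[OF _ continuous_on_subset[OF continuous_on_flow]]) auto

lemma flow_set_integrable:
  assumes t: "0 \<le> t"
  shows "set_integrable lborel {s\<in>{0..t}. flow s \<in> C} (\<lambda>s. grad (Phi k S) (flow s))"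
proof -
  let ?\<psi> = "\<lambda>s. indicator {0..t} s *\<^sub>R path_drift flow s"
  note [measurable] = flow_measurable[of t]
  have eq: "indicator {s\<in>{0..t}. flow s \<in> C} s *\<^sub>R grad (Phi k S) (flow s) = - ?\<psi> s" for s
    by (auto simp: indicator_def path_drift_def grad_Phi)
  \<comment> \<open>\<open>flow\<close> is only known to be continuous at nonnegative times, so
    Borel measurability is obtained after multiplying it by the indicator inside the argument as
    well.\<close>
  have "?\<psi> = (\<lambda>s. indicator {0..t} s *\<^sub>R (if indicator {0..t} s *\<^sub>R flow s \<in> C then drift (indicator {0..t} s *\<^sub>R flow s) else 0))"
    by (auto simp: indicator_def path_drift_def)
  also have "\<dots> \<in> borel_measurable borel" by measurable
  finally have m: "?\<psi> \<in> borel_measurable lborel" by simp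
  have "set_integrable lebesgue {0..t} (path_drift flow)" by (rule flow_drift_absolutely_integrable[OF t])
  then have "integrable lborel ?\<psi>"
    using integrable_completion[OF m] by (simp add: set_integrable_def)
  then show ?thesis unfolding set_integrable_def eq by simp
qed

end

context noisy_walls
begin

lemma integral_tail:
  "integral {0..real T} (\<lambda>s. tail \<delta> (eulerc (mesh n) (path \<omega>) s)) = (\<Sum>i<T * 2 ^ n. mesh n * tail \<delta> (X (mesh n) (Suc i) \<omega>))"
  using integral_eulerc[OF mesh_pos, of "T * 2 ^ n" n "tail \<delta>" "path \<omega>"] unfolding grid_time X_def by simp

text \<open>For levels \<open>d i\<close> with expected tail at most \<open>1 / real (Suc i)\<close>
  on all fine meshes, Fatou bounds the mean of the liminf by the same number. The infimum over
  \<open>i\<close> therefore has mean zero and vanishes almost surely, which gives smallness for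
  infinitely many meshes.\<close>

lemma AE_tail_fixed:
  "AE \<omega> in M. \<forall>e>0. \<exists>\<delta>>0. \<exists>\<^sub>F n in sequentially. integral {0..real T} (\<lambda>s. tail \<delta> (eulerc (mesh n) (path \<omega>) s)) \<le> e"
proof -
  have "\<forall>i. \<exists>\<delta>>0. \<exists>N. \<forall>n\<ge>N. occ (mesh n) (T * 2 ^ n) (tail \<delta>) \<le> 1 / real (Suc i)"
    by (intro allI tail_tight) simp
  then obtain d N where dN: "\<And>i. 0 < d i" "\<And>i n. n \<ge> N i \<Longrightarrow> occ (mesh n) (T * 2 ^ n) (tail (d i)) \<le> 1 / real (Suc i)"
    by metis
  define \<Theta> where "\<Theta> i n \<omega> = (\<Sum>j<T * 2 ^ n. mesh n * tail (d i) (X (mesh n) (Suc j) \<omega>))" for i n \<omega>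
  have ti: "integrable M (\<lambda>\<omega>. tail (d i) (X (mesh n) (Suc j) \<omega>))" for i n j
    by (rule dominated_integrable[OF mesh_pos dominated_tail])
  have \<Theta>i: "integrable M (\<Theta> i n)" for i n unfolding \<Theta>_def by (intro Bochner_Integration.integrable_sum integrable_mult_right ti)
  have \<Theta>0: "0 \<le> \<Theta> i n \<omega>" for i n \<omega>
    unfolding \<Theta>_def using mesh_pos by (intro sum_nonneg mult_nonneg_nonneg tail_nonneg X_in_C) (auto simp: less_imp_le)
  have \<Theta>e: "(\<integral>\<omega>. \<Theta> i n \<omega> \<partial>M) = occ (mesh n) (T * 2 ^ n) (tail (d i))" for i n
    unfolding \<Theta>_def occ_def using ti by (subst Bochner_Integration.integral_sum) auto
  have [measurable]: "\<Theta> i n \<in> borel_measurable M" for i n using \<Theta>i by (rule borel_measurable_integrable)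
  define G where "G i \<omega> = liminf (\<lambda>n. ennreal (\<Theta> i n \<omega>))" for i \<omega>
  have [measurable]: "G i \<in> borel_measurable M" for i unfolding G_def by measurable
  have Gle: "(\<integral>\<^sup>+\<omega>. G i \<omega> \<partial>M) \<le> ennreal (1 / real (Suc i))" for i
  proof -
    have "(\<integral>\<^sup>+\<omega>. G i \<omega> \<partial>M) \<le> liminf (\<lambda>n. \<integral>\<^sup>+\<omega>. ennreal (\<Theta> i n \<omega>) \<partial>M)"
      unfolding G_def by (rule nn_integral_liminf) measurable
    also have "\<dots> = liminf (\<lambda>n. ennreal (occ (mesh n) (T * 2 ^ n) (tail (d i))))"
      using nn_integral_eq_integral[OF \<Theta>i] \<Theta>0 by (simp add: \<Theta>e)
    also have "\<dots> \<le> ennreal (1 / real (Suc i))"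
    proof -
      have "\<forall>\<^sub>F n in sequentially. ennreal (occ (mesh n) (T * 2 ^ n) (tail (d i))) \<le> ennreal (1 / real (Suc i))"
        unfolding eventually_sequentially using dN(2)[of i, THEN ennreal_leI] by blast
      from Liminf_mono[OF this] show ?thesis unfolding Liminf_const[OF trivial_limit_sequentially] .
    qed
    finally show ?thesis .
  qed
  have "(\<integral>\<^sup>+\<omega>. (INF i. G i \<omega>) \<partial>M) = 0"
  proof -
    have "(\<integral>\<^sup>+\<omega>. (INF i. G i \<omega>) \<partial>M) \<le> ennreal (1 / real (Suc i))" for i
      by (rule order_trans[OF nn_integral_mono Gle]) (auto intro: INF_lower)
    moreover have "(\<lambda>i. ennreal (1 / real (Suc i))) \<longlonglongrightarrow> ennreal 0"
      by (intro tendsto_ennrealI LIMSEQ_Suc lim_1_over_n)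
    ultimately have "(\<integral>\<^sup>+\<omega>. (INF i. G i \<omega>) \<partial>M) \<le> ennreal 0"
      by (intro LIMSEQ_le_const) auto
    then show ?thesis by simp
  qed
  then have "AE \<omega> in M. (INF i. G i \<omega>) = 0"
    by (subst (asm) nn_integral_0_iff_AE) auto
  then show ?thesis
  proof (rule AE_mp, intro AE_I2 impI allI)
    fix \<omega> and e :: real assume 0: "(INF i. G i \<omega>) = 0" and e: "0 < e"
    have "(INF i. G i \<omega>) < ennreal e" unfolding 0 using e by simp
    then obtain i where i: "G i \<omega> < ennreal e" unfolding INF_less_iff by blast
    have "\<exists>\<^sub>F n in sequentially. \<Theta> i n \<omega> \<le> e"
    proof (rule ccontr)
      assume "\<not> ?thesis"
      then have "\<forall>\<^sub>F n in sequentially. ennreal e \<le> ennreal (\<Theta> i n \<omega>)"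
        unfolding not_frequently by (rule eventually_mono) (auto intro: ennreal_leI)
      then have "ennreal e \<le> G i \<omega>" unfolding G_def by (rule Liminf_bounded)
      with i show False by simp
    qed
    then have "\<exists>\<^sub>F n in sequentially. integral {0..real T} (\<lambda>s. tail (d i) (eulerc (mesh n) (path \<omega>) s)) \<le> e"
      unfolding integral_tail \<Theta>_def .
    then show "\<exists>\<delta>>0. \<exists>\<^sub>F n in sequentially. integral {0..real T} (\<lambda>s. tail \<delta> (eulerc (mesh n) (path \<omega>) s)) \<le> e"
      using dN(1) by blast
  qed
qed

lemma AE_flow_equation:
  "AE \<omega> in M. continuous_on {0..} (\<lambda>t. B t \<omega>) \<longrightarrow>
    (\<forall>t\<ge>0. repelled_path.flow S k (path \<omega>) t = path \<omega> t + integral {0..t} (path_drift (repelled_path.flow S k (path \<omega>))))"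
proof -
  have "AE \<omega> in M. \<forall>T. \<forall>e>0. \<exists>\<delta>>0. \<exists>\<^sub>F n in sequentially. integral {0..real T} (\<lambda>s. tail \<delta> (eulerc (mesh n) (path \<omega>) s)) \<le> e"
    unfolding AE_all_countable using AE_tail_fixed by blast
  then show ?thesis
  proof (rule AE_mp, intro AE_I2 impI allI)
    fix \<omega> t
    assume tight: "\<forall>T. \<forall>e>0. \<exists>\<delta>>0. \<exists>\<^sub>F n in sequentially. integral {0..real T} (\<lambda>s. tail \<delta> (eulerc (mesh n) (path \<omega>) s)) \<le> e"
      and c: "continuous_on {0..} (\<lambda>t. B t \<omega>)" and t: "0 \<le> (t::real)"
    interpret repelled_path S k "path \<omega>"
    proof unfold_locales
      show "continuous_on {0..} (path \<omega>)" unfolding path_def by (intro continuous_intros c)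
      show "path \<omega> 0 \<in> C" by (simp add: path_0 Z_in_C)
    qed
    show "flow t = path \<omega> t + integral {0..t} (path_drift flow)"
      by (rule flow_equation[OF _ t]) (use tight in blast)
  qed
qed

end

locale brownian_walls = wall_repulsion S k + filtered_brownian M F B
  for S :: "'a::euclidean_space set" and k :: "'a \<Rightarrow> real" and M :: "'w measure" and F and B :: "real \<Rightarrow> 'w \<Rightarrow> 'a" +
  fixes X0 :: "'w \<Rightarrow> 'a"
  assumes X0_adapted: "X0 \<in> borel_measurable (F 0)" and X0_in_C: "AE \<omega> in M. X0 \<omega> \<in> weyl_chamber S"
begin

definition input :: "'w \<Rightarrow> real \<Rightarrow> 'a" where
  "input \<omega> t = X0 \<omega> + (B t \<omega> - B 0 \<omega>)"

text \<open>Almost surely the equation holds simultaneously for all truncations of the initial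
  value, and a given \<omega> with \<open>X0 \<omega>\<close> in the chamber agrees with one of
  them.\<close>

lemma AE_equation:
  "AE \<omega> in M. X0 \<omega> \<in> C \<and> B 0 \<omega> = 0 \<and> continuous_on {0..} (\<lambda>t. B t \<omega>) \<and>
    (\<forall>t\<ge>0. repelled_path.flow S k (input \<omega>) t = input \<omega> t + integral {0..t} (path_drift (repelled_path.flow S k (input \<omega>))))"
proof -
  obtain a where a: "a \<in> C" using chamber_nonempty by blast
  \<comment> \<open>Values outside the chamber or too large are replaced by the interior point
    \<open>a\<close>, which keeps \<open>Z i\<close> bounded and in \<open>C\<close>
    everywhere.\<close>
  define Z where "Z i \<omega> = (if X0 \<omega> \<in> C \<and> norm (X0 \<omega>) \<le> real i then X0 \<omega> else a)" for i :: nat and \<omega>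
  have "AE \<omega> in M. continuous_on {0..} (\<lambda>t. B t \<omega>) \<longrightarrow>
    (\<forall>t\<ge>0. repelled_path.flow S k (\<lambda>t. Z i \<omega> + (B t \<omega> - B 0 \<omega>)) t
      = Z i \<omega> + (B t \<omega> - B 0 \<omega>) + integral {0..t} (path_drift (repelled_path.flow S k (\<lambda>t. Z i \<omega> + (B t \<omega> - B 0 \<omega>)))))" for i
  proof -
    note [measurable] = X0_adapted
    interpret noisy_walls S k M F B "Z i" "max (real i) (norm a)"
    proof unfold_locales
      show "Z i \<in> borel_measurable (F 0)" unfolding Z_def by measurable
      show "Z i \<omega> \<in> C" "norm (Z i \<omega>) \<le> max (real i) (norm a)" for \<omega> using a by (auto simp: Z_def)
    qed
    have p: "path \<omega> = (\<lambda>t. Z i \<omega> + (B t \<omega> - B 0 \<omega>))" for \<omega> by (rule ext) (simp add: path_def)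
    from AE_flow_equation show ?thesis unfolding p .
  qed
  then have "AE \<omega> in M. \<forall>i. continuous_on {0..} (\<lambda>t. B t \<omega>) \<longrightarrow>
    (\<forall>t\<ge>0. repelled_path.flow S k (\<lambda>t. Z i \<omega> + (B t \<omega> - B 0 \<omega>)) t
      = Z i \<omega> + (B t \<omega> - B 0 \<omega>) + integral {0..t} (path_drift (repelled_path.flow S k (\<lambda>t. Z i \<omega> + (B t \<omega> - B 0 \<omega>)))))"
    unfolding AE_all_countable by blast
  moreover have "AE \<omega> in M. B 0 \<omega> = 0" "AE \<omega> in M. continuous_on {0..} (\<lambda>t. B t \<omega>)"
    using brownian unfolding brownian_motion_def by blast+
  ultimately show ?thesis using X0_in_C
  proof eventually_elim
    fix \<omega>
    assume eqs: "\<forall>i. continuous_on {0..} (\<lambda>t. B t \<omega>) \<longrightarrow>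
        (\<forall>t\<ge>0. repelled_path.flow S k (\<lambda>t. Z i \<omega> + (B t \<omega> - B 0 \<omega>)) t
        = Z i \<omega> + (B t \<omega> - B 0 \<omega>) + integral {0..t} (path_drift (repelled_path.flow S k (\<lambda>t. Z i \<omega> + (B t \<omega> - B 0 \<omega>)))))"
      and b: "B 0 \<omega> = 0" "continuous_on {0..} (\<lambda>t. B t \<omega>)" "X0 \<omega> \<in> C"
    obtain i :: nat where "norm (X0 \<omega>) \<le> real i" using real_arch_simple by blast
    then have "(\<lambda>t. Z i \<omega> + (B t \<omega> - B 0 \<omega>)) = input \<omega>" using b(3) by (auto simp: Z_def input_def)
    with eqs b show "X0 \<omega> \<in> C \<and> B 0 \<omega> = 0 \<and> continuous_on {0..} (\<lambda>t. B t \<omega>) \<and>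
      (\<forall>t\<ge>0. repelled_path.flow S k (input \<omega>) t = input \<omega> t + integral {0..t} (path_drift (repelled_path.flow S k (input \<omega>))))"
      by metis
  qed
qed

lemma space_generated: "space (generated_filtration M X0 B t) = space M"
  unfolding generated_filtration_def by (rule space_measure_of) auto

lemma sets_generated:
  "sets (generated_filtration M X0 B t) = sigma_sets (space M)
     ({X0 -` A \<inter> space M | A. A \<in> sets borel} \<union>
      {B s -` A \<inter> space M | s A. 0 \<le> s \<and> s \<le> t \<and> A \<in> sets borel})"
  unfolding generated_filtration_def by (rule sets_measure_of) auto

lemma space_augmented: "space (augmented M (generated_filtration M X0 B) t) = space M"
  unfolding augmented_def by (rule space_measure_of_conv)

lemma sets_augmented:
  assumes t: "0 \<le> t"
  shows "sets (generated_filtration M X0 B t) \<subseteq> sets (augmented M (generated_filtration M X0 B) t)"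
    and "null_sets M \<subseteq> sets (augmented M (generated_filtration M X0 B) t)"
proof -
  have "sets (generated_filtration M X0 B t) \<union> null_sets M \<subseteq> Pow (space M)"
    using sets.sets_into_space[of _ "generated_filtration M X0 B t"] sets.sets_into_space[of _ M] space_generated[of t] by auto
  then have "sets (augmented M (generated_filtration M X0 B) t) = sigma_sets (space M) (sets (generated_filtration M X0 B t) \<union> null_sets M)"
    unfolding augmented_def by (rule sets_measure_of)
  then show "sets (generated_filtration M X0 B t) \<subseteq> sets (augmented M (generated_filtration M X0 B) t)"
    "null_sets M \<subseteq> sets (augmented M (generated_filtration M X0 B) t)" by auto
qed

lemma generated_measurable:
  shows "X0 \<in> borel_measurable (generated_filtration M X0 B t)"
    and "0 \<le> s \<Longrightarrow> s \<le> t \<Longrightarrow> B s \<in> borel_measurable (generated_filtration M X0 B t)"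
  unfolding measurable_def space_generated sets_generated by (auto intro!: sigma_sets.Basic)

text \<open>The flow depends on \<omega> only through \<open>X0\<close> and the past of
  \<open>B\<close>, being a pointwise limit of scheme values at grid times not exceeding
  \<open>t\<close>. The exceptional null set belongs to the augmented filtration.\<close>

lemma strong_solution_exists:
  "\<exists>X. strong_solution M C (grad (Phi k S)) X0 B X"
proof -
  let ?A = "augmented M (generated_filtration M X0 B)"
  let ?good = "\<lambda>\<omega>. X0 \<omega> \<in> C \<and> B 0 \<omega> = 0 \<and> continuous_on {0..} (\<lambda>t. B t \<omega>) \<and>
    (\<forall>t\<ge>0. repelled_path.flow S k (input \<omega>) t = input \<omega> t + integral {0..t} (path_drift (repelled_path.flow S k (input \<omega>))))"
  obtain a where a: "a \<in> C" using chamber_nonempty by blast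
  obtain N where N: "N \<in> null_sets M" "\<And>\<omega>. \<omega> \<in> space M \<Longrightarrow> \<omega> \<notin> N \<Longrightarrow> ?good \<omega>"
    using AE_equation unfolding eventually_ae_filter by auto
  \<comment> \<open>Continuity and values in the closed chamber are demanded for every \<omega>, so
    the process is set to the constant \<open>a\<close> on the null set.\<close>
  define X where "X t \<omega> = (if \<omega> \<in> N then a else repelled_path.flow S k (input \<omega>) t)" for t \<omega>
  have rp: "repelled_path S k (input \<omega>)" if "\<omega> \<in> space M" "\<omega> \<notin> N" for \<omega>
  proof unfold_locales
    show "continuous_on {0..} (input \<omega>)" unfolding input_def using N(2)[OF that] by (intro continuous_intros) auto
    show "input \<omega> 0 \<in> C" using N(2)[OF that] by (simp add: input_def)
  qed
  have "strong_solution M C (grad (Phi k S)) X0 B X"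
    unfolding strong_solution_def sde_solution_def
  proof (intro conjI allI impI ballI)
    fix t :: real assume t: "0 \<le> t"
    let ?g = "\<lambda>n \<omega>. if \<omega> \<in> N then a else euler (mesh n) (input \<omega>) (nat \<lfloor>t / mesh n\<rfloor>)"
    have NA: "N \<in> sets (?A t)" using sets_augmented(2)[OF t] N(1) by blast
    have sub: "f \<in> borel_measurable (generated_filtration M X0 B t) \<Longrightarrow> f \<in> borel_measurable (?A t)" for f :: "'w \<Rightarrow> 'a"
      using sets_augmented(1)[OF t] unfolding measurable_def space_generated space_augmented by auto
    have "?g n \<in> borel_measurable (?A t)" for n
    proof -
      have "(\<lambda>\<omega>. euler (mesh n) (input \<omega>) (nat \<lfloor>t / mesh n\<rfloor>)) \<in> borel_measurable (?A t)"
      proof (rule sub, rule euler_measurable[OF mesh_pos])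
        fix i assume "i \<le> nat \<lfloor>t / mesh n\<rfloor>"
        then have "real i \<le> t / mesh n" using t mesh_pos[of n] by (simp add: le_nat_iff le_floor_iff)
        then have i: "0 \<le> real i * mesh n" "real i * mesh n \<le> t" using mesh_pos[of n] by (simp_all add: pos_le_divide_eq)
        note [measurable] = generated_measurable(1)[of t] generated_measurable(2)[OF i] generated_measurable(2)[OF order_refl t]
        show "(\<lambda>\<omega>. input \<omega> (real i * mesh n)) \<in> borel_measurable (generated_filtration M X0 B t)"
          unfolding input_def by measurable
      qed
      moreover have "N \<inter> space M = N" using N(1) sets.sets_into_space by blast
      ultimately show ?thesis using NA by (intro measurable_If_set) (auto simp: space_augmented)
    qed
    moreover have "(\<lambda>n. ?g n \<omega>) \<longlonglongrightarrow> X t \<omega>" if "\<omega> \<in> space (?A t)" for \<omega>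
      using repelled_path.euler_floor_tendsto[OF rp, of \<omega> t] that t by (cases "\<omega> \<in> N") (auto simp: X_def space_augmented)
    ultimately show "X t \<in> borel_measurable (?A t)" by (rule borel_measurable_LIMSEQ_metric)
  next
    fix \<omega> assume w: "\<omega> \<in> space M"
    show "continuous_on {0..} (\<lambda>t. X t \<omega>)"
      unfolding X_def using repelled_path.continuous_on_flow[OF rp[OF w]] by (cases "\<omega> \<in> N") auto
    show "X t \<omega> \<in> closure C" if "0 \<le> t" for t
    proof (cases "\<omega> \<in> N")
      case True
      then show ?thesis using a closure_subset by (auto simp: X_def)
    next
      case False
      then show ?thesis using repelled_path.flow_in_closure[OF rp[OF w False] that] by (simp add: X_def)
    qed
  next
    show "AE \<omega> in M. \<forall>t\<ge>0. set_integrable lborel {s \<in> {0..t}. X s \<omega> \<in> C} (\<lambda>s. grad (Phi k S) (X s \<omega>)) \<and>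
      X t \<omega> = X0 \<omega> + B t \<omega> - (LINT s:{s \<in> {0..t}. X s \<omega> \<in> C}|lborel. grad (Phi k S) (X s \<omega>))"
    proof (rule AE_I'[OF N(1)], rule subsetI, rule ccontr)
      fix \<omega> assume bad: "\<omega> \<in> {\<omega> \<in> space M. \<not> (\<forall>t\<ge>0. set_integrable lborel {s \<in> {0..t}. X s \<omega> \<in> C} (\<lambda>s. grad (Phi k S) (X s \<omega>)) \<and>
          X t \<omega> = X0 \<omega> + B t \<omega> - (LINT s:{s \<in> {0..t}. X s \<omega> \<in> C}|lborel. grad (Phi k S) (X s \<omega>)))}"
        and "\<omega> \<notin> N"
      from bad have w: "\<omega> \<in> space M" by blast
      interpret repelled_path S k "input \<omega>" by (rule rp[OF w \<open>\<omega> \<notin> N\<close>])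
      have X: "X s \<omega> = flow s" for s using \<open>\<omega> \<notin> N\<close> by (simp add: X_def)
      have "\<forall>t\<ge>0. set_integrable lborel {s \<in> {0..t}. X s \<omega> \<in> C} (\<lambda>s. grad (Phi k S) (X s \<omega>)) \<and>
        X t \<omega> = X0 \<omega> + B t \<omega> - (LINT s:{s \<in> {0..t}. X s \<omega> \<in> C}|lborel. grad (Phi k S) (X s \<omega>))"
        unfolding X using flow_set_integrable path_drift_lborel(2)[OF flow_set_integrable] N(2)[OF w \<open>\<omega> \<notin> N\<close>] by (auto simp: input_def)
      with bad show False by blast
    qed
  qed
  then show ?thesis by blast
qed

end

section \<open>Uniqueness\<close>

text \<open>After the shift the integrals of \<open>V\<close> over the overlap cancel, leaving two
  intervals of length \<open>u\<close> at the ends.\<close>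

lemma integral_increment_le:
  fixes V :: "real \<Rightarrow> real"
  assumes T: "0 \<le> T" and u: "0 \<le> u" "u \<le> 1" and V: "continuous_on {0..} V"
    and mono: "\<And>s t. 0 \<le> s \<Longrightarrow> s \<le> t \<Longrightarrow> V s \<le> V t"
  shows "integral {0..T} (\<lambda>s. V (s + u) - V s) \<le> u * (V (T + 1) - V 0)"
proof -
  have Vi: "V integrable_on {a..b}" if "0 \<le> a" for a b
    by (rule integrable_continuous_interval[OF continuous_on_subset[OF V]]) (use that in auto)
  have shift: "((\<lambda>s. V (s + u)) has_integral integral {u..T + u} V) {0..T}"
    using has_integral_shift_real_ivl[OF integrable_integral[OF Vi[OF u(1), of "T + u"]], of u] by simp
  have "integral {0..T} (\<lambda>s. V (s + u) - V s) = integral {u..T + u} V - integral {0..T} V"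
    using integral_diff[OF has_integral_integrable[OF shift] Vi[of 0 T]] integral_unique[OF shift] by simp
  also have "\<dots> = integral {T..T + u} V - integral {0..u} V"
    using Henstock_Kurzweil_Integration.integral_combine[of 0 u "T + u" V] Henstock_Kurzweil_Integration.integral_combine[of 0 T "T + u" V]
      Vi[of 0 "T + u"] T u by simp
  also have "\<dots> \<le> u * V (T + 1) - u * V 0"
  proof (rule diff_mono)
    have "integral {T..T + u} V \<le> integral {T..T + u} (\<lambda>s. V (T + 1))"
      using T u by (intro integral_le Vi mono) auto
    then show "integral {T..T + u} V \<le> u * V (T + 1)" using u by simp
    have "integral {0..u} (\<lambda>s. V 0) \<le> integral {0..u} V"
      using u by (intro integral_le Vi mono) auto
    then show "u * V 0 \<le> integral {0..u} V" using u by simp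
  qed
  finally show ?thesis by (simp add: algebra_simps)
qed

text \<open>Markov's inequality for \<open>V (s + u) - V s\<close>; the bound is of order 1/K
  uniformly in the step \<open>u\<close>.\<close>

lemma measure_large_increment_le:
  fixes V :: "real \<Rightarrow> real"
  assumes T: "0 \<le> T" and u: "0 < u" "u \<le> 1" and K: "0 < K" and V: "continuous_on {0..} V"
    and mono: "\<And>s t. 0 \<le> s \<Longrightarrow> s \<le> t \<Longrightarrow> V s \<le> V t"
  shows "{s\<in>{0..T}. K * u < V (s + u) - V s} \<in> lmeasurable"
    and "measure lebesgue {s\<in>{0..T}. K * u < V (s + u) - V s} \<le> (V (T + 1) - V 0) / K"
proof -
  let ?B = "{s\<in>{0..T}. K * u < V (s + u) - V s}"
  have c: "continuous_on {0..T} (\<lambda>s. V (s + u) - V s)"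
    using u by (intro continuous_on_diff continuous_on_compose2[OF V] continuous_on_subset[OF V] continuous_intros) auto
  have "{s\<in>{0..T}. V (s + u) - V s \<le> K * u} \<in> lmeasurable"
    by (rule lmeasurable_compact[OF compact_sublevel[OF c]])
  then have "{0..T} - {s\<in>{0..T}. V (s + u) - V s \<le> K * u} \<in> lmeasurable"
    by (intro fmeasurable.Diff) auto
  moreover have eq: "?B = {0..T} - {s\<in>{0..T}. V (s + u) - V s \<le> K * u}" by auto
  ultimately show lm: "?B \<in> lmeasurable" by simp
  have sub: "?B \<inter> {0..T} = ?B" by auto
  have ind: "indicat_real ?B integrable_on {0..T}"
    using integrable_on_indicator[of ?B "{0..T}"] lm unfolding sub by simp
  have "K * u * measure lebesgue ?B = integral {0..T} (\<lambda>s. K * u * indicat_real ?B s)"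
    using Equivalence_Lebesgue_Henstock_Integration.integral_indicator[of ?B "{0..T}"] lm unfolding sub by simp
  also have "\<dots> \<le> integral {0..T} (\<lambda>s. V (s + u) - V s)"
  proof (rule integral_le)
    show "(\<lambda>s. K * u * indicat_real ?B s) integrable_on {0..T}" by (rule integrable_on_mult_right[OF ind])
    show "(\<lambda>s. V (s + u) - V s) integrable_on {0..T}" by (rule integrable_continuous_interval[OF c])
    fix s assume s: "s \<in> {0..T}"
    show "K * u * indicat_real ?B s \<le> V (s + u) - V s"
    proof (cases "s \<in> ?B")
      case True
      then have "K * u < V (s + u) - V s" by blast
      with True show ?thesis by simp
    next
      case False
      then show ?thesis using s mono[of s "s + u"] u by simp
    qed
  qed
  also have "\<dots> \<le> u * (V (T + 1) - V 0)" using u by (intro integral_increment_le[OF T _ _ V mono]) auto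
  finally have "K * u * measure lebesgue ?B \<le> u * (V (T + 1) - V 0)" .
  then have "u * (measure lebesgue ?B * K) \<le> u * (V (T + 1) - V 0)" by (simp only: ac_simps)
  from mult_left_le_imp_le[OF this u(1)]
  show "measure lebesgue ?B \<le> (V (T + 1) - V 0) / K" unfolding pos_le_divide_eq[OF K] .
qed

text \<open>Shifting a set of positive measure by a small amount changes little of it, so on most of the zero
  set the increments of \<open>W\<close> are those of a path of bounded variation, hence of order \<open>u\<close>.\<close>

lemma negligible_zero_set:
  fixes Y W V :: "real \<Rightarrow> real"
  assumes T: "0 \<le> T" and Y: "continuous_on {0..} Y" and W: "continuous_on {0..} W" and V: "continuous_on {0..} V"
    and mono: "\<And>s t. 0 \<le> s \<Longrightarrow> s \<le> t \<Longrightarrow> V s \<le> V t"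
    and incr: "\<And>s t. 0 \<le> s \<Longrightarrow> s \<le> t \<Longrightarrow> \<bar>(Y t - W t) - (Y s - W s)\<bar> \<le> V t - V s"
    and small: "\<And>(K :: nat) e. 0 < e \<Longrightarrow>
      \<exists>\<^sub>F n in sequentially. measure lebesgue {s\<in>{0..T}. \<bar>W (s + mesh n) - W s\<bar> \<le> real K * mesh n} \<le> e"
  shows "negligible {s\<in>{0..T}. Y s = 0}"
proof (rule ccontr)
  let ?Z = "{s\<in>{0..T}. Y s = 0}"
  define m where "m = measure lebesgue ?Z"
  assume nn: "\<not> negligible ?Z"
  have "continuous_on {0..T} (\<lambda>s. \<bar>Y s\<bar>)"
    by (intro continuous_on_rabs continuous_on_subset[OF Y]) auto
  from compact_sublevel[OF this, of 0] have comp: "compact ?Z" by simp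
  have lm: "?Z \<in> lmeasurable" by (rule lmeasurable_compact[OF comp])
  then have "m \<noteq> 0" using nn unfolding m_def negligible_iff_measure by blast
  then have m: "0 < m" unfolding m_def by (simp only: zero_less_measure_iff not_False_eq_True)
  then have m4: "0 < m / 4" by simp
  \<comment> \<open>Outer regularity allows an excess of \<open>m / 4\<close>; compactness then
    gives a distance \<open>d\<close> by which the zero set can be shifted without leaving
    \<open>U\<close>.\<close>
  obtain U where U: "open U" "?Z \<subseteq> U" "emeasure lborel (U - ?Z) < m / 4"
    by (rule outer_regular_lborel[OF borel_closed[OF compact_imp_closed[OF comp]] m4])
  obtain d where d: "0 < d" "(\<Union>x\<in>?Z. ball x d) \<subseteq> U"
    by (rule compact_subset_open_imp_ball_epsilon_subset[OF comp U(1,2)])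
  have UZ: "U - ?Z \<in> sets borel" using U(1) compact_imp_closed[OF comp] by (intro sets.Diff borel_open borel_closed)
  have "U - ?Z \<in> sets lborel" using UZ by (simp only: sets_lborel)
  then have UZe: "emeasure lebesgue (U - ?Z) < m / 4" using U(3)
  proof -
    have "emeasure lebesgue A = emeasure lborel A" if "A \<in> sets lborel" for A :: "real set" using that by simp
    from this[OF \<open>U - ?Z \<in> sets lborel\<close>] U(3) show ?thesis by (rule ord_eq_less_trans)
  qed
  have UZlm: "U - ?Z \<in> lmeasurable"
  proof (rule fmeasurableI)
    show "U - ?Z \<in> sets lebesgue" using \<open>U - ?Z \<in> sets lborel\<close> by (rule sets_completionI_sets)
    show "emeasure lebesgue (U - ?Z) < \<infinity>" using UZe by (rule less_trans) simp
  qed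
  have UZm: "measure lebesgue (U - ?Z) \<le> m / 4"
  proof -
    have "x \<le> y" if "ennreal x < ennreal y" "0 \<le> x" for x y
      using that by (simp add: ennreal_less_iff less_imp_le)
    from this[OF UZe[unfolded emeasure_eq_measure2[OF UZlm]] measure_nonneg] show ?thesis .
  qed
  \<comment> \<open>Makes the set \<open>?B\<close> of times at which \<open>V\<close> grows by more
    than \<open>real K * u\<close> of measure at most \<open>m / 4\<close>.\<close>
  obtain K :: nat where K: "4 * (V (T + 1) - V 0) / m < real K" using reals_Archimedean2 by blast
  have VT: "V 0 \<le> V (T + 1)" using T by (intro mono) auto
  have K0: "0 < real K" using K m VT by (smt (verit) divide_nonneg_pos)
  have "\<forall>\<^sub>F n in sequentially. mesh n < d" using d(1) mesh_tendsto_0 by (intro order_tendstoD)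
  then obtain N where N: "\<And>n. n \<ge> N \<Longrightarrow> mesh n < d" unfolding eventually_sequentially by blast
  obtain n where n: "n \<ge> N" "measure lebesgue {s\<in>{0..T}. \<bar>W (s + mesh n) - W s\<bar> \<le> real K * mesh n} \<le> m / 4"
    using small[OF m4, of K] unfolding frequently_sequentially by blast
  define u where "u = mesh n"
  have u: "0 < u" "u \<le> 1" "u < d" using N[OF n(1)] mesh_pos mesh_le_1 by (auto simp: u_def)
  let ?G = "{s\<in>{0..T}. \<bar>W (s + u) - W s\<bar> \<le> real K * u}"
  let ?B = "{s\<in>{0..T}. real K * u < V (s + u) - V s}"
  let ?Zu = "(+) (- u) ` ?Z"
  have "continuous_on {0..T} (\<lambda>s. \<bar>W (s + u) - W s\<bar>)"
    using u by (intro continuous_on_rabs continuous_on_diff continuous_on_compose2[OF W] continuous_on_subset[OF W] continuous_intros) auto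
  then have Glm: "?G \<in> lmeasurable" by (rule lmeasurable_compact[OF compact_sublevel])
  note B = measure_large_increment_le[OF T u(1,2) K0 V mono]
  have Bm: "measure lebesgue ?B \<le> m / 4"
  proof -
    have "4 * (V (T + 1) - V 0) < real K * m" using K m by (simp add: pos_divide_less_eq)
    then have "V (T + 1) - V 0 \<le> real K * m / 4" by simp
    also have "\<dots> = m / 4 * real K" by simp
    finally have "(V (T + 1) - V 0) / real K \<le> m / 4" unfolding pos_divide_le_eq[OF K0] .
    with B(2) show ?thesis by (rule order_trans)
  qed
  have Zulm: "?Zu \<in> lmeasurable" and Zum: "measure lebesgue ?Zu = m"
    unfolding m_def by (rule measurable_translation[OF lm], rule measure_translation)
  have ZuU: "?Zu - ?Z \<subseteq> U - ?Z"
  proof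
    fix x assume x: "x \<in> ?Zu - ?Z"
    then obtain z where z: "z \<in> ?Z" "x = - u + z" by auto
    then have "x \<in> ball z d" using u by (auto simp: dist_real_def)
    with z d(2) x show "x \<in> U - ?Z" by blast
  qed
  \<comment> \<open>On the overlap \<open>Y\<close> vanishes at both \<open>s\<close> and
    \<open>s + u\<close>, so the increment of \<open>W\<close> is at most that of \<open>V\<close>:
    either it is small, or \<open>V\<close> has a large increment. Together with the part shifted
    off the zero set, three sets of measure at most \<open>m / 4\<close> would cover measure
    \<open>m\<close>.\<close>
  have sub: "?Zu \<inter> ?Z \<subseteq> ?G \<union> ?B"
  proof
    fix s assume s: "s \<in> ?Zu \<inter> ?Z"
    then have s1: "s \<in> {0..T}" "Y s = 0" "Y (s + u) = 0" by auto
    have "\<bar>W (s + u) - W s\<bar> \<le> V (s + u) - V s" using incr[of s "s + u"] s1 u by simp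
    with s1 show "s \<in> ?G \<union> ?B" by auto
  qed
  have "m = measure lebesgue ((?Zu - ?Z) \<union> (?Zu \<inter> ?Z))"
  proof -
    have "(A - B) \<union> (A \<inter> B) = A" for A B :: "real set" by blast
    then show ?thesis by (simp only: Zum)
  qed
  also have "\<dots> \<le> measure lebesgue (?Zu - ?Z) + measure lebesgue (?Zu \<inter> ?Z)"
    using Zulm lm by (intro measure_Un_le) auto
  also have "measure lebesgue (?Zu - ?Z) \<le> measure lebesgue (U - ?Z)"
    using Zulm lm UZlm by (intro measure_mono_fmeasurable[OF ZuU]) auto
  also have "measure lebesgue (?Zu \<inter> ?Z) \<le> measure lebesgue (?G \<union> ?B)"
    using Zulm lm Glm B(1) by (intro measure_mono_fmeasurable[OF sub]) (auto intro: fmeasurable.Un)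
  also have "\<dots> \<le> measure lebesgue ?G + measure lebesgue ?B"
    using Glm B(1) by (intro measure_Un_le) auto
  finally have "m \<le> measure lebesgue (U - ?Z) + (measure lebesgue ?G + measure lebesgue ?B)" by linarith
  moreover have "measure lebesgue ?G \<le> m / 4" using n(2) unfolding u_def .
  ultimately show False using UZm Bm m by linarith
qed

section \<open>Brownian increments are rarely as small as the time step\<close>

context filtered_brownian
begin

text \<open>By scaling with \<open>sqrt (mesh n)\<close> the event concerns a standard Gaussian
  vector in the slab \<open>A n\<close>. The slabs shrink to a hyperplane, which is a null set, so
  the probabilities tend to zero at a rate independent of \<open>s\<close>.\<close>

lemma increment_small_ball:
  assumes a: "\<alpha> \<noteq> 0"
  shows "\<exists>\<pi>. \<pi> \<longlonglongrightarrow> 0 \<and> (\<forall>n s. 0 \<le> s \<longrightarrow>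
    emeasure M {\<omega>\<in>space M. \<bar>\<alpha> \<bullet> (B (s + mesh n) \<omega> - B s \<omega>)\<bar> \<le> real K * mesh n} \<le> ennreal (\<pi> n))"
proof -
  let ?g = "\<lambda>y::'a. \<Prod>b\<in>Basis. normal_density 0 1 (y \<bullet> b)"
  have gm[measurable]: "?g \<in> borel_measurable borel" by measurable
  define \<mu> where "\<mu> = density lborel (\<lambda>y. ennreal (?g y))"
  have g1: "(\<integral>\<^sup>+y. ennreal (?g y) \<partial>lborel) = 1"
  proof -
    have "(\<integral>\<^sup>+y. ennreal (?g y) \<partial>lborel) = (\<integral>\<^sup>+y. (\<Prod>b\<in>Basis. ennreal (normal_density 0 1 (y \<bullet> (b :: 'a)))) \<partial>lborel)"
      by (simp add: prod_ennreal)
    also have "\<dots> = (\<Prod>b\<in>(Basis::'a set). \<integral>\<^sup>+y. ennreal (normal_density 0 1 y) \<partial>lborel)"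
      by (rule nn_integral_lborel_prod) auto
    also have "(\<integral>\<^sup>+y. ennreal (normal_density 0 1 y) \<partial>lborel) = 1"
      using prob_space.emeasure_space_1[OF prob_space_normal_density[of 1 0]] by (simp add: emeasure_density)
    finally show ?thesis by simp
  qed
  interpret \<mu>: prob_space \<mu>
    by (rule prob_spaceI) (simp add: \<mu>_def emeasure_density g1)
  define A where "A n = {y::'a. \<bar>\<alpha> \<bullet> y\<bar> \<le> real K * sqrt (mesh n)}" for n
  have Ab[measurable]: "A n \<in> sets borel" for n
    unfolding A_def by (intro borel_closed closed_Collect_le continuous_intros)
  have "(\<lambda>n. measure \<mu> (A n)) \<longlonglongrightarrow> measure \<mu> (\<Inter>n. A n)"
  proof (rule \<mu>.finite_Lim_measure_decseq)
    show "range A \<subseteq> sets \<mu>" using Ab by (auto simp: \<mu>_def)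
    have "mesh (Suc n) \<le> mesh n" for n by (simp add: mesh_def field_simps)
    then have "real K * sqrt (mesh (Suc n)) \<le> real K * sqrt (mesh n)" for n by (simp add: mult_left_mono)
    then show "decseq A" unfolding A_def by (intro decseq_SucI) (auto intro: order_trans)
  qed
  moreover have "measure \<mu> (\<Inter>n. A n) = 0"
  proof -
    have sub: "(\<Inter>n. A n) \<subseteq> {y. \<alpha> \<bullet> y = 0}"
    proof
      fix y assume "y \<in> (\<Inter>n. A n)"
      then have y: "\<bar>\<alpha> \<bullet> y\<bar> \<le> real K * sqrt (mesh n)" for n by (auto simp: A_def)
      have "(\<lambda>n. real K * sqrt (mesh n)) \<longlonglongrightarrow> real K * sqrt 0" by (intro tendsto_intros mesh_tendsto_0)
      then have "\<bar>\<alpha> \<bullet> y\<bar> \<le> real K * sqrt 0" using y by (intro LIMSEQ_le_const) auto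
      then show "y \<in> {y. \<alpha> \<bullet> y = 0}" by simp
    qed
    have hb: "{y. \<alpha> \<bullet> y = 0} \<in> sets borel" by (intro borel_closed closed_Collect_eq continuous_intros)
    have "{y. \<alpha> \<bullet> y = 0} \<in> null_sets lebesgue"
      using negligible_hyperplane[of \<alpha> 0] a unfolding negligible_iff_null_sets by blast
    then have "{y. \<alpha> \<bullet> y = 0} \<in> null_sets lborel"
      using null_sets_completion_iff[of "{y. \<alpha> \<bullet> y = 0}" lborel] hb by (simp only: sets_lborel)
    moreover have "absolutely_continuous lborel \<mu>"
      unfolding \<mu>_def by (rule absolutely_continuousI_density) measurable
    ultimately have null: "{y. \<alpha> \<bullet> y = 0} \<in> null_sets \<mu>" unfolding absolutely_continuous_def by blast
    have "(\<Inter>n. A n) \<in> sets \<mu>" using Ab by (auto simp: \<mu>_def)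
    then have "(\<Inter>n. A n) \<in> null_sets \<mu>" using sub by (intro null_sets_subset[OF null])
    then show ?thesis by (auto simp: measure_eq_0_null_sets)
  qed
  ultimately have lim: "(\<lambda>n. measure \<mu> (A n)) \<longlonglongrightarrow> 0" by simp
  moreover have "emeasure M {\<omega>\<in>space M. \<bar>\<alpha> \<bullet> (B (s + mesh n) \<omega> - B s \<omega>)\<bar> \<le> real K * mesh n} \<le> ennreal (measure \<mu> (A n))"
    if s: "0 \<le> s" for n s
  proof -
    define c where "c = sqrt (mesh n)"
    have c: "0 < c" "c * c = mesh n" using mesh_pos[of n] by (auto simp: c_def)
    let ?D = "\<lambda>\<omega>. B (s + mesh n) \<omega> - B s \<omega>"
    let ?E = "{x::'a. \<bar>\<alpha> \<bullet> x\<bar> \<le> real K * mesh n}"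
    let ?f = "\<lambda>x. ennreal (\<Prod>b\<in>Basis. normal_density 0 c (x \<bullet> b))"
    have Eb[measurable]: "?E \<in> sets borel" by (intro borel_closed closed_Collect_le continuous_intros)
    have st: "s < s + mesh n" using mesh_pos[of n] by simp
    have dist: "distributed M lborel ?D ?f" using increment_distributed[OF s st] by (simp add: c_def)
    have Dm[measurable]: "?D \<in> borel_measurable M" by (rule increment_measurable[OF s st])
    have "emeasure M {\<omega>\<in>space M. \<bar>\<alpha> \<bullet> ?D \<omega>\<bar> \<le> real K * mesh n} = emeasure (distr M lborel ?D) ?E"
      by (subst emeasure_distr) (auto simp: vimage_def Int_def conj_commute)
    also have "\<dots> = (\<integral>\<^sup>+x. ?f x * indicator ?E x \<partial>lborel)"
      unfolding distributed_distr_eq_density[OF dist] by (subst emeasure_density) auto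
    \<comment> \<open>Substitution x = c y with c = \<open>sqrt (mesh n)\<close>, whose Jacobian is
      absorbed by the Gaussian density.\<close>
    also have "\<dots> = (\<integral>\<^sup>+x. ?f x * indicator ?E x \<partial>density (distr lborel borel (\<lambda>x. 0 + c *\<^sub>R x)) (\<lambda>_. ennreal (\<bar>c\<bar> ^ DIM('a))))"
      using lborel_affine[of c "0::'a"] c by simp
    also have "\<dots> = (\<integral>\<^sup>+y. ennreal (\<bar>c\<bar> ^ DIM('a)) * (?f (c *\<^sub>R y) * indicator ?E (c *\<^sub>R y)) \<partial>lborel)"
      by (subst nn_integral_density) (auto simp: nn_integral_distr)
    also have "\<dots> = (\<integral>\<^sup>+y. ennreal (?g y) * indicator (A n) y \<partial>lborel)"
    proof (intro nn_integral_cong)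
      fix y :: 'a
      have "normal_density 0 c (c * t) = normal_density 0 1 t / c" for t
        using c(1) by (simp add: normal_density_def real_sqrt_mult power_mult_distrib)
      then have "(\<Prod>b\<in>Basis. normal_density 0 c ((c *\<^sub>R y) \<bullet> b)) = ?g y / c ^ DIM('a)"
        by (simp add: prod_dividef)
      then have 1: "\<bar>c\<bar> ^ DIM('a) * (\<Prod>b\<in>Basis. normal_density 0 c ((c *\<^sub>R y) \<bullet> b)) = ?g y" using c(1) by simp
      have 2: "ennreal (\<bar>c\<bar> ^ DIM('a)) * ?f (c *\<^sub>R y) = ennreal (?g y)"
        unfolding 1[symmetric] by (rule ennreal_mult[symmetric]) (auto intro: prod_nonneg)
      have e1: "\<bar>\<alpha> \<bullet> (c *\<^sub>R y)\<bar> = c * \<bar>\<alpha> \<bullet> y\<bar>" using c(1) by (simp add: abs_mult)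
      have e2: "real K * mesh n = c * (real K * c)" unfolding c(2)[symmetric] by (simp only: ac_simps)
      have "c *\<^sub>R y \<in> ?E \<longleftrightarrow> c * \<bar>\<alpha> \<bullet> y\<bar> \<le> c * (real K * c)" by (simp only: mem_Collect_eq e1 e2)
      also have "\<dots> \<longleftrightarrow> \<bar>\<alpha> \<bullet> y\<bar> \<le> real K * c" by (rule mult_le_cancel_left_pos[OF c(1)])
      also have "\<dots> \<longleftrightarrow> y \<in> A n" by (simp add: A_def c_def)
      finally have 3: "indicator ?E (c *\<^sub>R y) = (indicator (A n) y :: ennreal)" by (simp add: indicator_def)
      show "ennreal (\<bar>c\<bar> ^ DIM('a)) * (?f (c *\<^sub>R y) * indicator ?E (c *\<^sub>R y)) = ennreal (?g y) * indicator (A n) y"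
        unfolding 3 mult.assoc[symmetric] 2 ..
    qed
    also have "\<dots> = emeasure \<mu> (A n)" unfolding \<mu>_def by (subst emeasure_density) auto
    also have "\<dots> = ennreal (measure \<mu> (A n))" by (rule \<mu>.emeasure_eq_measure)
    finally show ?thesis by simp
  qed
  ultimately show ?thesis by blast
qed

text \<open>Joint measurability follows by approximating with the values at the next dyadic time,
  each approximation taking countably many of the variables \<open>Y t\<close>.\<close>

lemma continuous_version_measurable:
  fixes Y :: "real \<Rightarrow> 'w \<Rightarrow> 'a"
  assumes m: "\<And>t. 0 \<le> t \<Longrightarrow> Y t \<in> borel_measurable M"
    and c: "\<And>\<omega>. \<omega> \<in> space M \<Longrightarrow> continuous_on {0..} (\<lambda>t. Y t \<omega>)"
  shows "(\<lambda>(\<omega>, s). Y (max 0 s) \<omega>) \<in> borel_measurable (M \<Otimes>\<^sub>M lborel)"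
proof -
  let ?i = "\<lambda>n s. nat \<lceil>max 0 s / mesh n\<rceil>"
  let ?f = "\<lambda>n p. Y (real (?i n (snd p)) * mesh n) (fst p)"
  have "?f n \<in> borel_measurable (M \<Otimes>\<^sub>M lborel)" for n
  proof (rule measurable_compose_countable[where f="\<lambda>i p. Y (real i * mesh n) (fst p)" and g="\<lambda>p. ?i n (snd p)"])
    fix i :: nat
    have "Y (real i * mesh n) \<in> borel_measurable M" using mesh_pos[of n] by (intro m) simp
    then show "(\<lambda>p. Y (real i * mesh n) (fst p)) \<in> borel_measurable (M \<Otimes>\<^sub>M lborel)"
      by (rule measurable_compose[OF measurable_fst])
    show "(\<lambda>p. ?i n (snd p)) \<in> measurable (M \<Otimes>\<^sub>M lborel) (count_space UNIV)" by measurable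
  qed
  moreover have "(\<lambda>n. ?f n p) \<longlonglongrightarrow> (\<lambda>(\<omega>, s). Y (max 0 s) \<omega>) p" if p: "p \<in> space (M \<Otimes>\<^sub>M lborel)" for p
  proof -
    obtain s \<omega> where p': "p = (\<omega>, s)" "\<omega> \<in> space M" using p by (auto simp: space_pair_measure)
    let ?s = "max 0 s"
    have b: "?s \<le> real (?i n s) * mesh n" "real (?i n s) * mesh n \<le> ?s + mesh n" for n
    proof -
      have e: "real (?i n s) = of_int \<lceil>?s / mesh n\<rceil>" using mesh_pos[of n] by (simp add: less_imp_le)
      have "?s / mesh n \<le> of_int \<lceil>?s / mesh n\<rceil>" by (rule le_of_int_ceiling)
      then have 1: "?s \<le> of_int \<lceil>?s / mesh n\<rceil> * mesh n" by (simp only: pos_divide_le_eq[OF mesh_pos])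
      have "of_int \<lceil>?s / mesh n\<rceil> * mesh n \<le> (?s / mesh n + 1) * mesh n"
        using of_int_ceiling_le_add_one[of "?s / mesh n"] mesh_pos[of n] by (intro mult_right_mono) auto
      also have "\<dots> = ?s + mesh n" using mesh_pos[of n] by (simp add: distrib_right)
      finally show "?s \<le> real (?i n s) * mesh n" "real (?i n s) * mesh n \<le> ?s + mesh n" using 1 unfolding e by auto
    qed
    have "(\<lambda>n. real (?i n s) * mesh n) \<longlonglongrightarrow> ?s"
    proof (rule tendsto_sandwich[of "\<lambda>n. ?s" _ _ "\<lambda>n. ?s + mesh n"])
      show "(\<lambda>n. ?s + mesh n) \<longlonglongrightarrow> ?s" using tendsto_add[OF tendsto_const mesh_tendsto_0, of ?s] by simp
    qed (use b in auto)
    moreover have "\<forall>\<^sub>F n in sequentially. real (?i n s) * mesh n \<in> {0..}"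
      unfolding atLeast_iff by (intro always_eventually allI mult_nonneg_nonneg of_nat_0_le_iff less_imp_le[OF mesh_pos])
    moreover have "?s \<in> {0..}" by simp
    ultimately have "(\<lambda>n. Y (real (?i n s) * mesh n) \<omega>) \<longlonglongrightarrow> Y ?s \<omega>"
      by (intro continuous_on_tendsto_compose[OF c[OF p'(2)]])
    then show ?thesis by (simp add: p'(1))
  qed
  ultimately show ?thesis by (rule borel_measurable_LIMSEQ_metric)
qed

text \<open>By Tonelli the expected measure of these times is at most
  \<open>\<pi> n * real T\<close>, which tends to zero. Fatou makes the liminf vanish almost surely,
  which is the stated frequency in \<open>n\<close>.\<close>

lemma AE_small_increments_fixed:
  assumes a: "\<alpha> \<noteq> 0"
  shows "AE \<omega> in M. \<forall>e>0. \<exists>\<^sub>F n in sequentially.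
    measure lebesgue {s\<in>{0..real T}. \<bar>\<alpha> \<bullet> B (s + mesh n) \<omega> - \<alpha> \<bullet> B s \<omega>\<bar> \<le> real K * mesh n} \<le> e"
proof -
  obtain \<pi> where \<pi>: "\<pi> \<longlonglongrightarrow> 0" "\<And>n s. 0 \<le> s \<Longrightarrow>
    emeasure M {\<omega>\<in>space M. \<bar>\<alpha> \<bullet> (B (s + mesh n) \<omega> - B s \<omega>)\<bar> \<le> real K * mesh n} \<le> ennreal (\<pi> n)"
    using increment_small_ball[OF a] by blast
  have "AE \<omega> in M. continuous_on {0..} (\<lambda>t. B t \<omega>)" using brownian unfolding brownian_motion_def by blast
  then obtain N where N: "N \<in> null_sets M" "\<And>\<omega>. \<omega> \<in> space M \<Longrightarrow> \<omega> \<notin> N \<Longrightarrow> continuous_on {0..} (\<lambda>t. B t \<omega>)"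
    unfolding eventually_ae_filter by auto
  \<comment> \<open>Zero on the null set of discontinuous paths, so that the lemma on joint
    measurability applies to every \<omega>.\<close>
  define Y where "Y t \<omega> = (if \<omega> \<in> N then 0 else B t \<omega>)" for t \<omega>
  have NM: "N \<in> sets M" "N \<inter> space M = N" using N(1) sets.sets_into_space by blast+
  have Ym: "Y t \<in> borel_measurable M" if "0 \<le> t" for t
    unfolding Y_def using B_measurable[OF that] NM by (intro measurable_If_set) auto
  have Yc: "continuous_on {0..} (\<lambda>t. Y t \<omega>)" if "\<omega> \<in> space M" for \<omega>
    unfolding Y_def using N(2)[OF that] by (cases "\<omega> \<in> N") auto
  define p where "p = (\<lambda>(\<omega>, s). Y (max 0 s) \<omega>)"
  have pm[measurable]: "p \<in> borel_measurable (M \<Otimes>\<^sub>M lborel)"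
    unfolding p_def by (rule continuous_version_measurable[OF Ym Yc])
  define f where "f n \<omega> s = (if s \<in> {0..real T} \<and> \<bar>\<alpha> \<bullet> (p (\<omega>, s + mesh n) - p (\<omega>, s))\<bar> \<le> real K * mesh n then 1 else 0 :: ennreal)" for n \<omega> s
  have fm: "case_prod (f n) \<in> borel_measurable (M \<Otimes>\<^sub>M lborel)" for n
  proof -
    have [measurable]: "(\<lambda>q. p (fst q, snd q + mesh n)) \<in> borel_measurable (M \<Otimes>\<^sub>M lborel)"
      by (rule measurable_compose[OF _ pm]) measurable
    have "(\<lambda>q. if snd q \<in> {0..real T} \<and> \<bar>\<alpha> \<bullet> (p (fst q, snd q + mesh n) - p q)\<bar> \<le> real K * mesh n then 1 else 0 :: ennreal)
        \<in> borel_measurable (M \<Otimes>\<^sub>M lborel)" by measurable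
    moreover have "case_prod (f n) = (\<lambda>q. if snd q \<in> {0..real T} \<and> \<bar>\<alpha> \<bullet> (p (fst q, snd q + mesh n) - p q)\<bar> \<le> real K * mesh n then 1 else 0 :: ennreal)"
      by (auto simp: f_def)
    ultimately show ?thesis by simp
  qed
  define L where "L n \<omega> = (\<integral>\<^sup>+s. f n \<omega> s \<partial>lborel)" for n \<omega>
  have Lm[measurable]: "L n \<in> borel_measurable M" for n
    unfolding L_def by (rule lborel.borel_measurable_nn_integral[OF fm])
  interpret pair_sigma_finite M lborel ..
  have EL: "(\<integral>\<^sup>+\<omega>. L n \<omega> \<partial>M) \<le> ennreal (\<pi> n) * ennreal (real T)" for n
  proof -
    have "(\<integral>\<^sup>+\<omega>. L n \<omega> \<partial>M) = (\<integral>\<^sup>+s. (\<integral>\<^sup>+\<omega>. f n \<omega> s \<partial>M) \<partial>lborel)"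
      unfolding L_def by (rule Fubini'[OF fm, symmetric])
    also have "\<dots> \<le> (\<integral>\<^sup>+s. ennreal (\<pi> n) * indicator {0..real T} s \<partial>lborel)"
    proof (rule nn_integral_mono)
      fix s :: real
      show "(\<integral>\<^sup>+\<omega>. f n \<omega> s \<partial>M) \<le> ennreal (\<pi> n) * indicator {0..real T} s"
      proof (cases "s \<in> {0..real T}")
        case False
        then have "f n \<omega> s = 0" for \<omega> unfolding f_def by auto
        then show ?thesis by simp
      next
        case True
        then have s: "0 \<le> s" by simp
        let ?E = "{\<omega>\<in>space M. \<bar>\<alpha> \<bullet> (B (s + mesh n) \<omega> - B s \<omega>)\<bar> \<le> real K * mesh n}"
        have D: "(\<lambda>\<omega>. B (s + mesh n) \<omega> - B s \<omega>) \<in> borel_measurable M"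
          using mesh_pos[of n] s by (intro increment_measurable) auto
        have E: "?E \<in> sets M" using D by measurable
        have "(\<integral>\<^sup>+\<omega>. f n \<omega> s \<partial>M) = (\<integral>\<^sup>+\<omega>. indicator ?E \<omega> \<partial>M)"
        proof (rule nn_integral_cong_AE, rule AE_I'[OF N(1)], rule subsetI, rule ccontr)
          fix \<omega> assume bad: "\<omega> \<in> {\<omega> \<in> space M. f n \<omega> s \<noteq> indicator ?E \<omega>}" and "\<omega> \<notin> N"
          have "p (\<omega>, s + mesh n) = B (s + mesh n) \<omega>" "p (\<omega>, s) = B s \<omega>"
            using \<open>\<omega> \<notin> N\<close> s mesh_pos[of n] by (simp_all add: p_def Y_def max_def)
          then have "f n \<omega> s = indicator ?E \<omega>" using True bad unfolding f_def indicator_def by auto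
          with bad show False by blast
        qed
        also have "\<dots> = emeasure M ?E" using E by (rule nn_integral_indicator)
        also have "\<dots> \<le> ennreal (\<pi> n)" by (rule \<pi>(2)[OF s])
        finally show ?thesis using True by simp
      qed
    qed
    also have "\<dots> = ennreal (\<pi> n) * ennreal (real T)" by (simp add: nn_integral_cmult_indicator)
    finally show ?thesis .
  qed
  define G where "G \<omega> = liminf (\<lambda>n. L n \<omega>)" for \<omega>
  have Gm[measurable]: "G \<in> borel_measurable M" unfolding G_def by measurable
  have "(\<integral>\<^sup>+\<omega>. G \<omega> \<partial>M) \<le> liminf (\<lambda>n. \<integral>\<^sup>+\<omega>. L n \<omega> \<partial>M)"
    unfolding G_def by (rule nn_integral_liminf) (rule Lm)
  also have "\<dots> \<le> liminf (\<lambda>n. ennreal (\<pi> n) * ennreal (real T))"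
    using EL by (intro Liminf_mono always_eventually allI)
  also have "\<dots> = 0"
  proof -
    have "(\<lambda>n. ennreal (\<pi> n) * ennreal (real T)) \<longlonglongrightarrow> ennreal 0 * ennreal (real T)"
      by (intro ennreal_tendsto_cmult[of "ennreal (real T)", unfolded mult.commute[of "ennreal (real T)"]] tendsto_ennrealI \<pi>(1)) simp
    then show ?thesis using lim_imp_Liminf[OF trivial_limit_sequentially] by simp
  qed
  finally have "AE \<omega> in M. G \<omega> = 0" using nn_integral_0_iff_AE[OF Gm] by simp
  moreover have "AE \<omega> in M. \<omega> \<notin> N" by (rule AE_not_in[OF N(1)])
  ultimately show ?thesis
  proof (rule AE_mp[OF _ AE_mp], intro AE_I2 impI allI)
    fix \<omega> and e :: real assume w: "\<omega> \<in> space M" and wN: "\<omega> \<notin> N" and G0: "G \<omega> = 0" and e: "0 < e"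
    let ?A = "\<lambda>n. {s\<in>{0..real T}. \<bar>\<alpha> \<bullet> B (s + mesh n) \<omega> - \<alpha> \<bullet> B s \<omega>\<bar> \<le> real K * mesh n}"
    have c: "continuous_on {0..} (\<lambda>t. B t \<omega>)" by (rule N(2)[OF w wN])
    have "compact (?A n)" for n
      using mesh_pos[of n]
      by (intro compact_sublevel continuous_on_rabs continuous_on_diff continuous_on_inner continuous_on_const
          continuous_on_compose2[OF c] continuous_on_subset[OF c] continuous_intros) auto
    then have lm: "?A n \<in> lmeasurable" and bo: "?A n \<in> sets borel" for n
      by (auto intro: lmeasurable_compact borel_compact)
    have L: "L n \<omega> = ennreal (measure lebesgue (?A n))" for n
    proof -
      have "L n \<omega> = (\<integral>\<^sup>+s. indicator (?A n) s \<partial>lborel)"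
        unfolding L_def
      proof (rule nn_integral_cong)
        fix s :: real
        show "f n \<omega> s = indicator (?A n) s"
          using wN mesh_pos[of n] by (auto simp: f_def p_def Y_def indicator_def inner_diff_right max_def)
      qed
      also have "\<dots> = emeasure lborel (?A n)" by (rule nn_integral_indicator) (simp only: sets_lborel bo)
      also have "\<dots> = emeasure lebesgue (?A n)"
      proof -
        have "emeasure lborel A = emeasure lebesgue A" if "A \<in> sets borel" for A :: "real set" using that by simp
        then show ?thesis using bo by blast
      qed
      also have "\<dots> = ennreal (measure lebesgue (?A n))" by (rule emeasure_eq_measure2[OF lm])
      finally show ?thesis .
    qed
    show "\<exists>\<^sub>F n in sequentially. measure lebesgue (?A n) \<le> e"
    proof (rule ccontr)
      assume "\<not> ?thesis"
      then have "\<forall>\<^sub>F n in sequentially. ennreal e \<le> L n \<omega>"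
        unfolding not_frequently L by (rule eventually_mono) (intro ennreal_leI, linarith)
      then have "ennreal e \<le> G \<omega>" unfolding G_def by (rule Liminf_bounded)
      with G0 e show False by simp
    qed
  qed
qed

lemma AE_small_increments:
  assumes "\<alpha> \<noteq> 0"
  shows "AE \<omega> in M. \<forall>T K :: nat. \<forall>e>0. \<exists>\<^sub>F n in sequentially.
    measure lebesgue {s\<in>{0..real T}. \<bar>\<alpha> \<bullet> B (s + mesh n) \<omega> - \<alpha> \<bullet> B s \<omega>\<bar> \<le> real K * mesh n} \<le> e"
  unfolding AE_all_countable using AE_small_increments_fixed[OF assms] by blast

end

section \<open>Time on the walls and comparison of two solutions\<close>

context wall_repulsion
begin

text \<open>For each root, \<open>\<alpha> \<bullet> x\<close> differs from
  \<open>\<alpha> \<bullet> b\<close> by an integral whose variation is bounded by \<open>V\<close>,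
  so the zero-set lemma applies. In contrast to the constructed flow, an arbitrary solution comes
  with no bound on 1 / (\<alpha> \<bullet> x), hence the recourse to the roughness of the
  noise.\<close>

lemma negligible_boundary_time_path:
  fixes b x :: "real \<Rightarrow> 'a"
  assumes x: "continuous_on {0..} x" and b: "continuous_on {0..} b"
    and cl: "\<And>t. 0 \<le> t \<Longrightarrow> x t \<in> closure C"
    and ai: "\<And>t. 0 \<le> t \<Longrightarrow> path_drift x absolutely_integrable_on {0..t}"
    and eq: "\<And>t. 0 \<le> t \<Longrightarrow> x t = x0 + b t + integral {0..t} (path_drift x)"
    and small: "\<And>\<alpha> (K :: nat) e. \<alpha> \<in> S \<Longrightarrow> 0 < e \<Longrightarrow> \<exists>\<^sub>F n in sequentially.
      measure lebesgue {s\<in>{0..real T}. \<bar>\<alpha> \<bullet> b (s + mesh n) - \<alpha> \<bullet> b s\<bar> \<le> real K * mesh n} \<le> e"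
  shows "negligible {s\<in>{0..real T}. x s \<notin> C}"
proof -
  have pi: "path_drift x integrable_on {0..t}" and ni: "(\<lambda>s. norm (path_drift x s)) integrable_on {0..t}" if "0 \<le> t" for t
    using ai[OF that] by (auto simp: absolutely_integrable_on_def)
  have "negligible {s\<in>{0..real T}. \<alpha> \<bullet> x s = 0}" if al: "\<alpha> \<in> S" for \<alpha>
  proof -
    define V where "V t = norm \<alpha> * integral {0..t} (\<lambda>s. norm (path_drift x s))" for t
    have split: "integral {0..t} f = integral {0..s} f + integral {s..t} f"
      if "0 \<le> s" "s \<le> t" "f integrable_on {0..t}" for s t and f :: "real \<Rightarrow> 'c::banach"
      using Henstock_Kurzweil_Integration.integral_combine[OF that] by simp
    have nst: "(\<lambda>s. norm (path_drift x s)) integrable_on {s..t}" "path_drift x integrable_on {s..t}"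
      if "0 \<le> s" "s \<le> t" for s t
      using that by (auto intro: integrable_subinterval_real[OF ni[of t]] integrable_subinterval_real[OF pi[of t]])
    show ?thesis
    proof (rule negligible_zero_set[where W="\<lambda>s. \<alpha> \<bullet> b s" and V=V])
      show "continuous_on {0..} V"
        unfolding V_def
        by (intro continuous_on_mult continuous_on_const continuous_on_Ici indefinite_integral_continuous_1 ni)
      show "continuous_on {0..} (\<lambda>s. \<alpha> \<bullet> x s)" "continuous_on {0..} (\<lambda>s. \<alpha> \<bullet> b s)"
        by (intro continuous_intros x b)+
    next
      fix s t :: real assume st: "0 \<le> s" "s \<le> t"
      have t0: "0 \<le> t" using st by simp
      have Vd: "V t - V s = norm \<alpha> * integral {s..t} (\<lambda>s. norm (path_drift x s))"
        unfolding V_def split[OF st ni[OF t0]] by (simp add: algebra_simps)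
      have "0 \<le> integral {s..t} (\<lambda>s. norm (path_drift x s))"
        by (intro integral_nonneg nst st) auto
      then have "0 \<le> V t - V s" unfolding Vd by simp
      then show "V s \<le> V t" by simp
      have "(\<alpha> \<bullet> x t - \<alpha> \<bullet> b t) - (\<alpha> \<bullet> x s - \<alpha> \<bullet> b s) = \<alpha> \<bullet> integral {s..t} (path_drift x)"
        unfolding eq[OF t0] eq[OF st(1)] split[OF st pi[OF t0]] by (simp add: inner_add_right)
      also have "\<bar>\<dots>\<bar> \<le> norm \<alpha> * norm (integral {s..t} (path_drift x))" by (rule Cauchy_Schwarz_ineq2)
      also have "\<dots> \<le> norm \<alpha> * integral {s..t} (\<lambda>s. norm (path_drift x s))"
        by (intro mult_left_mono integral_norm_bound_integral nst st) auto
      finally show "\<bar>(\<alpha> \<bullet> x t - \<alpha> \<bullet> b t) - (\<alpha> \<bullet> x s - \<alpha> \<bullet> b s)\<bar> \<le> V t - V s" unfolding Vd .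
    qed (use small[OF al] in auto)
  qed
  then have "negligible (\<Union>\<alpha>\<in>S. {s\<in>{0..real T}. \<alpha> \<bullet> x s = 0})"
    using fin by (intro negligible_Union) auto
  moreover have "{s\<in>{0..real T}. x s \<notin> C} \<subseteq> (\<Union>\<alpha>\<in>S. {s\<in>{0..real T}. \<alpha> \<bullet> x s = 0})"
  proof
    fix s assume s: "s \<in> {s\<in>{0..real T}. x s \<notin> C}"
    then obtain \<alpha> where "\<alpha> \<in> S" "\<alpha> \<bullet> x s \<le> 0" by (auto simp: weyl_chamber_def not_less)
    with closure_C_D[OF cl, of s \<alpha>] s show "s \<in> (\<Union>\<alpha>\<in>S. {s\<in>{0..real T}. \<alpha> \<bullet> x s = 0})" by force
  qed
  ultimately show ?thesis by (rule negligible_subset)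
qed

text \<open>The noise cancels in the difference. Once times with either path on a wall are
  discarded, monotonicity makes the integrand of the energy estimate nonpositive, so the bound there
  is zero.\<close>

lemma path_unique:
  assumes T: "0 \<le> T"
    and ai: "path_drift x absolutely_integrable_on {0..T}" "path_drift y absolutely_integrable_on {0..T}"
    and eq: "\<And>t. t \<in> {0..T} \<Longrightarrow> x t - y t = integral {0..t} (path_drift x) - integral {0..t} (path_drift y)"
    and neg: "negligible {s\<in>{0..T}. x s \<notin> C}" "negligible {s\<in>{0..T}. y s \<notin> C}"
  shows "x T = y T"
proof -
  \<comment> \<open>Agrees with the drift difference off a null set. The value zero elsewhere makes
    the sign condition hold at every time, as the energy estimate demands.\<close>
  define g where "g s = (if x s \<in> C \<and> y s \<in> C then path_drift x s - path_drift y s else 0)" for s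
  let ?N = "{s\<in>{0..T}. x s \<notin> C} \<union> {s\<in>{0..T}. y s \<notin> C}"
  have N: "negligible ?N" using neg by (rule negligible_Un)
  have di: "(\<lambda>s. path_drift x s - path_drift y s) absolutely_integrable_on {0..T}"
    using ai by (intro set_integral_diff)
  have ge: "g s = path_drift x s - path_drift y s" if "s \<in> {0..T} - ?N" for s
    using that by (auto simp: g_def)
  have gai: "g absolutely_integrable_on {0..T}"
    by (rule absolutely_integrable_spike[OF di N ge])
  have xy: "integral {0..t} g = x t - y t" if t: "t \<in> {0..T}" for t
  proof -
    have i: "path_drift x integrable_on {0..t}" "path_drift y integrable_on {0..t}"
      using ai t by (auto simp: absolutely_integrable_on_def intro: integrable_subinterval_real)
    have "integral {0..t} g = integral {0..t} (\<lambda>s. path_drift x s - path_drift y s)"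
      by (rule integral_spike[OF N]) (use t in \<open>auto simp: g_def\<close>)
    also have "\<dots> = x t - y t" unfolding eq[OF t] by (rule integral_diff[OF i])
    finally show ?thesis .
  qed
  have "(norm (integral {0..T} g))\<^sup>2 \<le> 2 * integral {0..T} (\<lambda>s. 0 :: real)"
  proof (rule energy_estimate[OF T gai])
    fix s assume s: "s \<in> {0..T}"
    show "integral {0..s} g \<bullet> g s \<le> 0"
      unfolding xy[OF s] using drift_mono[of "x s" "y s"] by (auto simp: g_def path_drift_def)
  qed auto
  then show ?thesis using xy[of T] T by simp
qed

end

context brownian_walls
begin

lemma solution_unique:
  assumes X: "sde_solution M G C (grad (Phi k S)) X0 B X" and Y: "sde_solution M G C (grad (Phi k S)) X0 B Y"
  shows "AE \<omega> in M. \<forall>t\<ge>0. X t \<omega> = Y t \<omega>"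
proof -
  have "AE \<omega> in M. \<forall>\<alpha>\<in>S. \<forall>T K :: nat. \<forall>e>0. \<exists>\<^sub>F n in sequentially.
    measure lebesgue {s\<in>{0..real T}. \<bar>\<alpha> \<bullet> B (s + mesh n) \<omega> - \<alpha> \<bullet> B s \<omega>\<bar> \<le> real K * mesh n} \<le> e"
    using nonzero by (intro AE_finite_allI[OF fin] AE_small_increments) auto
  moreover have "AE \<omega> in M. continuous_on {0..} (\<lambda>t. B t \<omega>)"
    using brownian unfolding brownian_motion_def by blast
  moreover have "AE \<omega> in M. \<forall>t\<ge>0. set_integrable lborel {s\<in>{0..t}. X s \<omega> \<in> C} (\<lambda>s. grad (Phi k S) (X s \<omega>)) \<and>
      X t \<omega> = X0 \<omega> + B t \<omega> - (LINT s:{s\<in>{0..t}. X s \<omega> \<in> C}|lborel. grad (Phi k S) (X s \<omega>))"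
    using X unfolding sde_solution_def by blast
  moreover have "AE \<omega> in M. \<forall>t\<ge>0. set_integrable lborel {s\<in>{0..t}. Y s \<omega> \<in> C} (\<lambda>s. grad (Phi k S) (Y s \<omega>)) \<and>
      Y t \<omega> = X0 \<omega> + B t \<omega> - (LINT s:{s\<in>{0..t}. Y s \<omega> \<in> C}|lborel. grad (Phi k S) (Y s \<omega>))"
    using Y unfolding sde_solution_def by blast
  ultimately show ?thesis using AE_space
  proof eventually_elim
    fix \<omega>
    assume small: "\<forall>\<alpha>\<in>S. \<forall>T K :: nat. \<forall>e>0. \<exists>\<^sub>F n in sequentially.
        measure lebesgue {s\<in>{0..real T}. \<bar>\<alpha> \<bullet> B (s + mesh n) \<omega> - \<alpha> \<bullet> B s \<omega>\<bar> \<le> real K * mesh n} \<le> e"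
      and bc: "continuous_on {0..} (\<lambda>t. B t \<omega>)"
      and Xs: "\<forall>t\<ge>0. set_integrable lborel {s\<in>{0..t}. X s \<omega> \<in> C} (\<lambda>s. grad (Phi k S) (X s \<omega>)) \<and>
        X t \<omega> = X0 \<omega> + B t \<omega> - (LINT s:{s\<in>{0..t}. X s \<omega> \<in> C}|lborel. grad (Phi k S) (X s \<omega>))"
      and Ys: "\<forall>t\<ge>0. set_integrable lborel {s\<in>{0..t}. Y s \<omega> \<in> C} (\<lambda>s. grad (Phi k S) (Y s \<omega>)) \<and>
        Y t \<omega> = X0 \<omega> + B t \<omega> - (LINT s:{s\<in>{0..t}. Y s \<omega> \<in> C}|lborel. grad (Phi k S) (Y s \<omega>))"
      and w: "\<omega> \<in> space M"
    let ?x = "\<lambda>t. X t \<omega>" and ?y = "\<lambda>t. Y t \<omega>"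
    have path: "path_drift x absolutely_integrable_on {0..t} \<and> x t = X0 \<omega> + B t \<omega> + integral {0..t} (path_drift x)"
      if "\<forall>t\<ge>0. set_integrable lborel {s\<in>{0..t}. x s \<in> C} (\<lambda>s. grad (Phi k S) (x s)) \<and>
        x t = X0 \<omega> + B t \<omega> - (LINT s:{s\<in>{0..t}. x s \<in> C}|lborel. grad (Phi k S) (x s))" "0 \<le> t" for x t
    proof -
      from that have si: "set_integrable lborel {s\<in>{0..t}. x s \<in> C} (\<lambda>s. grad (Phi k S) (x s))"
        and "x t = X0 \<omega> + B t \<omega> - (LINT s:{s\<in>{0..t}. x s \<in> C}|lborel. grad (Phi k S) (x s))" by blast+
      from this(2) show ?thesis unfolding path_drift_lborel(2)[OF si] using path_drift_lborel(1)[OF si] by simp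
    qed
    note px = path[OF Xs] and py = path[OF Ys]
    have Xc: "continuous_on {0..} ?x" "\<And>t. 0 \<le> t \<Longrightarrow> ?x t \<in> closure C"
      and Yc: "continuous_on {0..} ?y" "\<And>t. 0 \<le> t \<Longrightarrow> ?y t \<in> closure C"
      using X Y w unfolding sde_solution_def by blast+
    show "\<forall>t\<ge>0. X t \<omega> = Y t \<omega>"
    proof (intro allI impI)
      fix t :: real assume t: "0 \<le> t"
      obtain T :: nat where T: "t \<le> real T" using real_arch_simple by blast
      have sub: "{s\<in>{0..t}. x s \<notin> C} \<subseteq> {s\<in>{0..real T}. x s \<notin> C}" for x :: "real \<Rightarrow> 'a" using T by auto
      have smallT: "\<exists>\<^sub>F n in sequentially. measure lebesgue {s\<in>{0..real T}. \<bar>\<alpha> \<bullet> B (s + mesh n) \<omega> - \<alpha> \<bullet> B s \<omega>\<bar> \<le> real K * mesh n} \<le> e"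
        if "\<alpha> \<in> S" "0 < e" for \<alpha> e and K :: nat
        using small that by blast
      have "negligible {s\<in>{0..real T}. ?x s \<notin> C}"
        using Xc(1) bc Xc(2) conjunct1[OF px] conjunct2[OF px] smallT
        by (rule negligible_boundary_time_path[where x="?x" and b="\<lambda>t. B t \<omega>" and ?x0.0="X0 \<omega>" and T=T])
      then have nx: "negligible {s\<in>{0..t}. ?x s \<notin> C}" using sub by (rule negligible_subset)
      have "negligible {s\<in>{0..real T}. ?y s \<notin> C}"
        using Yc(1) bc Yc(2) conjunct1[OF py] conjunct2[OF py] smallT
        by (rule negligible_boundary_time_path[where x="?y" and b="\<lambda>t. B t \<omega>" and ?x0.0="X0 \<omega>" and T=T])
      then have ny: "negligible {s\<in>{0..t}. ?y s \<notin> C}" using sub by (rule negligible_subset)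
      show "X t \<omega> = Y t \<omega>"
      proof (rule path_unique[where x="?x" and y="?y", OF t conjunct1[OF px[OF t]] conjunct1[OF py[OF t]] _ nx ny])
        fix s assume "s \<in> {0..t}"
        then have s: "0 \<le> s" by simp
        show "?x s - ?y s = integral {0..s} (path_drift ?x) - integral {0..s} (path_drift ?y)"
          using conjunct2[OF px[OF s]] conjunct2[OF py[OF s]] by simp
      qed
    qed
  qed
qed

end

theorem theorem1:
  fixes R \<Delta> Rp C :: "'a::euclidean_space set"
    and k :: "'a \<Rightarrow> real"
    and M :: "'w measure"
    and F :: "real \<Rightarrow> 'w measure"
    and B :: "real \<Rightarrow> 'w \<Rightarrow> 'a"
    and X0 :: "'w \<Rightarrow> 'a"
  assumes "reduced_root_system R"
    and "simple_system R \<Delta>"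
    and "Rp = positive_roots R \<Delta>"
    and "C = weyl_chamber Rp"
    and "\<forall>w\<in>reflection_group R. \<forall>\<alpha>\<in>R. k (w \<alpha>) = k \<alpha>"
    and "\<forall>\<alpha>\<in>Rp. 0 < k \<alpha>"
    and "prob_space M"
    and "filtration_on M F"
    and "brownian_motion M F B"
    and "X0 \<in> borel_measurable (F 0)"
    and "AE \<omega> in M. X0 \<omega> \<in> C"
  shows "(\<exists>X. strong_solution M C (grad (Phi k Rp)) X0 B X) \<and>
         (\<forall>X Y. sde_solution M (augmented M F) C (grad (Phi k Rp)) X0 B X \<longrightarrow>
                sde_solution M (augmented M F) C (grad (Phi k Rp)) X0 B Y \<longrightarrow>
                (AE \<omega> in M. \<forall>t\<ge>0. X t \<omega> = Y t \<omega>))"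
proof -
  have sub: "Rp \<subseteq> R" using assms(3) by (auto simp: positive_roots_def)
  interpret prob_space M by (rule assms(7))
  \<comment> \<open>An empty chamber would contradict the almost sure membership of
    \<open>X0\<close>, since the whole space has probability one.\<close>
  have "weyl_chamber Rp \<noteq> {}"
  proof
    assume "weyl_chamber Rp = {}"
    then have "AE \<omega> in M. False" using assms(4,11) by simp
    then show False by simp
  qed
  then interpret brownian_walls Rp k M F B X0
    using assms sub by unfold_locales (auto simp: reduced_root_system_def intro: finite_subset)
  show ?thesis unfolding assms(4) using strong_solution_exists solution_unique by blast
qed

end
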